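(* Let $(M^7,\varphi)$ be a manifold with a $G_2$-structure, with torsion endomorphism $T\in\Gamma(\mathrm{End}(TM))$ and cross products $Cr$, $\chi$, and let $K_{\pi_7([Cr,\chi]^{FN})},\,L_{[\chi,\chi]^{FN}}\in\Gamma(\mathrm{End}(TM))$ be the associated endomorphism fields. Decompose $\mathrm{End}(TM)=V_1(M)\oplus V_7(M)\oplus V_{14}(M)\oplus V_{27}(M)$. Then for each $k\in\{1,7,14,27\}$, the $V_k(M)$-component of $T$ vanishes if and only if the $V_k(M)$-component of $K_{\pi_7([Cr,\chi]^{FN})}$ vanishes, if and only if the $V_k(M)$-component of $L_{[\chi,\chi]^{FN}}$ vanishes. Consequently, the $16$ Fernández–Gray classes of $G_2$-structures (the class attached to a sub-sum of $V_1(M)\oplus V_7(M)\oplus V_{14}(M)\oplus V_{27}(M)$ consists of those $\varphi$ for which $T$ is a section of that sub-sum) are characterized as follows: for each choice of $A\in\{T,\,K_{\pi_7([Cr,\chi]^{FN})},\,L_{[\chi,\chi]^{FN}}\}$, the $G_2$-structure belongs to the given class if and only if $A$ satisfies the stated relation: - $V_1\oplus V_7\oplus V_{14}\oplus V_{27}$: no relation; - $V_7\oplus V_{14}\oplus V_{27}$: $\mathrm{tr}(A)=0$; - $V_1\oplus V_{14}\oplus V_{27}$: $\sigma_A\in\Omega^2_{14}(M)$; - $V_1\oplus V_7\oplus V_{27}$: $\sigma_A\in\Omega^2_7(M)$; - $V_1\oplus V_7\oplus V_{14}$: $A+A^\top-\frac27\mathrm{tr}(A)\,\mathrm{id}_{TM}=0$;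 - $V_{14}\oplus V_{27}$: $\sigma_A\in\Omega^2_{14}(M)$ and $\mathrm{tr}(A)=0$; - $V_7\oplus V_{27}$: $\sigma_A\in\Omega^2_7(M)$ and $\mathrm{tr}(A)=0$; - $V_7\oplus V_{14}$: $A+A^\top=0$; - $V_1\oplus V_{27}$: $A-A^\top=0$; - $V_1\oplus V_{14}$: $A+A^\top-\frac27\mathrm{tr}(A)\,\mathrm{id}_{TM}=0$ and $\sigma_A\in\Omega^2_{14}(M)$; - $V_1\oplus V_7$: $A+A^\top-\frac27\mathrm{tr}(A)\,\mathrm{id}_{TM}=0$ and $\sigma_A\in\Omega^2_7(M)$; - $V_{27}$: $A-A^\top=0$ and $\mathrm{tr}(A)=0$; - $V_{14}$: $A+A^\top=0$ and $\sigma_A\in\Omega^2_{14}(M)$; - $V_7$: $A+A^\top=0$ and $\sigma_A\in\Omega^2_7(M)$; - $V_1$: $A=\frac17\mathrm{tr}(A)\,\mathrm{id}_{TM}$; - $\{0\}$: $A=0$.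
   Context: All objects are smooth; $\Omega^k(M,TM)$ denotes $TM$-valued $k$-forms. $G_2$-structure: on an oriented $7$-manifold $M$, a $3$-form $\varphi$ such that at each $p$ there is a positively oriented basis $(e_i)_{i=1}^7$ of $T_pM$ with dual basis $(e^i)$ (a $G_2$-frame) with $\varphi_p=e^{123}+e^{145}+e^{167}+e^{246}-e^{257}-e^{347}-e^{356}$, $e^{i_1\cdots i_k}=e^{i_1}\wedge\cdots\wedge e^{i_k}$. There is a unique Riemannian metric $g=g_\varphi$ for which every $G_2$-frame is orthonormal; $\ast$ is its Hodge star and $\nabla$ its Levi-Civita connection; $\ast\varphi=e^{4567}+e^{2367}+e^{2345}+e^{1357}-e^{1346}-e^{1256}-e^{1247}$. Torsion endomorphism: the section $T\in\Omega^1(M,TM)=\Gamma(\mathrm{End}(TM))$ determined by $\nabla_v\varphi=\imath_{T(v)}\ast\varphi$ for all $v\in TM$ (it exists, and then $\nabla_v\ast\varphi=-T(v)^\flat\wedge\varphi$). Cross products: with $\delta_g(\Psi):=\sum_i(\imath_{e_i}\Psi)\otimes(e^i)^\#$, $Cr:=\delta_g(\varphi)\in\Omega^2(M,TM)$ and $\chi:=-\delta_g(\ast\varphi)\in\Omega^3(M,TM)$. Frölicher–Nijenhuis bracket: the $\mathbb{R}$-bilinear bracket on $\Omega^*(M,TM)$ with $[\alpha\otimes X_1,\beta\otimes X_2]^{FN}=\alpha\wedge\beta\otimes[X_1,X_2]+\alpha\wedge\mathcal{L}_{X_1}\beta\otimes X_2-\mathcal{L}_{X_2}\alpha\wedge\beta\otimes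 X_1+(-1)^k(d\alpha\wedge(\imath_{X_1}\beta)\otimes X_2+(\imath_{X_2}\alpha)\wedge d\beta\otimes X_1)$ for $\alpha\in\Omega^k(M)$, $\beta\in\Omega^l(M)$ and vector fields $X_1,X_2$. Form decompositions: pointwise $\Lambda^5T^*M=\Lambda^5_7\oplus\Lambda^5_{14}$ with $\Lambda^5_7=\{\ast\varphi\wedge v^\flat\mid v\in TM\}$ and $\Lambda^5_{14}=\{\alpha\mid\alpha\wedge(\imath_v\varphi)=0\ \forall v\}$; $\pi_7$ is the projection of $\Lambda^5T^*M\otimes TM$ onto $\Lambda^5_7T^*M\otimes TM$ along $\Lambda^5_{14}T^*M\otimes TM$. Also $\Lambda^2T^*M=\Lambda^2_7\oplus\Lambda^2_{14}$ with $\Lambda^2_7=\{\imath_v\varphi\mid v\in TM\}$ and $\Lambda^2_{14}=\{\alpha\mid\ast\varphi\wedge\alpha=0\}$; $\Omega^2_k(M)$ is the space of sections of $\Lambda^2_k$. Bundle isomorphisms: $K:\Lambda^5_7T^*M\otimes TM\to T^*M\otimes TM=\mathrm{End}(TM)$, $(\ast\varphi\wedge v^\flat)\otimes w\mapsto v^\flat\otimes w$, and $L:\Lambda^6T^*M\otimes TM\to T^*M\otimes TM$, $(\ast v^\flat)\otimes w\mapsto v^\flat\otimes w$. $K_{\pi_7([Cr,\chi]^{FN})}$ and $L_{[\chi,\chi]^{FN}}$ denote the images of $\pi_7([Cr,\chi]^{FN})$ and $[\chi,\chi]^{FN}$ under $K$ and $L$. For $A=\sum a_{ij}e^i\otimes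 e_j\in\mathrm{End}(TM)$ ($(e_i)$ orthonormal), $A^\top$ is the transpose and $\sigma_A:=\sum_{i,j}a_{ij}e^{i}\wedge e^j$. In the decomposition of $\mathrm{End}(TM)$, $V_1(M)$ is spanned by $\mathrm{id}_{TM}$, $V_{27}(M)$ consists of the trace-free symmetric endomorphisms, and $V_7(M)$, $V_{14}(M)$ of the skew-symmetric endomorphisms $A$ with $\sigma_A\in\Lambda^2_7$, respectively $\sigma_A\in\Lambda^2_{14}$. *)

theory Defs
  imports "HOL-Analysis.Analysis"
begin

section \<open>Smooth maps and oriented smooth 7-manifolds\<close>

text \<open>Only used on open sets \<open>S\<close>.\<close>

primrec Ck_on :: "nat \<Rightarrow> (real^7 \<Rightarrow> 'b::real_normed_vector) \<Rightarrow> (real^7) set \<Rightarrow> bool" where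
  "Ck_on 0 f S \<longleftrightarrow> continuous_on S f"
| "Ck_on (Suc n) f S \<longleftrightarrow> f differentiable_on S \<and>
     (\<forall>v. Ck_on n (\<lambda>x. frechet_derivative f (at x) v) S)"

definition smooth_on :: "(real^7) set \<Rightarrow> (real^7 \<Rightarrow> 'b::real_normed_vector) \<Rightarrow> bool" where
  "smooth_on S f \<longleftrightarrow> (\<forall>n. Ck_on n f S)"

type_synonym 'm chart = "'m set \<times> ('m \<Rightarrow> real^7)"

definition chart_image :: "'m chart \<Rightarrow> (real^7) set" where
  "chart_image c = snd c ` fst c"

definition overlap :: "'m chart \<Rightarrow> 'm chart \<Rightarrow> (real^7) set" where
  "overlap c d = snd c ` (fst c \<inter> fst d)"

definition transition :: "'m chart \<Rightarrow> 'm chart \<Rightarrow> real^7 \<Rightarrow> real^7" where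
  "transition c d = snd d \<circ> inv_into (fst c) (snd c)"

abbreviation deriv_at :: "(real^7 \<Rightarrow> 'b::real_normed_vector) \<Rightarrow> real^7 \<Rightarrow> real^7 \<Rightarrow> 'b" where
  "deriv_at f x \<equiv> frechet_derivative f (at x)"

text \<open>\<open>A\<close> is a smooth oriented atlas of the topological space \<open>M\<close>; it need not be maximal, as any
  such atlas determines the smooth structure and the orientation.\<close>

definition oriented_manifold :: "'m topology \<Rightarrow> 'm chart set \<Rightarrow> bool" where
  "oriented_manifold M A \<longleftrightarrow>
     Hausdorff_space M \<and> second_countable M \<and> (\<Union>c\<in>A. fst c) = topspace M \<and>
     (\<forall>c\<in>A. openin M (fst c) \<and> open (chart_image c) \<and>
        homeomorphic_map (subtopology M (fst c)) (top_of_set (chart_image c)) (snd c)) \<and>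
     (\<forall>c\<in>A. \<forall>d\<in>A. smooth_on (overlap c d) (transition c d) \<and>
        (\<forall>x\<in>overlap c d. det (matrix (deriv_at (transition c d) x)) > 0))"

text \<open>A chart \<open>c\<close> identifies each tangent space with \<open>real^7\<close> through the coordinate basis
  \<open>\<partial>\<^sub>i = axis i 1\<close>. A tensor field on \<open>M\<close> is the family of its local representatives, one for each
  chart, which are functions of the coordinates \<open>x \<in> chart_image c\<close> and which obey the tensorial
  transformation law. Everything derived from such a family below (metric constructions, covariant
  derivative, brackets) is computed from the representative in the chart at hand.\<close>

definition on_M :: "'m chart set \<Rightarrow> ('m chart \<Rightarrow> real^7 \<Rightarrow> bool) \<Rightarrow> bool" where
  "on_M A P \<longleftrightarrow> (\<forall>c\<in>A. \<forall>x\<in>chart_image c. P c x)"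

section \<open>Exterior algebra of a tangent space\<close>

text \<open>A \<open>k\<close>-form is an alternating multilinear function of lists of \<open>k\<close> vectors, extended by \<open>0\<close> to
  lists of any other length. Values in \<open>real\<close> give \<open>\<Lambda>\<^sup>kT\<^sup>*M\<close>, values in \<open>real^7\<close> give
  \<open>\<Lambda>\<^sup>kT\<^sup>*M \<otimes> TM\<close>.\<close>

definition is_form :: "nat \<Rightarrow> ((real^7) list \<Rightarrow> 'b::real_vector) \<Rightarrow> bool" where
  "is_form k \<alpha> \<longleftrightarrow>
     (\<forall>vs. length vs \<noteq> k \<longrightarrow> \<alpha> vs = 0) \<and>
     (\<forall>vs i. length vs = k \<and> i < k \<longrightarrow> linear (\<lambda>w. \<alpha> (vs[i := w]))) \<and>
     (\<forall>vs. length vs = k \<and> \<not> distinct vs \<longrightarrow> \<alpha> vs = 0)"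

text \<open>Sum over shuffles: \<open>S\<close> is the set of positions filled into \<open>\<alpha>\<close>. Since forms vanish on lists
  of the wrong length, the degrees need not be mentioned. Normalised so that
  \<open>(\<alpha> \<and> \<beta>)(u, v) = \<alpha>(u)\<beta>(v) - \<alpha>(v)\<beta>(u)\<close> for 1-forms.\<close>

definition wedge :: "((real^7) list \<Rightarrow> real) \<Rightarrow> ((real^7) list \<Rightarrow> real) \<Rightarrow> (real^7) list \<Rightarrow> real"
    (infixr "\<and>\<^sub>f" 65) where
  "(\<alpha> \<and>\<^sub>f \<beta>) vs = (\<Sum>S\<in>Pow {..<length vs}.
     (-1) ^ card {(i, j). i \<in> S \<and> j \<in> {..<length vs} - S \<and> j < i} *
     \<alpha> (nths vs S) * \<beta> (nths vs (- S)))"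

definition interior :: "real^7 \<Rightarrow> ((real^7) list \<Rightarrow> 'b) \<Rightarrow> (real^7) list \<Rightarrow> 'b" where
  "interior v \<alpha> vs = \<alpha> (v # vs)"

definition one_form :: "(real^7 \<Rightarrow> real) \<Rightarrow> (real^7) list \<Rightarrow> real" where
  "one_form l vs = (case vs of [v] \<Rightarrow> l v | _ \<Rightarrow> 0)"

text \<open>For \<open>\<theta> i = e\<^sup>i\<close>, \<open>wedge_of \<theta> [i, j, \<dots>]\<close> is the form \<open>e\<^sup>i \<and> e\<^sup>j \<and> \<dots>\<close>. Indices are taken in the type
  \<open>7\<close>, whose elements are \<open>1, \<dots>, 7\<close> with \<open>7 = 0\<close>.\<close>

primrec wedge_of :: "(7 \<Rightarrow> real^7 \<Rightarrow> real) \<Rightarrow> 7 list \<Rightarrow> (real^7) list \<Rightarrow> real" where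
  "wedge_of \<theta> [] = (\<lambda>vs. if vs = [] then 1 else 0)"
| "wedge_of \<theta> (i # is) = one_form (\<theta> i) \<and>\<^sub>f wedge_of \<theta> is"

section \<open>Metric notions on a tangent space\<close>

definition positive_basis :: "(7 \<Rightarrow> real^7) \<Rightarrow> bool" where
  "positive_basis e \<longleftrightarrow> det (\<chi> i j. e j $ i) > 0"

definition orthonormal :: "(real^7 \<Rightarrow> real^7 \<Rightarrow> real) \<Rightarrow> (7 \<Rightarrow> real^7) \<Rightarrow> bool" where
  "orthonormal g e \<longleftrightarrow> (\<forall>i j. g (e i) (e j) = (if i = j then 1 else 0))"

text \<open>A fixed choice of positively oriented orthonormal basis; the notions defined with it do not
  depend on the choice.\<close>

definition onb :: "(real^7 \<Rightarrow> real^7 \<Rightarrow> real) \<Rightarrow> 7 \<Rightarrow> real^7" where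
  "onb g = (SOME e. orthonormal g e \<and> positive_basis e)"

definition flat :: "(real^7 \<Rightarrow> real^7 \<Rightarrow> real) \<Rightarrow> real^7 \<Rightarrow> (real^7) list \<Rightarrow> real" where
  "flat g v = one_form (g v)"

definition vol :: "(real^7 \<Rightarrow> real^7 \<Rightarrow> real) \<Rightarrow> (real^7) list \<Rightarrow> real" where
  "vol g = wedge_of (\<lambda>i. g (onb g i)) [1, 2, 3, 4, 5, 6, 7]"

text \<open>The Hodge star, in index notation
  \<open>(\<star>\<alpha>)\<^sub>j\<^sub>1\<^sub>\<dots>\<^sub>j\<^sub>m = 1/k! \<Sum> \<alpha>\<^sub>i\<^sub>1\<^sub>\<dots>\<^sub>i\<^sub>k vol\<^sub>i\<^sub>1\<^sub>\<dots>\<^sub>i\<^sub>k\<^sub>j\<^sub>1\<^sub>\<dots>\<^sub>j\<^sub>m\<close> with \<open>k + m = 7\<close>.\<close>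

definition hodge :: "(real^7 \<Rightarrow> real^7 \<Rightarrow> real) \<Rightarrow> ((real^7) list \<Rightarrow> real) \<Rightarrow> (real^7) list \<Rightarrow> real" where
  "hodge g \<alpha> vs = (\<Sum>is | length is = 7 - length vs.
     \<alpha> (map (onb g) is) * vol g (map (onb g) is @ vs)) / fact (7 - length vs)"

text \<open>For an orthonormal basis \<open>(e\<^sup>i)\<^sup># = e\<^sub>i\<close>.\<close>

definition delta :: "(real^7 \<Rightarrow> real^7 \<Rightarrow> real) \<Rightarrow> ((real^7) list \<Rightarrow> real) \<Rightarrow> (real^7) list \<Rightarrow> real^7" where
  "delta g \<Psi> vs = (\<Sum>i\<in>UNIV. interior (onb g i) \<Psi> vs *\<^sub>R onb g i)"

text \<open>The coefficients \<open>a\<^sub>i\<^sub>j\<close> of an endomorphism \<open>B = \<Sum> a\<^sub>i\<^sub>j e\<^sup>i \<otimes> e\<^sub>j\<close>, that is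
  \<open>B e\<^sub>i = \<Sum>\<^sub>j a\<^sub>i\<^sub>j e\<^sub>j\<close>.\<close>

definition coeff :: "(real^7 \<Rightarrow> real^7 \<Rightarrow> real) \<Rightarrow> (real^7 \<Rightarrow> real^7) \<Rightarrow> 7 \<Rightarrow> 7 \<Rightarrow> real" where
  "coeff g B i j = g (B (onb g i)) (onb g j)"

definition endo_transpose ::
    "(real^7 \<Rightarrow> real^7 \<Rightarrow> real) \<Rightarrow> (real^7 \<Rightarrow> real^7) \<Rightarrow> real^7 \<Rightarrow> real^7" where
  "endo_transpose g B v =
     (\<Sum>i\<in>UNIV. \<Sum>j\<in>UNIV. (coeff g B j i * g (onb g i) v) *\<^sub>R onb g j)"

definition endo_trace :: "(real^7 \<Rightarrow> real^7) \<Rightarrow> real" where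
  "endo_trace B = trace (matrix B)"

definition sigma_form ::
    "(real^7 \<Rightarrow> real^7 \<Rightarrow> real) \<Rightarrow> (real^7 \<Rightarrow> real^7) \<Rightarrow> (real^7) list \<Rightarrow> real" where
  "sigma_form g B vs = (\<Sum>i\<in>UNIV. \<Sum>j\<in>UNIV. coeff g B i j * wedge_of (\<lambda>i. g (onb g i)) [i, j] vs)"

section \<open>G2 linear algebra\<close>

definition dual_basis :: "(7 \<Rightarrow> real^7) \<Rightarrow> 7 \<Rightarrow> real^7 \<Rightarrow> real" where
  "dual_basis e i v = representation (range e) v (e i)"

definition G2_frame :: "((real^7) list \<Rightarrow> real) \<Rightarrow> (7 \<Rightarrow> real^7) \<Rightarrow> bool" where
  "G2_frame \<phi> e \<longleftrightarrow> positive_basis e \<and>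
     (let \<epsilon> = wedge_of (dual_basis e) in
      \<phi> = (\<lambda>vs. \<epsilon> [1,2,3] vs + \<epsilon> [1,4,5] vs + \<epsilon> [1,6,7] vs + \<epsilon> [2,4,6] vs
               - \<epsilon> [2,5,7] vs - \<epsilon> [3,4,7] vs - \<epsilon> [3,5,6] vs))"

definition Lambda2_7 :: "((real^7) list \<Rightarrow> real) \<Rightarrow> ((real^7) list \<Rightarrow> real) set" where
  "Lambda2_7 \<phi> = {interior v \<phi> | v. True}"

definition Lambda2_14 ::
    "(real^7 \<Rightarrow> real^7 \<Rightarrow> real) \<Rightarrow> ((real^7) list \<Rightarrow> real) \<Rightarrow> ((real^7) list \<Rightarrow> real) set" where
  "Lambda2_14 g \<phi> = {\<alpha>. is_form 2 \<alpha> \<and> hodge g \<phi> \<and>\<^sub>f \<alpha> = (\<lambda>vs. 0)}"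

definition Lambda5_7 ::
    "(real^7 \<Rightarrow> real^7 \<Rightarrow> real) \<Rightarrow> ((real^7) list \<Rightarrow> real) \<Rightarrow> ((real^7) list \<Rightarrow> real) set" where
  "Lambda5_7 g \<phi> = {hodge g \<phi> \<and>\<^sub>f flat g v | v. True}"

definition Lambda5_14 :: "((real^7) list \<Rightarrow> real) \<Rightarrow> ((real^7) list \<Rightarrow> real) set" where
  "Lambda5_14 \<phi> = {\<alpha>. is_form 5 \<alpha> \<and> (\<forall>v. \<alpha> \<and>\<^sub>f interior v \<phi> = (\<lambda>vs. 0))}"

text \<open>\<open>W \<otimes> TM\<close> for a linear subspace \<open>W\<close> of forms, by expansion in the basis \<open>\<partial>\<^sub>i\<close> of the tangent
  space.\<close>

definition tensor_TM :: "((real^7) list \<Rightarrow> real) set \<Rightarrow> ((real^7) list \<Rightarrow> real^7) set" where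
  "tensor_TM W = {\<Psi>. \<forall>i. (\<lambda>vs. \<Psi> vs $ i) \<in> W}"

definition pi7 :: "(real^7 \<Rightarrow> real^7 \<Rightarrow> real) \<Rightarrow> ((real^7) list \<Rightarrow> real) \<Rightarrow>
    ((real^7) list \<Rightarrow> real^7) \<Rightarrow> (real^7) list \<Rightarrow> real^7" where
  "pi7 g \<phi> \<Psi> = (THE \<Theta>. \<Theta> \<in> tensor_TM (Lambda5_7 g \<phi>) \<and>
     (\<lambda>vs. \<Psi> vs - \<Theta> vs) \<in> tensor_TM (Lambda5_14 \<phi>))"

text \<open>The linear maps with \<open>(\<star>\<phi> \<and> v\<^sup>\<flat>) \<otimes> w \<mapsto> v\<^sup>\<flat> \<otimes> w\<close> and \<open>(\<star>v\<^sup>\<flat>) \<otimes> w \<mapsto> v\<^sup>\<flat> \<otimes> w\<close>, where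
  \<open>v\<^sup>\<flat> \<otimes> w\<close> is the endomorphism \<open>u \<mapsto> g(v, u) w\<close>. As the tangent space has dimension 7, every
  element of the respective domain is a sum of seven such generators.\<close>

definition K_iso :: "(real^7 \<Rightarrow> real^7 \<Rightarrow> real) \<Rightarrow> ((real^7) list \<Rightarrow> real) \<Rightarrow>
    ((real^7) list \<Rightarrow> real^7) \<Rightarrow> real^7 \<Rightarrow> real^7" where
  "K_iso g \<phi> \<Psi> = (THE B. \<exists>v w :: 7 \<Rightarrow> real^7.
     \<Psi> = (\<lambda>vs. \<Sum>i\<in>UNIV. (hodge g \<phi> \<and>\<^sub>f flat g (v i)) vs *\<^sub>R w i) \<and>
     B = (\<lambda>u. \<Sum>i\<in>UNIV. g (v i) u *\<^sub>R w i))"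

definition L_iso :: "(real^7 \<Rightarrow> real^7 \<Rightarrow> real) \<Rightarrow>
    ((real^7) list \<Rightarrow> real^7) \<Rightarrow> real^7 \<Rightarrow> real^7" where
  "L_iso g \<Psi> = (THE B. \<exists>v w :: 7 \<Rightarrow> real^7.
     \<Psi> = (\<lambda>vs. \<Sum>i\<in>UNIV. hodge g (flat g (v i)) vs *\<^sub>R w i) \<and>
     B = (\<lambda>u. \<Sum>i\<in>UNIV. g (v i) u *\<^sub>R w i))"

text \<open>The summands of \<open>End(TM) = V\<^sub>1 \<oplus> V\<^sub>7 \<oplus> V\<^sub>1\<^sub>4 \<oplus> V\<^sub>2\<^sub>7\<close>.\<close>

definition V1 :: "(real^7 \<Rightarrow> real^7) set" where
  "V1 = {\<lambda>v. r *\<^sub>R v | r. True}"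

definition V7 ::
    "(real^7 \<Rightarrow> real^7 \<Rightarrow> real) \<Rightarrow> ((real^7) list \<Rightarrow> real) \<Rightarrow> (real^7 \<Rightarrow> real^7) set" where
  "V7 g \<phi> = {B. linear B \<and> endo_transpose g B = (\<lambda>v. - B v) \<and> sigma_form g B \<in> Lambda2_7 \<phi>}"

definition V14 ::
    "(real^7 \<Rightarrow> real^7 \<Rightarrow> real) \<Rightarrow> ((real^7) list \<Rightarrow> real) \<Rightarrow> (real^7 \<Rightarrow> real^7) set" where
  "V14 g \<phi> = {B. linear B \<and> endo_transpose g B = (\<lambda>v. - B v) \<and> sigma_form g B \<in> Lambda2_14 g \<phi>}"

definition V27 :: "(real^7 \<Rightarrow> real^7 \<Rightarrow> real) \<Rightarrow> (real^7 \<Rightarrow> real^7) set" where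
  "V27 g = {B. linear B \<and> endo_transpose g B = B \<and> endo_trace B = 0}"

definition V_part :: "(real^7 \<Rightarrow> real^7 \<Rightarrow> real) \<Rightarrow> ((real^7) list \<Rightarrow> real) \<Rightarrow> nat \<Rightarrow>
    (real^7 \<Rightarrow> real^7) set" where
  "V_part g \<phi> k = (if k = 1 then V1 else if k = 7 then V7 g \<phi> else if k = 14 then V14 g \<phi>
     else if k = 27 then V27 g else {})"

definition V_sum :: "(real^7 \<Rightarrow> real^7 \<Rightarrow> real) \<Rightarrow> ((real^7) list \<Rightarrow> real) \<Rightarrow> nat set \<Rightarrow>
    (real^7 \<Rightarrow> real^7) set" where
  "V_sum g \<phi> I = {\<lambda>v. \<Sum>k\<in>I. a k v | a. \<forall>k\<in>I. a k \<in> V_part g \<phi> k}"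

definition V_component :: "(real^7 \<Rightarrow> real^7 \<Rightarrow> real) \<Rightarrow> ((real^7) list \<Rightarrow> real) \<Rightarrow> nat \<Rightarrow>
    (real^7 \<Rightarrow> real^7) \<Rightarrow> real^7 \<Rightarrow> real^7" where
  "V_component g \<phi> k B = (THE C. \<exists>a. (\<forall>j\<in>{1, 7, 14, 27}. a j \<in> V_part g \<phi> j) \<and>
     B = (\<lambda>v. \<Sum>j\<in>{1, 7, 14, 27}. a j v) \<and> C = a k)"

section \<open>Differential calculus in a chart\<close>

definition lie_bracket ::
    "(real^7 \<Rightarrow> real^7) \<Rightarrow> (real^7 \<Rightarrow> real^7) \<Rightarrow> real^7 \<Rightarrow> real^7" where
  "lie_bracket X Y x = deriv_at Y x (X x) - deriv_at X x (Y x)"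

definition ext_deriv ::
    "(real^7 \<Rightarrow> (real^7) list \<Rightarrow> real) \<Rightarrow> real^7 \<Rightarrow> (real^7) list \<Rightarrow> real" where
  "ext_deriv \<alpha> x vs = (\<Sum>i<length vs.
     (-1) ^ i * deriv_at (\<lambda>y. \<alpha> y (take i vs @ drop (Suc i) vs)) x (vs ! i))"

definition lie_deriv :: "(real^7 \<Rightarrow> real^7) \<Rightarrow> (real^7 \<Rightarrow> (real^7) list \<Rightarrow> real) \<Rightarrow>
    real^7 \<Rightarrow> (real^7) list \<Rightarrow> real" where
  "lie_deriv X \<alpha> x vs = deriv_at (\<lambda>y. \<alpha> y vs) x (X x) +
     (\<Sum>i<length vs. \<alpha> x (vs[i := deriv_at X x (vs ! i)]))"

text \<open>The Levi-Civita connection is \<open>\<nabla>\<^sub>u V = DV(u) + \<Gamma>(u, V)\<close>, where \<open>\<Gamma>\<close> is the unique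
  symmetric (torsion-free) bilinear map for which the metric is parallel.\<close>

definition levi_civita ::
    "(real^7 \<Rightarrow> real^7 \<Rightarrow> real^7 \<Rightarrow> real) \<Rightarrow> real^7 \<Rightarrow> real^7 \<Rightarrow> real^7 \<Rightarrow> real^7" where
  "levi_civita g x = (THE \<Gamma>. bilinear \<Gamma> \<and> (\<forall>u v. \<Gamma> u v = \<Gamma> v u) \<and>
     (\<forall>u v w. deriv_at (\<lambda>y. g y v w) x u = g x (\<Gamma> u v) w + g x v (\<Gamma> u w)))"

definition nabla :: "(real^7 \<Rightarrow> real^7 \<Rightarrow> real^7 \<Rightarrow> real) \<Rightarrow> (real^7 \<Rightarrow> (real^7) list \<Rightarrow> real) \<Rightarrow>
    real^7 \<Rightarrow> real^7 \<Rightarrow> (real^7) list \<Rightarrow> real" where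
  "nabla g \<alpha> x v vs = deriv_at (\<lambda>y. \<alpha> y vs) x v -
     (\<Sum>i<length vs. \<alpha> x (vs[i := levi_civita g x v (vs ! i)]))"

text \<open>\<open>[\<alpha> \<otimes> X, \<beta> \<otimes> Y]\<^sup>F\<^sup>N\<close> for a \<open>k\<close>-form \<open>\<alpha>\<close> and a form \<open>\<beta>\<close> of any degree.\<close>

definition fn_decomposable :: "nat \<Rightarrow>
    (real^7 \<Rightarrow> (real^7) list \<Rightarrow> real) \<Rightarrow> (real^7 \<Rightarrow> real^7) \<Rightarrow>
    (real^7 \<Rightarrow> (real^7) list \<Rightarrow> real) \<Rightarrow> (real^7 \<Rightarrow> real^7) \<Rightarrow>
    real^7 \<Rightarrow> (real^7) list \<Rightarrow> real^7" where
  "fn_decomposable k \<alpha> X \<beta> Y x vs =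
     (\<alpha> x \<and>\<^sub>f \<beta> x) vs *\<^sub>R lie_bracket X Y x
     + (\<alpha> x \<and>\<^sub>f lie_deriv X \<beta> x) vs *\<^sub>R Y x
     - (lie_deriv Y \<alpha> x \<and>\<^sub>f \<beta> x) vs *\<^sub>R X x
     + (-1) ^ k *\<^sub>R ((ext_deriv \<alpha> x \<and>\<^sub>f interior (X x) (\<beta> x)) vs *\<^sub>R Y x
                  + (interior (Y x) (\<alpha> x) \<and>\<^sub>f ext_deriv \<beta> x) vs *\<^sub>R X x)"

text \<open>On a chart domain every \<open>TM\<close>-valued form is a sum of decomposables, \<open>\<Phi> = \<Sum>\<^sub>i \<Phi>\<^sup>i \<otimes> \<partial>\<^sub>i\<close> and
  \<open>\<Psi> = \<Sum>\<^sub>j \<Psi>\<^sup>j \<otimes> \<partial>\<^sub>j\<close>, and bilinearity determines the (local) Froelicher--Nijenhuis bracket. \<open>k\<close> is the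
  degree of \<open>\<Phi>\<close>.\<close>

definition fn_bracket :: "nat \<Rightarrow> (real^7 \<Rightarrow> (real^7) list \<Rightarrow> real^7) \<Rightarrow>
    (real^7 \<Rightarrow> (real^7) list \<Rightarrow> real^7) \<Rightarrow> real^7 \<Rightarrow> (real^7) list \<Rightarrow> real^7" where
  "fn_bracket k \<Phi> \<Psi> x vs = (\<Sum>i\<in>UNIV. \<Sum>j\<in>UNIV.
     fn_decomposable k (\<lambda>y ws. \<Phi> y ws $ i) (\<lambda>y. axis i 1) (\<lambda>y ws. \<Psi> y ws $ j) (\<lambda>y. axis j 1) x vs)"

section \<open>G2-structures on manifolds\<close>

definition form_field ::
    "'m chart set \<Rightarrow> nat \<Rightarrow> ('m chart \<Rightarrow> real^7 \<Rightarrow> (real^7) list \<Rightarrow> real) \<Rightarrow> bool" where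
  "form_field A k \<alpha> \<longleftrightarrow>
     (\<forall>c\<in>A. (\<forall>x\<in>chart_image c. is_form k (\<alpha> c x)) \<and>
            (\<forall>vs. smooth_on (chart_image c) (\<lambda>x. \<alpha> c x vs))) \<and>
     (\<forall>c\<in>A. \<forall>d\<in>A. \<forall>x\<in>overlap c d. \<forall>vs.
        \<alpha> c x vs = \<alpha> d (transition c d x) (map (deriv_at (transition c d) x) vs))"

definition endo_field ::
    "'m chart set \<Rightarrow> ('m chart \<Rightarrow> real^7 \<Rightarrow> real^7 \<Rightarrow> real^7) \<Rightarrow> bool" where
  "endo_field A B \<longleftrightarrow>
     (\<forall>c\<in>A. (\<forall>x\<in>chart_image c. linear (B c x)) \<and>
            (\<forall>v. smooth_on (chart_image c) (\<lambda>x. B c x v))) \<and>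
     (\<forall>c\<in>A. \<forall>d\<in>A. \<forall>x\<in>overlap c d. \<forall>v.
        deriv_at (transition c d) x (B c x v) =
        B d (transition c d x) (deriv_at (transition c d) x v))"

definition riemannian_metric ::
    "'m chart set \<Rightarrow> ('m chart \<Rightarrow> real^7 \<Rightarrow> real^7 \<Rightarrow> real^7 \<Rightarrow> real) \<Rightarrow> bool" where
  "riemannian_metric A g \<longleftrightarrow>
     (\<forall>c\<in>A. (\<forall>x\<in>chart_image c. bilinear (g c x) \<and> (\<forall>u v. g c x u v = g c x v u) \<and>
               (\<forall>v. v \<noteq> 0 \<longrightarrow> g c x v v > 0)) \<and>
            (\<forall>u v. smooth_on (chart_image c) (\<lambda>x. g c x u v))) \<and>
     (\<forall>c\<in>A. \<forall>d\<in>A. \<forall>x\<in>overlap c d. \<forall>u v.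
        g c x u v = g d (transition c d x)
          (deriv_at (transition c d) x u) (deriv_at (transition c d) x v))"

definition G2_structure ::
    "'m chart set \<Rightarrow> ('m chart \<Rightarrow> real^7 \<Rightarrow> (real^7) list \<Rightarrow> real) \<Rightarrow> bool" where
  "G2_structure A \<phi> \<longleftrightarrow> form_field A 3 \<phi> \<and> on_M A (\<lambda>c x. \<exists>e. G2_frame (\<phi> c x) e)"

text \<open>\<open>g\<close> is the (unique) metric \<open>g\<^sub>\<phi>\<close>.\<close>

definition G2_metric :: "'m chart set \<Rightarrow> ('m chart \<Rightarrow> real^7 \<Rightarrow> (real^7) list \<Rightarrow> real) \<Rightarrow>
    ('m chart \<Rightarrow> real^7 \<Rightarrow> real^7 \<Rightarrow> real^7 \<Rightarrow> real) \<Rightarrow> bool" where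
  "G2_metric A \<phi> g \<longleftrightarrow> riemannian_metric A g \<and>
     on_M A (\<lambda>c x. \<forall>e. G2_frame (\<phi> c x) e \<longrightarrow> orthonormal (g c x) e)"

text \<open>\<open>T\<close> is the (unique) torsion endomorphism: \<open>\<nabla>\<^sub>v\<phi> = \<iota>\<^sub>T\<^sub>(\<^sub>v\<^sub>) \<star>\<phi>\<close>.\<close>

definition torsion_endomorphism :: "'m chart set \<Rightarrow>
    ('m chart \<Rightarrow> real^7 \<Rightarrow> (real^7) list \<Rightarrow> real) \<Rightarrow>
    ('m chart \<Rightarrow> real^7 \<Rightarrow> real^7 \<Rightarrow> real^7 \<Rightarrow> real) \<Rightarrow>
    ('m chart \<Rightarrow> real^7 \<Rightarrow> real^7 \<Rightarrow> real^7) \<Rightarrow> bool" where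
  "torsion_endomorphism A \<phi> g T \<longleftrightarrow> endo_field A T \<and>
     on_M A (\<lambda>c x. \<forall>v. nabla (g c) (\<phi> c) x v = interior (T c x v) (hodge (g c x) (\<phi> c x)))"

definition Cr :: "('m chart \<Rightarrow> real^7 \<Rightarrow> (real^7) list \<Rightarrow> real) \<Rightarrow>
    ('m chart \<Rightarrow> real^7 \<Rightarrow> real^7 \<Rightarrow> real^7 \<Rightarrow> real) \<Rightarrow>
    'm chart \<Rightarrow> real^7 \<Rightarrow> (real^7) list \<Rightarrow> real^7" where
  "Cr \<phi> g c x = delta (g c x) (\<phi> c x)"

definition chi :: "('m chart \<Rightarrow> real^7 \<Rightarrow> (real^7) list \<Rightarrow> real) \<Rightarrow>
    ('m chart \<Rightarrow> real^7 \<Rightarrow> real^7 \<Rightarrow> real^7 \<Rightarrow> real) \<Rightarrow>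
    'm chart \<Rightarrow> real^7 \<Rightarrow> (real^7) list \<Rightarrow> real^7" where
  "chi \<phi> g c x vs = - delta (g c x) (hodge (g c x) (\<phi> c x)) vs"

definition K_endo :: "('m chart \<Rightarrow> real^7 \<Rightarrow> (real^7) list \<Rightarrow> real) \<Rightarrow>
    ('m chart \<Rightarrow> real^7 \<Rightarrow> real^7 \<Rightarrow> real^7 \<Rightarrow> real) \<Rightarrow>
    'm chart \<Rightarrow> real^7 \<Rightarrow> real^7 \<Rightarrow> real^7" where
  "K_endo \<phi> g c x = K_iso (g c x) (\<phi> c x)
     (pi7 (g c x) (\<phi> c x) (fn_bracket 2 (Cr \<phi> g c) (chi \<phi> g c) x))"

definition L_endo :: "('m chart \<Rightarrow> real^7 \<Rightarrow> (real^7) list \<Rightarrow> real) \<Rightarrow>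
    ('m chart \<Rightarrow> real^7 \<Rightarrow> real^7 \<Rightarrow> real^7 \<Rightarrow> real) \<Rightarrow>
    'm chart \<Rightarrow> real^7 \<Rightarrow> real^7 \<Rightarrow> real^7" where
  "L_endo \<phi> g c x = L_iso (g c x) (fn_bracket 3 (chi \<phi> g c) (chi \<phi> g c) x)"

definition component_vanishes :: "'m chart set \<Rightarrow>
    ('m chart \<Rightarrow> real^7 \<Rightarrow> (real^7) list \<Rightarrow> real) \<Rightarrow>
    ('m chart \<Rightarrow> real^7 \<Rightarrow> real^7 \<Rightarrow> real^7 \<Rightarrow> real) \<Rightarrow> nat \<Rightarrow>
    ('m chart \<Rightarrow> real^7 \<Rightarrow> real^7 \<Rightarrow> real^7) \<Rightarrow> bool" where
  "component_vanishes A \<phi> g k B \<longleftrightarrow>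
     on_M A (\<lambda>c x. V_component (g c x) (\<phi> c x) k (B c x) = (\<lambda>v. 0))"

text \<open>Membership of a G2-structure with torsion endomorphism \<open>T\<close> in the Fernandez--Gray class
  attached to the sum of the \<open>V\<^sub>k\<close>, \<open>k \<in> I\<close>.\<close>

definition fernandez_gray_class :: "'m chart set \<Rightarrow>
    ('m chart \<Rightarrow> real^7 \<Rightarrow> (real^7) list \<Rightarrow> real) \<Rightarrow>
    ('m chart \<Rightarrow> real^7 \<Rightarrow> real^7 \<Rightarrow> real^7 \<Rightarrow> real) \<Rightarrow>
    ('m chart \<Rightarrow> real^7 \<Rightarrow> real^7 \<Rightarrow> real^7) \<Rightarrow> nat set \<Rightarrow> bool" where
  "fernandez_gray_class A \<phi> g T I \<longleftrightarrow> on_M A (\<lambda>c x. T c x \<in> V_sum (g c x) (\<phi> c x) I)"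

end

theory Submission
  imports "Jordan_Normal_Form.Determinant" Defs
begin

text \<open>
  Everything is pointwise. In a chart, put \<open>Cr\<close> and \<open>\<chi>\<close> into the local formula for the
  Froelicher--Nijenhuis bracket and split each partial derivative into a covariant derivative and a
  Christoffel term. Because the Levi-Civita connection is symmetric, the Christoffel terms cancel,
  as a purely algebraic identity between alternating multilinear maps. Because the metric is
  parallel, the covariant derivatives are \<open>(\<nabla>\<^sub>z Cr)(u, v) = \<chi>(Tz, u, v)\<close> and
  \<open>(\<nabla>\<^sub>z \<chi>)(u, v, w) = \<phi>(u, v, w) Tz - \<langle>Tz, u\<rangle> v\<times>w + \<langle>Tz, v\<rangle> u\<times>w - \<langle>Tz, w\<rangle> u\<times>v\<close>; the second follows
  from \<open>\<chi>(u, v, w) = \<langle>u, w\<rangle> v - \<langle>u, v\<rangle> w - u\<times>(v\<times>w)\<close>, which also shows that \<open>\<chi>\<close> is differentiable although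
  the Hodge star is defined through an arbitrary choice of bases. So both brackets are linear in \<open>T\<close>,
  and evaluating them on a G2-frame gives
  \<open>K = 2T - 4T\<^sup>\<top> - 2 tr(T) id\<close> and \<open>L = -10T + 2T\<^sup>\<top> + 6 (\<Sum>\<^sub>i e\<^sub>i\<times>Te\<^sub>i)\<times>\<close>.
  On \<open>V\<^sub>1, V\<^sub>7, V\<^sub>1\<^sub>4, V\<^sub>2\<^sub>7\<close> these are the scalars \<open>-16, 6, 6, -2\<close> and \<open>-8, 24, -12, -8\<close>, all nonzero.
\<close>

text \<open>A G2-frame identifies the tangent space, its metric and \<phi> with R^7 and fixed
  octonionic data, so the pointwise claims become identities linear in the 49 entries of T, which
  are checked by evaluation. Three obstacles shape the way to that point. Forms are functions of
  lists and the wedge runs over sets of positions, so evaluation needs an equivalent recursion along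
  the list. The Hodge star, \<delta>_g, the transpose and \<sigma> use a basis chosen by
  \<open>SOME\<close>, so each has to be identified with its expression in the G2-frame. The maps K
  and L and the components of an endomorphism are descriptions by \<open>THE\<close>, so each needs
  an explicit candidate and a uniqueness argument. For K the projection \<pi>_7 is read off by
  pairing: wedging with the three-term 2-form \<iota>_{e_k} \<phi> annihilates \<Lambda>^5_14 and
  sends \<star>\<phi> \<and> v^flat to 3 v_k times the volume form, so K comes from one third of
  these products.\<close>

no_notation vec_index (infixl "$" 100) and scalar_prod (infix "\<bullet>" 70)

section \<open>The index type\<close>

lemma exhaust_7:
  fixes x :: 7
  shows "x = 1 \<or> x = 2 \<or> x = 3 \<or> x = 4 \<or> x = 5 \<or> x = 6 \<or> x = 7"
proof (induct x)
  case (of_int z)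
  then have "0 \<le> z" and "z < 7" by simp_all
  then have "z = 0 \<or> z = 1 \<or> z = 2 \<or> z = 3 \<or> z = 4 \<or> z = 5 \<or> z = 6" by arith
  \<comment> \<open>The residue 0 is the index written \<open>7\<close>.\<close>
  then show ?case by auto
qed

lemma forall_7: "(\<forall>i::7. P i) \<longleftrightarrow> P 1 \<and> P 2 \<and> P 3 \<and> P 4 \<and> P 5 \<and> P 6 \<and> P 7"
  by (metis exhaust_7)

lemma UNIV_7: "(UNIV::7 set) = {1, 2, 3, 4, 5, 6, 7}"
  using exhaust_7 by auto

lemma sum_7: "sum f (UNIV::7 set) = f 1 + f 2 + f 3 + f 4 + f 5 + f 6 + f 7"
  unfolding UNIV_7 by (simp add: ac_simps)

section \<open>Alternating forms\<close>

text \<open>The sum over shuffles as a recursion on the list, which simplification can unfold on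
  explicit lists: each vector joins the left or the right group. A vector that goes right is passed
  by every later vector that goes left, hence the sign \<open>(-1) ^ length I\<close>.
  \<open>H\<close> is any function of the two groups, so one device serves scalar wedges and
  vector-valued brackets.\<close>

primrec shuffle_sum :: "('a list \<Rightarrow> 'a list \<Rightarrow> 'b::real_vector) \<Rightarrow> 'a list \<Rightarrow> 'b" where
  "shuffle_sum H [] = H [] []"
| "shuffle_sum H (v # vs) = shuffle_sum (\<lambda>I J. H (v # I) J) vs
     + shuffle_sum (\<lambda>I J. (-1) ^ length I *\<^sub>R H I (v # J)) vs"

lemma sum_Pow_lessThan_Suc:
  fixes F :: "nat set \<Rightarrow> 'b::comm_monoid_add"
  shows "(\<Sum>S\<in>Pow {..<Suc n}. F S)
    = (\<Sum>S\<in>Pow {..<n}. F (insert 0 (Suc ` S))) + (\<Sum>S\<in>Pow {..<n}. F (Suc ` S))"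
proof -
  have P: "Pow {..<Suc n} = (\<lambda>S. insert 0 (Suc ` S)) ` Pow {..<n} \<union> ((`) Suc) ` Pow {..<n}"
    unfolding lessThan_Suc_eq_insert_0 Pow_insert image_Pow_surj[OF refl, symmetric]
    by (simp add: image_image Un_commute)
  have "inj_on (\<lambda>S. insert 0 (Suc ` S)) (Pow {..<n})"
    by (rule inj_on_inverseI[of _ "\<lambda>S. {i. Suc i \<in> S}"]) auto
  moreover have "inj_on ((`) Suc) (Pow {..<n})"
    by (simp add: inj_on_def inj_image_eq_iff)
  ultimately show ?thesis
    unfolding P by (subst sum.union_disjoint) (auto simp: sum.reindex)
qed

text \<open>Subsets are split by whether position 0 lies in \<open>S\<close>. If it does, no
  inversion is added; if not, it forms one inversion with each element of \<open>S\<close>, and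
  \<open>card S\<close> is the length of the left group.\<close>

lemma sum_Pow_eq_shuffle_sum:
  "(\<Sum>S\<in>Pow {..<length vs}.
     (-1) ^ card {(i, j). i \<in> S \<and> j \<in> {..<length vs} - S \<and> j < i} *\<^sub>R H (nths vs S) (nths vs (- S)))
   = shuffle_sum H vs"
proof (induction vs arbitrary: H)
  case Nil
  then show ?case by simp
next
  case (Cons v vs)
  let ?n = "length vs"
  define iv where "iv n S = {(i, j). i \<in> S \<and> j \<in> {..<n} - S \<and> j < i}" for n and S :: "nat set"
  have fin: "finite (iv n S)" if "S \<subseteq> {..<n}" for n S
    by (rule finite_subset[of _ "{..<n} \<times> {..<n}"]) (use that in \<open>auto simp: iv_def\<close>)
  have i1: "iv (Suc n) (insert 0 (Suc ` S)) = map_prod Suc Suc ` iv n S" if "S \<subseteq> {..<n}" for n S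
    by (auto simp: iv_def image_iff less_Suc_eq_0_disj)
  have c1: "card (iv (Suc n) (insert 0 (Suc ` S))) = card (iv n S)" if "S \<subseteq> {..<n}" for n S
    unfolding i1[OF that] by (rule card_image) (auto simp: inj_on_def)
  have i2: "iv (Suc n) (Suc ` S) = map_prod Suc Suc ` iv n S \<union> (\<lambda>i. (Suc i, 0)) ` S"
    if "S \<subseteq> {..<n}" for n S
    by (auto simp: iv_def image_iff less_Suc_eq_0_disj)
  have c2: "card (iv (Suc n) (Suc ` S)) = card S + card (iv n S)" if S: "S \<subseteq> {..<n}" for n S
  proof -
    have "finite S" using S finite_subset by blast
    then have "card (iv (Suc n) (Suc ` S)) = card (map_prod Suc Suc ` iv n S) + card ((\<lambda>i. (Suc i, 0::nat)) ` S)"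
      unfolding i2[OF S] by (intro card_Un_disjoint) (auto simp: fin S)
    also have "\<dots> = card (iv n S) + card S"
      by (intro arg_cong2[of _ _ _ _ "(+)"] card_image) (auto simp: inj_on_def)
    finally show ?thesis by simp
  qed
  have l: "length (nths vs S) = card S" if "S \<subseteq> {..<?n}" for S
    unfolding length_nths by (rule arg_cong[of _ _ card]) (use that in auto)
  have "(\<Sum>S\<in>Pow {..<length (v # vs)}.
      (-1) ^ card (iv (length (v # vs)) S) *\<^sub>R H (nths (v # vs) S) (nths (v # vs) (- S)))
    = (\<Sum>S\<in>Pow {..<?n}. (-1) ^ card (iv ?n S) *\<^sub>R H (v # nths vs S) (nths vs (- S)))
    + (\<Sum>S\<in>Pow {..<?n}. (-1) ^ card (iv ?n S) *\<^sub>R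
        ((-1) ^ length (nths vs S) *\<^sub>R H (nths vs S) (v # nths vs (- S))))"
    unfolding length_Cons sum_Pow_lessThan_Suc
    by (intro arg_cong2[of _ _ _ _ "(+)"] sum.cong)
      (auto simp: nths_Cons c1 c2 l power_add mult.commute Collect_neg_eq inj_image_mem_iff)
  also have "\<dots> = shuffle_sum H (v # vs)"
    unfolding shuffle_sum.simps Cons.IH[symmetric] iv_def by simp
  finally show ?case unfolding iv_def .
qed

lemma wedge_eq_shuffle_sum: "(\<alpha> \<and>\<^sub>f \<beta>) vs = shuffle_sum (\<lambda>I J. \<alpha> I * \<beta> J) vs"
  unfolding wedge_def sum_Pow_eq_shuffle_sum[symmetric] by (simp add: mult.assoc)

lemma shuffle_sum_add: "shuffle_sum (\<lambda>I J. H I J + H' I J) vs = shuffle_sum H vs + shuffle_sum H' vs"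
  by (induction vs arbitrary: H H') (simp_all add: scaleR_add_right)

lemma shuffle_sum_scaleR: "shuffle_sum (\<lambda>I J. c *\<^sub>R H I J) vs = c *\<^sub>R shuffle_sum H vs"
proof (induction vs arbitrary: H)
  case (Cons v vs)
  show ?case
    unfolding shuffle_sum.simps scaleR_left_commute[of _ c] Cons.IH by (simp add: scaleR_add_right)
qed simp

lemma shuffle_sum_linear:
  assumes "\<And>I J. linear (\<lambda>w. H w I J)"
  shows "linear (\<lambda>w. shuffle_sum (H w) vs)"
proof (rule linearI)
  show "shuffle_sum (H (a + b)) vs = shuffle_sum (H a) vs + shuffle_sum (H b) vs" for a b
  proof -
    have "H (a + b) = (\<lambda>I J. H a I J + H b I J)" by (simp add: fun_eq_iff linear_add[OF assms])
    then show ?thesis by (simp add: shuffle_sum_add)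
  qed
  show "shuffle_sum (H (c *\<^sub>R a)) vs = c *\<^sub>R shuffle_sum (H a) vs" for a c
  proof -
    have "H (c *\<^sub>R a) = (\<lambda>I J. c *\<^sub>R H a I J)" by (simp add: fun_eq_iff linear_scale[OF assms])
    then show ?thesis by (simp add: shuffle_sum_scaleR)
  qed
qed

lemma shuffle_sum_0: "shuffle_sum (\<lambda>I J. 0) vs = 0"
  using shuffle_sum_scaleR[of 0 "\<lambda>I J. 0"] by simp

lemma shuffle_sum_minus: "shuffle_sum (\<lambda>I J. - H I J) vs = - shuffle_sum H vs"
  using shuffle_sum_scaleR[of "-1"] by simp

lemma shuffle_sum_diff: "shuffle_sum (\<lambda>I J. H I J - H' I J) vs = shuffle_sum H vs - shuffle_sum H' vs"
  using shuffle_sum_add[of H "\<lambda>I J. - H' I J"] by (simp add: shuffle_sum_minus)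

lemma shuffle_sum_sum: "shuffle_sum (\<lambda>I J. \<Sum>i\<in>X. H i I J) vs = (\<Sum>i\<in>X. shuffle_sum (H i) vs)"
  by (induction X rule: infinite_finite_induct) (simp_all add: shuffle_sum_0 shuffle_sum_add)

text \<open>A shuffle uses up the whole list, so only pairs of complementary lengths occur. Degree
  arguments for wedges and brackets rest on this.\<close>

lemma shuffle_sum_eq_0:
  assumes "\<And>I J. length I + length J = length vs \<Longrightarrow> H I J = 0"
  shows "shuffle_sum H vs = 0"
  using assms
proof (induction vs arbitrary: H)
  case (Cons v vs)
  show ?case
    by (simp add: Cons.IH Cons.prems)
qed simp

lemma shuffle_sum_linear_slot:
  assumes "\<And>I I' J. linear (\<lambda>w. H (I @ w # I') J)" "\<And>I J J'. linear (\<lambda>w. H I (J @ w # J'))"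
  shows "linear (\<lambda>w. shuffle_sum H (us @ w # vs))"
  using assms
proof (induction us arbitrary: H)
  case Nil
  have "linear (\<lambda>w. H (w # I) J)" "linear (\<lambda>w. H I (w # J))" for I J
    using Nil(1)[of "[]"] Nil(2)[of _ "[]"] by auto
  then show ?case
    by (auto intro!: linear_compose_add shuffle_sum_linear linear_compose_scale_right)
next
  case (Cons u us)
  have "linear (\<lambda>w. shuffle_sum (\<lambda>I J. H (u # I) J) (us @ w # vs))"
    by (rule Cons.IH) (use Cons.prems(1)[of "u # _"] Cons.prems(2) in auto)
  moreover have "linear (\<lambda>w. shuffle_sum (\<lambda>I J. (- 1) ^ length I *\<^sub>R H I (u # J)) (us @ w # vs))"
    by (rule Cons.IH)
      (use Cons.prems(2)[of _ "u # _"] Cons.prems(1) in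
        \<open>auto intro!: linear_compose_scale_right simp del: power_Suc\<close>)
  ultimately show ?case by (simp add: linear_compose_add)
qed

text \<open>If both copies of \<open>v\<close> go to the same group, \<open>H\<close> vanishes. The
  shuffles that separate them come in pairs which give the same groups with opposite signs.\<close>

lemma shuffle_sum_adjacent_eq_0:
  assumes "\<And>I I' J. H (I @ v # v # I') J = 0" "\<And>I J J'. H I (J @ v # v # J') = 0"
  shows "shuffle_sum H (us @ v # v # vs) = 0"
  using assms
proof (induction us arbitrary: H)
  case Nil
  have "H (v # v # I) J = 0" "H I (v # v # J) = 0" for I J
    using Nil(1)[of "[]"] Nil(2)[of _ "[]"] by auto
  then show ?case by (simp add: shuffle_sum_minus shuffle_sum_0)
next
  case (Cons u us)
  have "shuffle_sum (\<lambda>I J. H (u # I) J) (us @ v # v # vs) = 0"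
    by (rule Cons.IH) (use Cons.prems(1)[of "u # _"] Cons.prems(2) in auto)
  moreover have "shuffle_sum (\<lambda>I J. (- 1) ^ length I *\<^sub>R H I (u # J)) (us @ v # v # vs) = 0"
    by (rule Cons.IH) (use Cons.prems(2)[of _ "u # _"] Cons.prems(1) in auto)
  ultimately show ?case by simp
qed

lemma is_formD_length: "is_form k \<alpha> \<Longrightarrow> length vs \<noteq> k \<Longrightarrow> \<alpha> vs = 0"
  by (simp add: is_form_def)

lemma linear_zero': "linear (\<lambda>w. 0)"
  by (simp add: linear_iff)

lemma is_formD_linear:
  assumes "is_form k \<alpha>" shows "linear (\<lambda>w. \<alpha> (us @ w # vs))"
proof (cases "length us + Suc (length vs) = k")
  case True
  then have "linear (\<lambda>w. \<alpha> ((us @ undefined # vs)[length us := w]))"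
    using assms unfolding is_form_def by (metis add_Suc_right length_Cons length_append less_add_Suc1)
  then show ?thesis by simp
next
  case False
  then have "\<alpha> (us @ w # vs) = 0" for w
    using is_formD_length[OF assms, of "us @ w # vs"] by simp
  then show ?thesis by (simp add: linear_zero')
qed

lemma is_formD_eq_0: "is_form k \<alpha> \<Longrightarrow> \<not> distinct vs \<Longrightarrow> \<alpha> vs = 0"
  unfolding is_form_def by metis

text \<open>Polarisation: insert v + w into both neighbouring slots and expand.\<close>

lemma swap_if_adjacent_eq_0:
  fixes \<alpha> :: "(real^7) list \<Rightarrow> 'b::real_vector"
  assumes lin: "\<And>us vs. linear (\<lambda>w. \<alpha> (us @ w # vs))"
    and adj: "\<And>us v vs. \<alpha> (us @ v # v # vs) = 0"
  shows "\<alpha> (us @ v # w # vs) = - \<alpha> (us @ w # v # vs)"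
proof -
  have l2: "linear (\<lambda>x. \<alpha> (us @ u # x # vs))" for u
    using lin[of "us @ [u]" vs] by simp
  have "0 = \<alpha> (us @ (v + w) # (v + w) # vs)" by (simp add: adj)
  also have "\<dots> = \<alpha> (us @ v # (v + w) # vs) + \<alpha> (us @ w # (v + w) # vs)"
    by (rule linear_add[OF lin])
  also have "\<dots> = \<alpha> (us @ v # w # vs) + \<alpha> (us @ w # v # vs)"
    by (simp add: linear_add[OF l2] adj)
  finally show ?thesis by (metis eq_neg_iff_add_eq_0)
qed

text \<open>Checking neighbouring repetitions is enough: swaps of neighbours bring two equal entries
  together at the cost of a sign.\<close>

lemma is_formI:
  fixes \<alpha> :: "(real^7) list \<Rightarrow> 'b::real_vector"
  assumes len: "\<And>vs. length vs \<noteq> k \<Longrightarrow> \<alpha> vs = 0"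
    and lin: "\<And>us vs. linear (\<lambda>w. \<alpha> (us @ w # vs))"
    and adj: "\<And>us v vs. \<alpha> (us @ v # v # vs) = 0"
  shows "is_form k \<alpha>"
  unfolding is_form_def
proof (intro conjI allI impI)
  show "\<alpha> vs = 0" if "length vs \<noteq> k" for vs by (rule len) fact
  show "linear (\<lambda>w. \<alpha> (vs[i := w]))" if "length vs = k \<and> i < k" for vs i
    using lin[of "take i vs" "drop (Suc i) vs"] that by (simp add: upd_conv_take_nth_drop)
next
  fix vs :: "(real^7) list" assume "length vs = k \<and> \<not> distinct vs"
  then obtain xs ys zs y where vs: "vs = xs @ [y] @ ys @ [y] @ zs"
    using not_distinct_decomp by blast
  have "\<alpha> (xs @ y # ys @ y # zs) = 0"
  proof (induction ys arbitrary: xs)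
    case (Cons a ys)
    show ?case
      using Cons.IH[of "xs @ [a]"] swap_if_adjacent_eq_0[of \<alpha> xs y a, OF lin adj] by simp
  qed (simp add: adj)
  then show "\<alpha> vs = 0" by (simp add: vs)
qed

lemma is_form_swap:
  assumes "is_form k \<alpha>" shows "\<alpha> (us @ v # w # vs) = - \<alpha> (us @ w # v # vs)"
  by (rule swap_if_adjacent_eq_0) (auto intro: is_formD_linear[OF assms] is_formD_eq_0[OF assms])

lemma is_form_wedge:
  assumes \<alpha>: "is_form p \<alpha>" and \<beta>: "is_form q \<beta>"
  shows "is_form (p + q) (\<alpha> \<and>\<^sub>f \<beta>)"
proof (rule is_formI)
  fix vs :: "(real^7) list" assume "length vs \<noteq> p + q"
  then have "\<alpha> I * \<beta> J = 0" if "length I + length J = length vs" for I J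
    using is_formD_length[OF \<alpha>, of I] is_formD_length[OF \<beta>, of J] that
    by (cases "length I = p") auto
  then show "(\<alpha> \<and>\<^sub>f \<beta>) vs = 0"
    unfolding wedge_eq_shuffle_sum by (rule shuffle_sum_eq_0)
next
  show "linear (\<lambda>w. (\<alpha> \<and>\<^sub>f \<beta>) (us @ w # vs))" for us vs
    unfolding wedge_eq_shuffle_sum
  proof (rule shuffle_sum_linear_slot)
    show "linear (\<lambda>w. \<alpha> (I @ w # I') * \<beta> J)" for I I' J
      using linear_compose_scale_right[OF is_formD_linear[OF \<alpha>], of "\<beta> J"] by (simp add: mult.commute)
    show "linear (\<lambda>w. \<alpha> I * \<beta> (J @ w # J'))" for I J J'
      using linear_compose_scale_right[OF is_formD_linear[OF \<beta>], of "\<alpha> I"] by simp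
  qed
next
  show "(\<alpha> \<and>\<^sub>f \<beta>) (us @ v # v # vs) = 0" for us v vs
    unfolding wedge_eq_shuffle_sum
    by (rule shuffle_sum_adjacent_eq_0) (auto simp: is_formD_eq_0[OF \<alpha>] is_formD_eq_0[OF \<beta>])
qed

lemma is_form_0: "is_form k (\<lambda>vs. 0)"
  by (rule is_formI) (auto simp: linear_zero')

lemma is_form_add: "is_form k \<alpha> \<Longrightarrow> is_form k \<beta> \<Longrightarrow> is_form k (\<lambda>vs. \<alpha> vs + \<beta> vs)"
  by (rule is_formI)
    (simp_all add: is_formD_length is_formD_eq_0 linear_compose_add is_formD_linear[of k \<alpha>] is_formD_linear[of k \<beta>])

lemma is_form_scaleR: "is_form k \<alpha> \<Longrightarrow> is_form k (\<lambda>vs. c *\<^sub>R \<alpha> vs)"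
  by (rule is_formI)
    (simp_all add: is_formD_length is_formD_eq_0 linear_compose_scale_right is_formD_linear[of k \<alpha>])

lemma is_form_minus: "is_form k \<alpha> \<Longrightarrow> is_form k (\<lambda>vs. - \<alpha> vs)"
  using is_form_scaleR[of k \<alpha> "-1"] by simp

lemma is_form_diff: "is_form k \<alpha> \<Longrightarrow> is_form k \<beta> \<Longrightarrow> is_form k (\<lambda>vs. \<alpha> vs - \<beta> vs)"
  using is_form_add[OF _ is_form_minus, of k \<alpha> \<beta>] by simp

lemma is_form_sum: "(\<And>i. i \<in> X \<Longrightarrow> is_form k (\<alpha> i)) \<Longrightarrow> is_form k (\<lambda>vs. \<Sum>i\<in>X. \<alpha> i vs)"
  by (induction X rule: infinite_finite_induct) (simp_all add: is_form_0 is_form_add)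

lemma is_form_interior:
  assumes "is_form (Suc k) \<alpha>" shows "is_form k (interior v \<alpha>)"
proof (rule is_formI)
  show "linear (\<lambda>w. interior v \<alpha> (us @ w # vs))" for us vs
    using is_formD_linear[OF assms, of "v # us"] by (simp add: interior_def)
  show "interior v \<alpha> (us @ w # w # vs) = 0" for us w vs
    using is_formD_eq_0[OF assms, of "v # us @ w # w # vs"] by (simp add: interior_def)
qed (simp add: interior_def is_formD_length[OF assms])

lemma is_form_one_form:
  assumes "linear l" shows "is_form 1 (one_form l)"
proof (rule is_formI)
  show "linear (\<lambda>w. one_form l (us @ w # vs))" for us vs
  proof (cases "us = [] \<and> vs = []")
    case True
    then show ?thesis using assms by (simp add: one_form_def)
  next
    case False
    then have "one_form l (us @ w # vs) = 0" for w
      by (cases us; cases vs) (auto simp: one_form_def split: list.split)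
    then show ?thesis by (simp add: linear_zero')
  qed
qed (auto simp: one_form_def split: list.split)

lemma is_form_wedge_of:
  assumes "\<And>i. linear (\<theta> i)" shows "is_form (length is) (wedge_of \<theta> is)"
proof (induction "is")
  case Nil
  show ?case by (rule is_formI) (auto simp: linear_zero')
next
  case (Cons i "is")
  then show ?case using is_form_wedge[OF is_form_one_form[OF assms] Cons.IH, of i] by simp
qed

text \<open>Vanishing does not depend on the sign of a permutation, so one ordering of each index
  set can be tested in place of all.\<close>

lemma is_form_mset:
  assumes \<alpha>: "is_form k \<alpha>" and "\<alpha> xs = 0" and "mset xs = mset ys"
  shows "\<alpha> ys = 0"
proof -
  have move: "\<alpha> (us @ ys @ x # zs) = 0" if "\<alpha> (us @ x # ys @ zs) = 0" for us x ys zs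
    using that
  proof (induction ys arbitrary: us)
    case (Cons a ys)
    have "\<alpha> ((us @ [a]) @ ys @ x # zs) = 0"
      by (rule Cons.IH) (use Cons.prems is_form_swap[OF \<alpha>, of us x a] in simp)
    then show ?case by simp
  qed simp
  have "\<alpha> (us @ ys) = 0" if "\<alpha> (us @ xs) = 0" "mset xs = mset ys" for us
    using that
  proof (induction xs arbitrary: us ys)
    case (Cons x xs)
    then have "x \<in> set ys" by (metis list.set_intros(1) mset_eq_setD)
    then obtain ys1 ys2 where ys: "ys = ys1 @ x # ys2" by (meson split_list)
    have "\<alpha> ((us @ [x]) @ ys1 @ ys2) = 0"
      by (rule Cons.IH) (use Cons.prems ys in auto)
    then show ?case using move by (simp add: ys)
  qed simp
  from this[of "[]"] assms show ?thesis by simp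
qed

text \<open>The arguments are expanded from left to right, the expanded ones accumulating in front
  as basis vectors. Lists of basis vectors with repetitions vanish by alternation.\<close>

lemma is_form_eq_0_if_basis:
  fixes e :: "7 \<Rightarrow> real^7"
  assumes \<alpha>: "is_form k \<alpha>" and e: "\<And>v. v = (\<Sum>i\<in>UNIV. f i v *\<^sub>R e i)"
    and 0: "\<And>is. length is = k \<Longrightarrow> distinct is \<Longrightarrow> \<alpha> (map e is) = 0"
  shows "\<alpha> vs = 0"
proof -
  have "\<alpha> (map e is @ vs) = 0" for "is"
  proof (induction vs arbitrary: "is")
    case Nil
    show ?case
    proof (cases "length is = k \<and> distinct is")
      case False
      then show ?thesis
        using is_formD_length[OF \<alpha>, of "map e is"] is_formD_eq_0[OF \<alpha>, of "map e is"]
        by (auto simp: distinct_map)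
    qed (simp add: 0)
  next
    case (Cons v vs)
    have "\<alpha> (map e is @ v # vs) = \<alpha> (map e is @ (\<Sum>i\<in>UNIV. f i v *\<^sub>R e i) # vs)"
      using e[of v] by simp
    also have "\<dots> = (\<Sum>i\<in>UNIV. f i v *\<^sub>R \<alpha> (map e (is @ [i]) @ vs))"
      by (simp add: linear_sum[OF is_formD_linear[OF \<alpha>]] linear_scale[OF is_formD_linear[OF \<alpha>]])
    also have "\<dots> = 0"
      unfolding Cons.IH by simp
    finally show ?case .
  qed
  from this[of "[]"] show ?thesis by simp
qed

section \<open>Volume form and Hodge star\<close>

lemma wedge_Nil: "(\<alpha> \<and>\<^sub>f \<beta>) [] = \<alpha> [] * \<beta> []"
  by (simp add: wedge_eq_shuffle_sum)

text \<open>The antiderivation rule for the interior product. The sign is attached to \<alpha>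
  through the length of its argument, so no degree has to be fixed.\<close>

lemma wedge_Cons:
  "(\<alpha> \<and>\<^sub>f \<beta>) (v # vs) = (interior v \<alpha> \<and>\<^sub>f \<beta>) vs
    + ((\<lambda>us. (-1) ^ length us * \<alpha> us) \<and>\<^sub>f interior v \<beta>) vs"
  by (simp add: wedge_eq_shuffle_sum interior_def mult.assoc)

text \<open>The left factor is the constant \<open>c\<close> regarded as a 0-form.\<close>

lemma wedge_const_left: "((\<lambda>us. if us = [] then c else 0) \<and>\<^sub>f \<beta>) vs = c * \<beta> vs"
proof -
  have 0: "((\<lambda>us. 0) \<and>\<^sub>f \<beta>) vs = 0" for vs \<beta>
    by (simp add: wedge_eq_shuffle_sum shuffle_sum_0)
  have 1: "interior v (\<lambda>us. if us = [] then c else 0) = (\<lambda>us. 0)" for v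
    by (simp add: interior_def fun_eq_iff)
  have 2: "(\<lambda>us. (- 1) ^ length us * (if us = [] then c else 0)) = (\<lambda>us. if us = [] then c else 0)"
    by (simp add: fun_eq_iff)
  show ?thesis
  proof (induction vs arbitrary: \<beta>)
    case (Cons a vs)
    show ?case
      unfolding wedge_Cons 0 1 2 Cons.IH by (simp add: interior_def)
  qed (simp add: wedge_Nil)
qed

lemma wedge_minus_left: "((\<lambda>us. - \<alpha> us) \<and>\<^sub>f \<beta>) vs = - (\<alpha> \<and>\<^sub>f \<beta>) vs"
  using shuffle_sum_minus[of "\<lambda>I J. \<alpha> I * \<beta> J"] by (simp add: wedge_eq_shuffle_sum)

lemma wedge_one_form:
  "(one_form l \<and>\<^sub>f \<beta>) vs
    = (\<Sum>i<length vs. (-1) ^ i * l (vs ! i) * \<beta> (take i vs @ drop (Suc i) vs))"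
proof (induction vs arbitrary: \<beta>)
  case Nil
  then show ?case by (simp add: wedge_Nil one_form_def)
next
  case (Cons v vs)
  have 1: "interior v (one_form l) = (\<lambda>us. if us = [] then l v else 0)"
    by (auto simp: interior_def one_form_def split: list.split)
  have 2: "(\<lambda>us. (- 1) ^ length us * one_form l us) = (\<lambda>us. - one_form l us)"
    by (auto simp: one_form_def fun_eq_iff split: list.split)
  show ?case
    unfolding wedge_Cons 1 2 wedge_const_left wedge_minus_left Cons.IH
    by (simp add: sum.lessThan_Suc_shift interior_def sum_negf del: sum.lessThan_Suc)
qed

text \<open>Both sides obey the same recursion: Laplace expansion in row 0 on one side, the rule for
  wedging with a 1-form on the other. Matrices indexed by numbers fit lists of arbitrary
  length.\<close>

lemma wedge_of_eq_det:
  assumes "length vs = length is"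
  shows "wedge_of \<theta> is vs
    = Determinant.det (Matrix.mat (length is) (length is) (\<lambda>(a, b). \<theta> (is ! a) (vs ! b)))"
  using assms
proof (induction "is" arbitrary: vs)
  case Nil
  then show ?case by simp
next
  case (Cons i "is")
  let ?n = "length is"
  define A where "A = Matrix.mat (Suc ?n) (Suc ?n) (\<lambda>(a, b). \<theta> ((i # is) ! a) (vs ! b))"
  have "Determinant.det A = (\<Sum>j<Suc ?n. A $$ (0, j) * cofactor A 0 j)"
    by (rule laplace_expansion_row) (auto simp: A_def)
  also have "\<dots> = (\<Sum>j<Suc ?n. (-1) ^ j * \<theta> i (vs ! j) * wedge_of \<theta> is (take j vs @ drop (Suc j) vs))"
  proof (rule sum.cong[OF refl])
    fix j assume j: "j \<in> {..<Suc ?n}"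
    have "mat_delete A 0 j
      = Matrix.mat ?n ?n (\<lambda>(a, b). \<theta> (is ! a) ((take j vs @ drop (Suc j) vs) ! b))"
      by (rule eq_matI) (use Cons.prems j in \<open>auto simp: A_def mat_delete_def nth_append min_def\<close>)
    moreover have "length (take j vs @ drop (Suc j) vs) = ?n"
      using Cons.prems j by auto
    ultimately show "A $$ (0, j) * cofactor A 0 j
      = (-1) ^ j * \<theta> i (vs ! j) * wedge_of \<theta> is (take j vs @ drop (Suc j) vs)"
      using j by (simp add: Cons.IH cofactor_def A_def)
  qed
  also have "\<dots> = wedge_of \<theta> (i # is) vs"
    using Cons.prems by (simp add: wedge_one_form)
  finally show ?case by (simp add: A_def)
qed

text \<open>Permutations are transported along the enumeration \<open>ix\<close>, which preserves
  their signs. This links the list-based determinant above with the one in which orientation is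
  defined.\<close>

lemma det_mat_eq_det:
  fixes f :: "'n::finite \<Rightarrow> 'n \<Rightarrow> real"
  assumes ix: "bij_betw ix {0..<n} (UNIV :: 'n set)"
  shows "Determinant.det (Matrix.mat n n (\<lambda>(a, b). f (ix a) (ix b))) = Determinants.det (\<chi> i j. f i j)"
proof -
  let ?A = "{0..<n}" and ?m = "map_permutation {0..<n} ix"
  have inj: "inj_on ix ?A" and surj: "ix ` ?A = UNIV"
    using ix by (auto simp: bij_betw_def)
  have "?m = (\<lambda>p x. if x \<in> UNIV then ix (p (inv_into ?A ix x)) else x)"
    by (simp add: fun_eq_iff map_permutation_def restrict_id_def surj)
  then have bij: "bij_betw ?m {p. p permutes ?A} {p. p permutes (UNIV :: 'n set)}"
    using bij_betw_permutations[OF ix] by simp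
  have "Determinants.det (\<chi> i j. f i j)
      = (\<Sum>p | p permutes UNIV. of_int (sign p) * (\<Prod>i\<in>UNIV. f i (p i)))"
    by (simp add: Determinants.det_def)
  also have "\<dots> = (\<Sum>p | p permutes ?A. of_int (sign (?m p)) * (\<Prod>i\<in>UNIV. f i (?m p i)))"
    by (rule sum.reindex_bij_betw[OF bij, symmetric])
  also have "\<dots> = (\<Sum>p | p permutes ?A. of_int (sign p) * (\<Prod>i\<in>?A. f (ix i) (ix (p i))))"
  proof (rule sum.cong[OF refl])
    fix p assume "p \<in> {p. p permutes ?A}"
    then have "sign (?m p) = sign p"
      using sign_map_permutation[OF inj] by simp
    moreover have "(\<Prod>i\<in>UNIV. f i (?m p i)) = (\<Prod>i\<in>?A. f (ix i) (ix (p i)))"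
      unfolding surj[symmetric] prod.reindex[OF inj]
      by (rule prod.cong) (auto simp: map_permutation_apply[OF inj])
    ultimately show "of_int (sign (?m p)) * (\<Prod>i\<in>UNIV. f i (?m p i))
        = of_int (sign p) * (\<Prod>i\<in>?A. f (ix i) (ix (p i)))" by simp
  qed
  also have "\<dots> = Determinant.det (Matrix.mat n n (\<lambda>(a, b). f (ix a) (ix b)))"
    by (subst det_def') (auto intro!: sum.cong prod.cong simp: permutes_in_image)
  finally show ?thesis by simp
qed

lemma bij_betw_nth_7: "bij_betw ((!) [1, 2, 3, 4, 5, 6, 7 :: 7]) {0..<7} UNIV"
proof (rule bij_betw_nth)
  show "UNIV = set [1, 2, 3, 4, 5, 6, 7 :: 7]" by (simp add: UNIV_7)
qed (simp_all add: atLeast0LessThan)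

section \<open>Independence of the choice of orthonormal basis\<close>

locale inner_product =
  fixes G :: "real^7 \<Rightarrow> real^7 \<Rightarrow> real"
  assumes bil: "bilinear G" and sym: "G u v = G v u"
begin

lemma lin1: "linear (\<lambda>u. G u v)" and lin2: "linear (G u)"
  using bil by (simp_all add: bilinear_def)

lemmas G_simps = linear_add[OF lin1] linear_add[OF lin2] linear_scale[OF lin1] linear_scale[OF lin2]
  linear_0[OF lin1] linear_0[OF lin2] linear_diff[OF lin1] linear_diff[OF lin2]
  linear_neg[OF lin1] linear_neg[OF lin2] linear_sum[OF lin1] linear_sum[OF lin2]

text \<open>Pairing with \<open>e i\<close> recovers the coordinates of \<open>E x\<close>, so
  \<open>E\<close> is injective and, by dimension, surjective.\<close>

lemma orthonormal_expand:
  assumes "orthonormal G e" shows "(\<Sum>i\<in>UNIV. G (e i) v *\<^sub>R e i) = v"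
proof -
  define E where "E x = (\<Sum>i\<in>UNIV. x $ i *\<^sub>R e i)" for x :: "real^7"
  have E: "linear E"
    by (rule linearI) (simp_all add: E_def scaleR_add_left sum.distrib scaleR_sum_right)
  have G: "G (e i) (E x) = x $ i" for i x
  proof -
    have "G (e i) (E x) = (\<Sum>j\<in>UNIV. if i = j then x $ j else 0)"
      unfolding E_def G_simps using assms by (intro sum.cong) (auto simp: orthonormal_def)
    then show ?thesis by simp
  qed
  have "inj E"
  proof (rule injI)
    fix x y assume "E x = E y"
    then have "x $ i = y $ i" for i using G[of i x] G[of i y] by simp
    then show "x = y" by (simp add: vec_eq_iff)
  qed
  then obtain x where "v = E x"
    using linear_injective_imp_surjective[OF E] by (metis surjD)
  then show ?thesis using G by (simp add: E_def)
qed

text \<open>The matrix \<open>Q\<close> between the two bases is orthogonal, so its determinant is 1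
  or -1, and equal orientations leave 1. The two volume forms differ by exactly this
  determinant.\<close>

lemma orthonormal_wedge_of_eq:
  assumes a: "orthonormal G a" "positive_basis a" and b: "orthonormal G b" "positive_basis b"
  shows "wedge_of (\<lambda>i. G (a i)) [1, 2, 3, 4, 5, 6, 7] = wedge_of (\<lambda>i. G (b i)) [1, 2, 3, 4, 5, 6, 7]"
proof
  fix vs
  let ?is = "[1, 2, 3, 4, 5, 6, 7] :: 7 list"
  define Q :: "real^7^7" where "Q = (\<chi> i j. G (a i) (b j))"
  have ab: "b j = (\<Sum>i\<in>UNIV. G (a i) (b j) *\<^sub>R a i)" for j
    using orthonormal_expand[OF a(1)] by metis
  have "(\<chi> i j. b j $ i) = (\<chi> i j. a j $ i) ** Q"
    by (subst ab) (simp add: matrix_matrix_mult_def Q_def vec_eq_iff mult.commute)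
  then have "Determinants.det Q > 0"
    using a(2) b(2) by (simp add: positive_basis_def det_mul zero_less_mult_iff)
  moreover have "Finite_Cartesian_Product.transpose Q ** Q = Finite_Cartesian_Product.mat 1"
  proof -
    have "(\<Sum>k\<in>UNIV. G (a k) (b i) * G (a k) (b j)) = G (b i) (b j)" for i j
    proof -
      have "(\<Sum>k\<in>UNIV. G (a k) (b i) * G (a k) (b j)) = G (\<Sum>k\<in>UNIV. G (a k) (b i) *\<^sub>R a k) (b j)"
        unfolding G_simps by simp
      then show ?thesis by (simp flip: ab)
    qed
    then show ?thesis
      using b(1) by (simp add: matrix_matrix_mult_def Finite_Cartesian_Product.transpose_def Q_def vec_eq_iff Finite_Cartesian_Product.mat_def orthonormal_def)
  qed
  then have "Determinants.det Q = 1 \<or> Determinants.det Q = -1"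
    by (intro det_orthogonal_matrix) (simp add: orthogonal_matrix)
  ultimately have Q: "Determinants.det Q = 1" by auto
  show "wedge_of (\<lambda>i. G (a i)) ?is vs = wedge_of (\<lambda>i. G (b i)) ?is vs"
  proof (cases "length vs = 7")
    case False
    then show ?thesis
      using is_formD_length[OF is_form_wedge_of, of "\<lambda>i. G (a i)" vs ?is]
        is_formD_length[OF is_form_wedge_of, of "\<lambda>i. G (b i)" vs ?is] by (simp add: lin2)
  next
    case True
    let ?M = "\<lambda>f. Matrix.mat 7 7 (\<lambda>(i, j). f i j) :: real mat"
    \<comment> \<open>Expanding the arguments in the basis \<open>b\<close> factors the coframe
      values of \<open>a\<close> through \<open>Q\<close>.\<close>
    have "?M (\<lambda>i j. G (a (?is ! i)) (vs ! j))
      = ?M (\<lambda>i j. G (a (?is ! i)) (b (?is ! j))) * ?M (\<lambda>i j. G (b (?is ! i)) (vs ! j))"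
    proof (rule eq_matI)
      fix i j :: nat
      assume "i < dim_row (?M (\<lambda>i j. G (a (?is ! i)) (b (?is ! j))) * ?M (\<lambda>i j. G (b (?is ! i)) (vs ! j)))"
        and "j < dim_col (?M (\<lambda>i j. G (a (?is ! i)) (b (?is ! j))) * ?M (\<lambda>i j. G (b (?is ! i)) (vs ! j)))"
      then have ij: "i < 7" "j < 7" by auto
      have "G (a (?is ! i)) (vs ! j) = G (a (?is ! i)) (\<Sum>k\<in>UNIV. G (b k) (vs ! j) *\<^sub>R b k)"
        using orthonormal_expand[OF b(1)] by simp
      also have "\<dots> = (\<Sum>k\<in>UNIV. G (a (?is ! i)) (b k) * G (b k) (vs ! j))"
        by (simp add: G_simps mult.commute)
      also have "\<dots> = (\<Sum>k\<in>{0..<7}. G (a (?is ! i)) (b (?is ! k)) * G (b (?is ! k)) (vs ! j))"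
        by (rule sum.reindex_bij_betw[OF bij_betw_nth_7, symmetric])
      finally show "?M (\<lambda>i j. G (a (?is ! i)) (vs ! j)) $$ (i, j)
        = (?M (\<lambda>i j. G (a (?is ! i)) (b (?is ! j))) * ?M (\<lambda>i j. G (b (?is ! i)) (vs ! j))) $$ (i, j)"
        using ij by (simp add: scalar_prod_def)
    qed auto
    moreover have "Determinant.det (?M (\<lambda>i j. G (a (?is ! i)) (b (?is ! j)))) = 1"
      using det_mat_eq_det[OF bij_betw_nth_7, of "\<lambda>i j. G (a i) (b j)"] Q by (simp add: Q_def)
    ultimately have "Determinant.det (?M (\<lambda>i j. G (a (?is ! i)) (vs ! j)))
        = Determinant.det (?M (\<lambda>i j. G (b (?is ! i)) (vs ! j)))"
      by (simp add: det_mult[of _ 7])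
    moreover have "length ?is = 7" by simp
    ultimately show ?thesis
      using True by (simp only: wedge_of_eq_det)
  qed
qed

text \<open>A full contraction with the inverse metric is the same in every orthonormal basis.
  \<open>F\<close> is multilinear in two lists contracted entry by entry, and the basis is exchanged
  one index at a time.\<close>

lemma sum_lists_orthonormal:
  assumes a: "orthonormal G a" and b: "orthonormal G b"
    and l1: "\<And>us vs ws. linear (\<lambda>w. F (us @ w # vs) ws)"
    and l2: "\<And>us vs ws. linear (\<lambda>w. F ws (us @ w # vs))"
  shows "(\<Sum>is | length is = n. F (map a is) (map a is)) = (\<Sum>is | length is = n. F (map b is) (map b is) :: real)"
  using l1 l2
proof (induction n arbitrary: F)
  case 0
  then show ?case by simp
next
  case (Suc n)
  have fin: "finite {is :: 7 list. length is = n}"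
    using finite_lists_length_eq[of "UNIV :: 7 set" n] by simp
  have S: "(\<Sum>is | length is = Suc n. H is) = (\<Sum>i\<in>UNIV. \<Sum>is | length is = n. H (i # is))"
    for H :: "7 list \<Rightarrow> real"
  proof -
    have *: "{is. length is = Suc n} = (\<lambda>(i, is). i # is) ` (UNIV \<times> {is :: 7 list. length is = n})"
      by (auto simp: length_Suc_conv)
    show ?thesis
      unfolding * by (subst sum.reindex) (auto simp: inj_on_def sum.cartesian_product intro!: sum.cong)
  qed
  \<comment> \<open>The one-index case: the trace of a bilinear form.\<close>
  have B: "(\<Sum>i\<in>UNIV. B (a i) (a i)) = (\<Sum>i\<in>UNIV. B (b i) (b i))"
    if B1: "\<And>v. linear (\<lambda>u. B u v)" and B2: "\<And>u. linear (B u)" for B :: "real^7 \<Rightarrow> real^7 \<Rightarrow> real"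
  proof -
    have "(\<Sum>i\<in>UNIV. B (a i) (a i)) = (\<Sum>i\<in>UNIV. B (a i) (\<Sum>j\<in>UNIV. G (b j) (a i) *\<^sub>R b j))"
      by (simp add: orthonormal_expand[OF b])
    also have "\<dots> = (\<Sum>i\<in>UNIV. \<Sum>j\<in>UNIV. G (b j) (a i) * B (a i) (b j))"
      by (simp add: linear_sum[OF B2] linear_scale[OF B2])
    also have "\<dots> = (\<Sum>j\<in>UNIV. \<Sum>i\<in>UNIV. G (b j) (a i) * B (a i) (b j))"
      by (rule sum.swap)
    also have "\<dots> = (\<Sum>j\<in>UNIV. B (\<Sum>i\<in>UNIV. G (a i) (b j) *\<^sub>R a i) (b j))"
      by (simp add: linear_sum[OF B1] linear_scale[OF B1] sym[of "a _" "b _"])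
    also have "\<dots> = (\<Sum>j\<in>UNIV. B (b j) (b j))"
      by (simp add: orthonormal_expand[OF a])
    finally show ?thesis .
  qed
  have IH: "(\<Sum>is | length is = n. F (u # map a is) (v # map a is))
      = (\<Sum>is | length is = n. F (u # map b is) (v # map b is))" for u v
    by (rule Suc.IH) (use Suc.prems(1)[of "u # _"] Suc.prems(2)[of _ "v # _"] in auto)
  have "(\<Sum>is | length is = Suc n. F (map a is) (map a is))
      = (\<Sum>i\<in>UNIV. \<Sum>is | length is = n. F (a i # map a is) (a i # map a is))"
    by (simp add: S)
  also have "\<dots> = (\<Sum>i\<in>UNIV. \<Sum>is | length is = n. F (a i # map b is) (a i # map b is))"
    by (simp add: IH)
  also have "\<dots> = (\<Sum>i\<in>UNIV. \<Sum>is | length is = n. F (b i # map b is) (b i # map b is))"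
    by (rule B; rule linear_compose_sum) (use Suc.prems(1)[of "[]"] Suc.prems(2)[of _ "[]"] in auto)
  also have "\<dots> = (\<Sum>is | length is = Suc n. F (map b is) (map b is))"
    by (simp add: S)
  finally show ?case .
qed

end

locale oriented_frame = inner_product +
  fixes e :: "7 \<Rightarrow> real^7"
  assumes on: "orthonormal G e" and pos: "positive_basis e"
begin

lemma onb: "orthonormal G (onb G)" "positive_basis (onb G)"
  unfolding onb_def by (rule someI2[of _ e], simp add: on pos, simp)+

lemma vol_eq: "vol G = wedge_of (\<lambda>i. G (e i)) [1, 2, 3, 4, 5, 6, 7]"
  unfolding vol_def by (rule orthonormal_wedge_of_eq[OF onb on pos])

lemma is_form_vol: "is_form 7 (vol G)"
  using is_form_wedge_of[of "\<lambda>i. G (e i)" "[1, 2, 3, 4, 5, 6, 7]"]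
  by (simp add: vol_eq lin2 eval_nat_numeral del: wedge_of.simps)

text \<open>The star is defined with the chosen basis \<open>onb G\<close>; this moves it to the
  given frame, later a G2-frame.\<close>

lemma hodge_eq:
  assumes \<alpha>: "is_form k \<alpha>"
  shows "hodge G \<alpha> vs
    = (\<Sum>is | length is = 7 - length vs. \<alpha> (map e is) * vol G (map e is @ vs)) / fact (7 - length vs)"
proof -
  have "linear (\<lambda>w. \<alpha> (us @ w # ws) * vol G ws')" for us ws ws'
    using linear_compose_scale_right[OF is_formD_linear[OF \<alpha>], of "vol G ws'"] by (simp add: mult.commute)
  moreover have "linear (\<lambda>w. \<alpha> ws * vol G ((us @ w # us') @ vs))" for us us' ws
    using linear_compose_scale_right[OF is_formD_linear[OF is_form_vol], of "\<alpha> ws" us "us' @ vs"] by simp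
  ultimately show ?thesis
    unfolding hodge_def by (subst sum_lists_orthonormal[OF onb(1) on]) auto
qed

lemma is_form_hodge:
  assumes \<alpha>: "is_form k \<alpha>" and k: "k \<le> 7" and m: "m = 7 - k"
  shows "is_form m (hodge G \<alpha>)"
proof -
  \<comment> \<open>The contracted length is pinned to \<open>k\<close>, in place of
    \<open>7 - length vs\<close>, so that multilinearity in \<open>vs\<close> can be read
    off.\<close>
  let ?h = "\<lambda>vs. (\<Sum>is | length is = k. \<alpha> (map e is) * vol G (map e is @ vs)) / fact k"
  have "hodge G \<alpha> = ?h"
  proof
    fix vs
    show "hodge G \<alpha> vs = ?h vs"
    proof (cases "7 - length vs = k")
      case False
      then have "hodge G \<alpha> vs = 0"
        by (simp add: hodge_eq[OF \<alpha>] is_formD_length[OF \<alpha>])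
      moreover have "?h vs = 0"
        using False k by (auto simp: is_formD_length[OF is_form_vol] intro!: sum.neutral)
      ultimately show ?thesis by simp
    qed (simp add: hodge_eq[OF \<alpha>])
  qed
  moreover have "is_form m (\<lambda>vs. vol G (map e is @ vs))" if "length is = k" for "is"
  proof (rule is_formI)
    show "vol G (map e is @ vs) = 0" if "length vs \<noteq> m" for vs
      using that \<open>length is = k\<close> k m by (auto simp: is_formD_length[OF is_form_vol])
    show "linear (\<lambda>w. vol G (map e is @ us @ w # vs))" for us vs
      using is_formD_linear[OF is_form_vol, of "map e is @ us"] by simp
    show "vol G (map e is @ us @ v # v # vs) = 0" for us v vs
      by (simp add: is_formD_eq_0[OF is_form_vol])
  qed
  then have "is_form m (\<lambda>vs. (1 / fact k) *\<^sub>R (\<Sum>is | length is = k. \<alpha> (map e is) *\<^sub>R vol G (map e is @ vs)))"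
    by (intro is_form_scaleR is_form_sum) auto
  ultimately show ?thesis by simp
qed

end

section \<open>The standard cross products on Euclidean 7-space\<close>

text \<open>Vectors as seven literal entries, a shape on which sums, inner products and cross
  products rewrite to explicit coordinates. Index 0 is the seventh coordinate, as 7 = 0.\<close>

definition vec7 :: "real \<Rightarrow> real \<Rightarrow> real \<Rightarrow> real \<Rightarrow> real \<Rightarrow> real \<Rightarrow> real \<Rightarrow> real^7" where
  "vec7 a b c d e f g = (\<chi> i. if i = 1 then a else if i = 2 then b else if i = 3 then c
     else if i = 4 then d else if i = 5 then e else if i = 6 then f else g)"

lemma vec7_nth [simp]:
  "vec7 a b c d e f g $ 1 = a" "vec7 a b c d e f g $ 2 = b" "vec7 a b c d e f g $ 3 = c"
  "vec7 a b c d e f g $ 4 = d" "vec7 a b c d e f g $ 5 = e" "vec7 a b c d e f g $ 6 = f"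
  "vec7 a b c d e f g $ 7 = g" "vec7 a b c d e f g $ 0 = g"
  by (simp_all add: vec7_def)

lemma vec7_eta: "x = vec7 (x $ 1) (x $ 2) (x $ 3) (x $ 4) (x $ 5) (x $ 6) (x $ 7)"
  by (simp add: vec_eq_iff forall_7)

lemma vec7_arith:
  "vec7 a b c d e f g + vec7 a' b' c' d' e' f' g'
    = vec7 (a + a') (b + b') (c + c') (d + d') (e + e') (f + f') (g + g')"
  "vec7 a b c d e f g - vec7 a' b' c' d' e' f' g'
    = vec7 (a - a') (b - b') (c - c') (d - d') (e - e') (f - f') (g - g')"
  "- vec7 a b c d e f g = vec7 (- a) (- b) (- c) (- d) (- e) (- f) (- g)"
  "r *\<^sub>R vec7 a b c d e f g = vec7 (r * a) (r * b) (r * c) (r * d) (r * e) (r * f) (r * g)"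
  "vec7 a b c d e f g \<bullet> vec7 a' b' c' d' e' f' g'
    = a * a' + b * b' + c * c' + d * d' + e * e' + f * f' + g * g'"
  "0 = vec7 0 0 0 0 0 0 0"
  by (simp_all add: vec_eq_iff forall_7 inner_vec_def sum_7)

lemma vec7_eq_iff: "vec7 a b c d e f g = vec7 a' b' c' d' e' f' g' \<longleftrightarrow>
    a = a' \<and> b = b' \<and> c = c' \<and> d = d' \<and> e = e' \<and> f = f' \<and> g = g'"
  by (simp add: vec_eq_iff forall_7)

lemma axis_eq_vec7:
  "axis 1 1 = vec7 1 0 0 0 0 0 0" "axis 2 1 = vec7 0 1 0 0 0 0 0" "axis 3 1 = vec7 0 0 1 0 0 0 0"
  "axis 4 1 = vec7 0 0 0 1 0 0 0" "axis 5 1 = vec7 0 0 0 0 1 0 0" "axis 6 1 = vec7 0 0 0 0 0 1 0"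
  "axis 7 1 = vec7 0 0 0 0 0 0 1"
  by (simp_all add: vec_eq_iff forall_7 axis_def)

text \<open>The product of imaginary octonions in the basis in which \<phi> has its seven standard
  terms: each component collects the terms of \<phi> that contain its index.\<close>

definition cross7 :: "real^7 \<Rightarrow> real^7 \<Rightarrow> real^7" where
  "cross7 u v = vec7
    (u$2 * v$3 - u$3 * v$2 + u$4 * v$5 - u$5 * v$4 + u$6 * v$7 - u$7 * v$6)
    (u$3 * v$1 - u$1 * v$3 + u$4 * v$6 - u$6 * v$4 - u$5 * v$7 + u$7 * v$5)
    (u$1 * v$2 - u$2 * v$1 - u$4 * v$7 + u$7 * v$4 - u$5 * v$6 + u$6 * v$5)
    (u$5 * v$1 - u$1 * v$5 + u$6 * v$2 - u$2 * v$6 - u$7 * v$3 + u$3 * v$7)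
    (u$1 * v$4 - u$4 * v$1 - u$7 * v$2 + u$2 * v$7 - u$6 * v$3 + u$3 * v$6)
    (u$7 * v$1 - u$1 * v$7 + u$2 * v$4 - u$4 * v$2 - u$3 * v$5 + u$5 * v$3)
    (u$1 * v$6 - u$6 * v$1 - u$2 * v$5 + u$5 * v$2 - u$3 * v$4 + u$4 * v$3)"

text \<open>The vector whose inner product with a fourth argument is \<star>\<phi>, as
  \<open>star_form_coord\<close> confirms.\<close>

definition chi7 :: "real^7 \<Rightarrow> real^7 \<Rightarrow> real^7 \<Rightarrow> real^7" where
  "chi7 u v w = (u \<bullet> w) *\<^sub>R v - (u \<bullet> v) *\<^sub>R w - cross7 u (cross7 v w)"

lemma cross7_vec7: "cross7 (vec7 a b c d e f g) (vec7 a' b' c' d' e' f' g') = vec7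
    (b * c' - c * b' + d * e' - e * d' + f * g' - g * f')
    (c * a' - a * c' + d * f' - f * d' - e * g' + g * e')
    (a * b' - b * a' - d * g' + g * d' - e * f' + f * e')
    (e * a' - a * e' + f * b' - b * f' - g * c' + c * g')
    (a * d' - d * a' - g * b' + b * g' - f * c' + c * f')
    (g * a' - a * g' + b * d' - d * b' - c * e' + e * c')
    (a * f' - f * a' - b * e' + e * b' - c * d' + d * c')"
  by (simp add: cross7_def)

lemma bilinear_cross7: "bilinear cross7"
  unfolding bilinear_def
  by (intro conjI allI linearI) (simp_all add: cross7_def vec_eq_iff forall_7 algebra_simps)

lemmas cross7_simps = bilinear_ladd[OF bilinear_cross7] bilinear_radd[OF bilinear_cross7]
  bilinear_lmul[OF bilinear_cross7] bilinear_rmul[OF bilinear_cross7]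
  bilinear_lneg[OF bilinear_cross7] bilinear_rneg[OF bilinear_cross7]
  bilinear_lzero[OF bilinear_cross7] bilinear_rzero[OF bilinear_cross7]
  bilinear_lsub[OF bilinear_cross7] bilinear_rsub[OF bilinear_cross7]

lemma cross7_self [simp]: "cross7 u u = 0"
  by (simp add: cross7_def vec7_arith)

lemma inner_cross7_cyclic: "cross7 u v \<bullet> w = cross7 v w \<bullet> u"
  by (simp add: cross7_def inner_vec_def sum_7 algebra_simps)

text \<open>The polarised form of u \<times> (u \<times> w) = <u, w> u - |u|^2 w.\<close>

lemma cross7_cross7_sym:
  "cross7 u (cross7 v w) + cross7 v (cross7 u w)
    = (u \<bullet> w) *\<^sub>R v + (v \<bullet> w) *\<^sub>R u - (2 * (u \<bullet> v)) *\<^sub>R w"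
  by (simp add: cross7_def vec_eq_iff forall_7 inner_vec_def sum_7 algebra_simps)

text \<open>With a = Tz, the left side is what the product rule makes of - u \<times> (v \<times> w)
  when the cross product has derivative \<chi>(Tz, ., .) in direction z. The right side is therefore
  the derivative of \<chi>. The double product rule at \<open>a\<close>, \<open>u\<close>,
  \<open>cross7 v w\<close> and cyclicity of the triple product give the equality.\<close>

lemma cross7_chi7:
  "- chi7 a u (cross7 v w) - cross7 u (chi7 a v w)
    = (cross7 u v \<bullet> w) *\<^sub>R a - (a \<bullet> u) *\<^sub>R cross7 v w + (a \<bullet> v) *\<^sub>R cross7 u w - (a \<bullet> w) *\<^sub>R cross7 u v"
  using cross7_cross7_sym[of a u "cross7 v w"] inner_cross7_cyclic[of v w u] inner_cross7_cyclic[of u v w]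
  by (simp add: chi7_def cross7_simps inner_commute vec_eq_iff algebra_simps)

section \<open>The bracket of the standard cross products\<close>

text \<open>The exterior derivative of a form, written through its directional derivatives
  \<open>D z\<close>.\<close>

definition alternation :: "(real^7 \<Rightarrow> (real^7) list \<Rightarrow> real^7) \<Rightarrow> (real^7) list \<Rightarrow> real^7" where
  "alternation D vs = (\<Sum>i<length vs. (-1) ^ i *\<^sub>R D (vs ! i) (take i vs @ drop (Suc i) vs))"

text \<open>The bracket at a point from the values and first derivatives of both forms. The
  derivatives are separate arguments, so partial derivatives, covariant derivatives and Christoffel
  terms can all be inserted. The last two summands stem from the terms of the bracket with exterior
  derivatives.\<close>

definition fn_expression :: "nat \<Rightarrow> ((real^7) list \<Rightarrow> real^7) \<Rightarrow> (real^7 \<Rightarrow> (real^7) list \<Rightarrow> real^7) \<Rightarrow>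
    ((real^7) list \<Rightarrow> real^7) \<Rightarrow> (real^7 \<Rightarrow> (real^7) list \<Rightarrow> real^7) \<Rightarrow> (real^7) list \<Rightarrow> real^7" where
  "fn_expression k \<Phi> D\<Phi> \<Psi> D\<Psi> vs = shuffle_sum (\<lambda>I J. D\<Psi> (\<Phi> I) J - D\<Phi> (\<Psi> J) I
     + (-1) ^ k *\<^sub>R (\<Psi> (alternation D\<Phi> I # J) + \<Phi> (alternation D\<Psi> J # I))) vs"

definition cross_form :: "(real^7) list \<Rightarrow> real^7" where
  "cross_form vs = (case vs of [u, v] \<Rightarrow> cross7 u v | _ \<Rightarrow> 0)"

definition chi_form :: "(real^7) list \<Rightarrow> real^7" where
  "chi_form vs = (case vs of [u, v, w] \<Rightarrow> chi7 u v w | _ \<Rightarrow> 0)"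

text \<open>The covariant derivative of the cross product in direction \<open>z\<close>, in frame
  coordinates, for the torsion endomorphism \<open>T\<close>; \<open>nabla_chi\<close> is its
  analogue for \<chi>.\<close>

definition nabla_cross :: "(real^7 \<Rightarrow> real^7) \<Rightarrow> real^7 \<Rightarrow> (real^7) list \<Rightarrow> real^7" where
  "nabla_cross T z vs = (case vs of [u, v] \<Rightarrow> chi7 (T z) u v | _ \<Rightarrow> 0)"

definition nabla_chi :: "(real^7 \<Rightarrow> real^7) \<Rightarrow> real^7 \<Rightarrow> (real^7) list \<Rightarrow> real^7" where
  "nabla_chi T z vs = (case vs of [u, v, w] \<Rightarrow> (cross7 u v \<bullet> w) *\<^sub>R T z
     - (T z \<bullet> u) *\<^sub>R cross7 v w + (T z \<bullet> v) *\<^sub>R cross7 u w - (T z \<bullet> w) *\<^sub>R cross7 u v | _ \<Rightarrow> 0)"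

definition transpose7 :: "(real^7 \<Rightarrow> real^7) \<Rightarrow> real^7 \<Rightarrow> real^7" where
  "transpose7 T v = (\<chi> i. T (axis i 1) \<bullet> v)"

definition trace7 :: "(real^7 \<Rightarrow> real^7) \<Rightarrow> real" where
  "trace7 T = (\<Sum>i\<in>UNIV. T (axis i 1) $ i)"

text \<open>The contraction of the skew part of \<open>T\<close> with \<phi>. It vanishes on V_1,
  V_14 and V_27 and takes m \<times> to 6 m, so it isolates V_7.\<close>

definition skew_vector :: "(real^7 \<Rightarrow> real^7) \<Rightarrow> real^7" where
  "skew_vector T = (\<Sum>i\<in>UNIV. cross7 (axis i 1) (T (axis i 1)))"

lemma alternation_simps:
  "alternation D [] = 0"
  "alternation D [a] = D a []"
  "alternation D [a, b] = D a [b] - D b [a]"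
  "alternation D [a, b, c] = D a [b, c] - D b [a, c] + D c [a, b]"
  "alternation D [a, b, c, d] = D a [b, c, d] - D b [a, c, d] + D c [a, b, d] - D d [a, b, c]"
  by (simp_all add: alternation_def eval_nat_numeral)

lemma linear_vec7:
  assumes "linear T"
  shows "T (vec7 a b c d e f g) = a *\<^sub>R T (axis 1 1) + b *\<^sub>R T (axis 2 1) + c *\<^sub>R T (axis 3 1)
    + d *\<^sub>R T (axis 4 1) + e *\<^sub>R T (axis 5 1) + f *\<^sub>R T (axis 6 1) + g *\<^sub>R T (axis 7 1)"
proof -
  have "vec7 a b c d e f g = a *\<^sub>R axis 1 1 + b *\<^sub>R axis 2 1 + c *\<^sub>R axis 3 1
    + d *\<^sub>R axis 4 1 + e *\<^sub>R axis 5 1 + f *\<^sub>R axis 6 1 + g *\<^sub>R axis 7 1"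
    by (simp add: axis_eq_vec7 vec7_arith)
  then show ?thesis
    by (simp only: linear_add[OF assms] linear_scale[OF assms])
qed

text \<open>The action of \<open>T\<close> as a rewrite rule on literal vectors,
  \<open>t i j\<close> being the j-th coordinate of T e_i. It reduces the bracket formulas to
  identities in 49 unknowns.\<close>

definition coordinates :: "(real^7 \<Rightarrow> real^7) \<Rightarrow> (7 \<Rightarrow> 7 \<Rightarrow> real) \<Rightarrow> bool" where
  "coordinates T t \<longleftrightarrow> (\<forall>a b c d e f g. T (vec7 a b c d e f g) = vec7
      (a * t 1 1 + b * t 2 1 + c * t 3 1 + d * t 4 1 + e * t 5 1 + f * t 6 1 + g * t 7 1)
      (a * t 1 2 + b * t 2 2 + c * t 3 2 + d * t 4 2 + e * t 5 2 + f * t 6 2 + g * t 7 2)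
      (a * t 1 3 + b * t 2 3 + c * t 3 3 + d * t 4 3 + e * t 5 3 + f * t 6 3 + g * t 7 3)
      (a * t 1 4 + b * t 2 4 + c * t 3 4 + d * t 4 4 + e * t 5 4 + f * t 6 4 + g * t 7 4)
      (a * t 1 5 + b * t 2 5 + c * t 3 5 + d * t 4 5 + e * t 5 5 + f * t 6 5 + g * t 7 5)
      (a * t 1 6 + b * t 2 6 + c * t 3 6 + d * t 4 6 + e * t 5 6 + f * t 6 6 + g * t 7 6)
      (a * t 1 7 + b * t 2 7 + c * t 3 7 + d * t 4 7 + e * t 5 7 + f * t 6 7 + g * t 7 7))"

lemma linear_coordinates:
  assumes "linear T" shows "coordinates T (\<lambda>i j. T (axis i 1) $ j)"
  by (simp add: coordinates_def linear_vec7[OF assms] vec_eq_iff forall_7)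

lemma coordinates_transpose7:
  assumes "coordinates T t" shows "coordinates (transpose7 T) (\<lambda>i j. t j i)"
  using assms
  by (simp add: coordinates_def transpose7_def axis_eq_vec7 vec7_arith vec_eq_iff[of "\<chi> i. f i" for f]
    forall_7 mult.commute)

lemma coordinates_trace7:
  assumes "coordinates T t" shows "trace7 T = t 1 1 + t 2 2 + t 3 3 + t 4 4 + t 5 5 + t 6 6 + t 7 7"
  using assms by (simp add: coordinates_def trace7_def sum_7 axis_eq_vec7)

text \<open>Evaluation runs in stages: lists and shuffles are unfolded while vectors are still
  symbols, then the sparse coordinate vectors are inserted. These rules discard the many zero terms
  early, and general algebra is left for the end.\<close>

lemmas ring_eval = mult_zero_left mult_zero_right mult_1_left mult_1_right mult_minus_left mult_minus_right
  minus_minus add_0_left add_0_right diff_0 diff_0_right minus_zero add_uminus_conv_diff diff_minus_eq_add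

lemmas shuffle_eval = shuffle_sum.simps list.size power_Suc power_0 One_nat_def add_Suc add_Suc_right
  numeral_3_eq_3 numeral_2_eq_2 scaleR_minus_left scaleR_one scaleR_zero_right scaleR_zero_left diff_self list.case alternation_simps

lemmas form_eval = fn_expression_def chi_form_def cross_form_def nabla_chi_def nabla_cross_def

lemmas vec7_eval = axis_eq_vec7 skew_vector_def sum_7 chi7_def cross7_vec7 vec7_arith

text \<open>\<open>M i\<close> is the value of L at e_i. The sign alternates because \<star>e^i
  takes the value (-1)^(i-1) on the remaining axes in increasing order.\<close>

lemma fn_expression_chi_chi_coordinates:
  assumes T: "coordinates T t"
  defines "F \<equiv> fn_expression 3 chi_form (nabla_chi T) chi_form (nabla_chi T)"
    and "M i \<equiv> - 10 *\<^sub>R T (axis i 1) + 2 *\<^sub>R transpose7 T (axis i 1) + 6 *\<^sub>R cross7 (skew_vector T) (axis i 1)"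
  shows
    "F [axis 2 1, axis 3 1, axis 4 1, axis 5 1, axis 6 1, axis 7 1] = M 1"
    "F [axis 1 1, axis 3 1, axis 4 1, axis 5 1, axis 6 1, axis 7 1] = - M 2"
    "F [axis 1 1, axis 2 1, axis 4 1, axis 5 1, axis 6 1, axis 7 1] = M 3"
    "F [axis 1 1, axis 2 1, axis 3 1, axis 5 1, axis 6 1, axis 7 1] = - M 4"
    "F [axis 1 1, axis 2 1, axis 3 1, axis 4 1, axis 6 1, axis 7 1] = M 5"
    "F [axis 1 1, axis 2 1, axis 3 1, axis 4 1, axis 5 1, axis 7 1] = - M 6"
    "F [axis 1 1, axis 2 1, axis 3 1, axis 4 1, axis 5 1, axis 6 1] = M 7"
  unfolding F_def M_def
  by (simp only: form_eval shuffle_eval ring_eval,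
      simp only: vec7_eval ring_eval T[unfolded coordinates_def, rule_format]
        coordinates_transpose7[OF T, unfolded coordinates_def, rule_format] vec7_eq_iff,
      intro conjI; simp add: algebra_simps)+

definition cross_2form :: "real^7 \<Rightarrow> (real^7) list \<Rightarrow> real" where
  "cross_2form x vs = (case vs of [u, v] \<Rightarrow> cross7 u v \<bullet> x | _ \<Rightarrow> 0)"

text \<open>Of the 21 ways to split off two axes only three meet the 2-form \<iota>_{e_i} \<phi>,
  which for i = 1 is e^23 + e^45 + e^67. Shuffles keep the complement in increasing order, so
  \<open>F\<close> may be any function of lists.\<close>

lemma shuffle_sum_cross_2form:
  fixes F :: "(real^7) list \<Rightarrow> 'b::real_vector"
  defines "S i \<equiv> shuffle_sum (\<lambda>I J. cross_2form (axis i 1) J *\<^sub>R F I) [axis 1 1, axis 2 1, axis 3 1, axis 4 1, axis 5 1, axis 6 1, axis 7 1]"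
  shows
    "S 1 = F [axis 1 1, axis 4 1, axis 5 1, axis 6 1, axis 7 1] + F [axis 1 1, axis 2 1, axis 3 1, axis 6 1, axis 7 1] + F [axis 1 1, axis 2 1, axis 3 1, axis 4 1, axis 5 1]"
    "S 2 = F [axis 2 1, axis 4 1, axis 5 1, axis 6 1, axis 7 1] + F [axis 1 1, axis 2 1, axis 3 1, axis 4 1, axis 6 1] - F [axis 1 1, axis 2 1, axis 3 1, axis 5 1, axis 7 1]"
    "S 3 = F [axis 3 1, axis 4 1, axis 5 1, axis 6 1, axis 7 1] - F [axis 1 1, axis 2 1, axis 3 1, axis 5 1, axis 6 1] - F [axis 1 1, axis 2 1, axis 3 1, axis 4 1, axis 7 1]"
    "S 4 = F [axis 2 1, axis 3 1, axis 4 1, axis 6 1, axis 7 1] + F [axis 1 1, axis 3 1, axis 4 1, axis 5 1, axis 7 1] - F [axis 1 1, axis 2 1, axis 4 1, axis 5 1, axis 6 1]"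
    "S 5 = F [axis 2 1, axis 3 1, axis 5 1, axis 6 1, axis 7 1] + F [axis 1 1, axis 3 1, axis 4 1, axis 5 1, axis 6 1] + F [axis 1 1, axis 2 1, axis 4 1, axis 5 1, axis 7 1]"
    "S 6 = F [axis 2 1, axis 3 1, axis 4 1, axis 5 1, axis 6 1] + F [axis 1 1, axis 2 1, axis 4 1, axis 6 1, axis 7 1] - F [axis 1 1, axis 3 1, axis 5 1, axis 6 1, axis 7 1]"
    "S 7 = F [axis 2 1, axis 3 1, axis 4 1, axis 5 1, axis 7 1] - F [axis 1 1, axis 3 1, axis 4 1, axis 6 1, axis 7 1] - F [axis 1 1, axis 2 1, axis 5 1, axis 6 1, axis 7 1]"
  unfolding S_def
  by (simp only: shuffle_eval cross_2form_def ring_eval,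
      simp only: axis_eq_vec7 cross7_vec7 vec7_arith(5) ring_eval scaleR_zero_left scaleR_one scaleR_minus_left,
      simp add: algebra_simps)+

text \<open>\<open>M i\<close> is the value of K at e_i. The factor 3 is also produced by
  \<star>\<phi> \<and> v^flat under this pairing, so it cancels when K is read off.\<close>

lemma fn_expression_cross_chi_coordinates:
  assumes T: "coordinates T t"
  defines "S i \<equiv> shuffle_sum (\<lambda>I J. cross_2form (axis i 1) J *\<^sub>R
      fn_expression 2 cross_form (nabla_cross T) chi_form (nabla_chi T) I) [axis 1 1, axis 2 1, axis 3 1, axis 4 1, axis 5 1, axis 6 1, axis 7 1]"
    and "M i \<equiv> 2 *\<^sub>R T (axis i 1) - 4 *\<^sub>R transpose7 T (axis i 1) - (2 * trace7 T) *\<^sub>R axis i 1"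
  shows
    "S 1 = 3 *\<^sub>R M 1"
    "S 2 = 3 *\<^sub>R M 2"
    "S 3 = 3 *\<^sub>R M 3"
    "S 4 = 3 *\<^sub>R M 4"
    "S 5 = 3 *\<^sub>R M 5"
    "S 6 = 3 *\<^sub>R M 6"
    "S 7 = 3 *\<^sub>R M 7"
  unfolding S_def shuffle_sum_cross_2form M_def coordinates_trace7[OF T]
  by (simp only: form_eval shuffle_eval ring_eval,
      simp only: vec7_eval ring_eval T[unfolded coordinates_def, rule_format]
        coordinates_transpose7[OF T, unfolded coordinates_def, rule_format] vec7_eq_iff,
      intro conjI; simp add: algebra_simps)+

section \<open>Independence of the connection\<close>

text \<open>Partial minus covariant derivative of a vector-valued form: \<Gamma> enters every
  argument slot and, with the opposite sign, acts on the value.\<close>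

definition connection_action ::
    "(real^7 \<Rightarrow> real^7 \<Rightarrow> real^7) \<Rightarrow> ((real^7) list \<Rightarrow> real^7) \<Rightarrow> real^7 \<Rightarrow> (real^7) list \<Rightarrow> real^7" where
  "connection_action \<Gamma> \<Phi> z vs = (\<Sum>i<length vs. \<Phi> (vs[i := \<Gamma> z (vs ! i)])) - \<Gamma> z (\<Phi> vs)"

text \<open>Every summand contains exactly one derivative, and linearly. Hence partial derivatives
  may be split into covariant ones and Christoffel terms.\<close>

lemma fn_expression_add:
  assumes "\<And>J. linear (\<lambda>w. \<Phi> (w # J))" "\<And>J. linear (\<lambda>w. \<Psi> (w # J))"
  shows "fn_expression k \<Phi> (\<lambda>z vs. D\<Phi> z vs + D\<Phi>' z vs) \<Psi> (\<lambda>z vs. D\<Psi> z vs + D\<Psi>' z vs) vs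
    = fn_expression k \<Phi> D\<Phi> \<Psi> D\<Psi> vs + fn_expression k \<Phi> D\<Phi>' \<Psi> D\<Psi>' vs"
proof -
  have "alternation (\<lambda>z vs. D z vs + D' z vs) I = alternation D I + alternation D' I" for D D' I
    by (simp add: alternation_def scaleR_add_right sum.distrib)
  then show ?thesis
    unfolding fn_expression_def shuffle_sum_add[symmetric]
    by (simp add: linear_add[OF assms(1)] linear_add[OF assms(2)] algebra_simps)
qed

context
  fixes \<Gamma> :: "real^7 \<Rightarrow> real^7 \<Rightarrow> real^7"
  assumes bil: "bilinear \<Gamma>" and sym: "\<And>u v. \<Gamma> u v = \<Gamma> v u"
begin

lemma connection_action_eq_0:
  assumes "is_form k \<Phi>" "length vs \<noteq> k" shows "connection_action \<Gamma> \<Phi> z vs = 0"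
  using assms by (simp add: connection_action_def is_formD_length bilinear_rzero[OF bil])

lemma alternation_connection_action_eq_0:
  assumes "is_form k \<Phi>" "length vs \<noteq> Suc k"
  shows "alternation (connection_action \<Gamma> \<Phi>) vs = 0"
  using assms unfolding alternation_def
  by (intro sum.neutral ballI) (simp add: connection_action_eq_0[of k])

text \<open>A normal form for simplification: an argument produced by \<Gamma> moves to the front
  with the sign of the move, so that cancelling terms meet.\<close>

lemma form_eval_slots:
  assumes \<Phi>: "is_form k \<Phi>"
  shows "\<Phi> ((a + b) # vs) = \<Phi> (a # vs) + \<Phi> (b # vs)" "\<Phi> ((- a) # vs) = - \<Phi> (a # vs)"
    "\<Phi> ((a - b) # vs) = \<Phi> (a # vs) - \<Phi> (b # vs)"
    "\<Phi> [u, \<Gamma> z v] = - \<Phi> [\<Gamma> z v, u]"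
    "\<Phi> [u, \<Gamma> z v, w] = - \<Phi> [\<Gamma> z v, u, w]"
    "\<Phi> [u, w, \<Gamma> z v] = \<Phi> [\<Gamma> z v, u, w]"
proof -
  have lin: "linear (\<lambda>a. \<Phi> (a # vs))" using is_formD_linear[OF \<Phi>, of "[]" vs] by simp
  show "\<Phi> ((a + b) # vs) = \<Phi> (a # vs) + \<Phi> (b # vs)" "\<Phi> ((- a) # vs) = - \<Phi> (a # vs)"
    "\<Phi> ((a - b) # vs) = \<Phi> (a # vs) - \<Phi> (b # vs)"
    using linear_add[OF lin] linear_neg[OF lin] linear_diff[OF lin] by simp_all
qed (use is_form_swap[OF \<Phi>, of "[]" u "\<Gamma> z v"] is_form_swap[OF \<Phi>, of "[u]" w "\<Gamma> z v"] in simp_all)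

text \<open>Terms with \<Gamma> in an argument slot come in pairs containing \<Gamma> a b and
  \<Gamma> b a with opposite signs, which symmetry cancels. The terms with \<Gamma> outside
  remain.\<close>

lemma alternation_connection_action:
  shows "is_form 2 \<Phi> \<Longrightarrow> alternation (connection_action \<Gamma> \<Phi>) [a, b, c]
      = - \<Gamma> a (\<Phi> [b, c]) + \<Gamma> b (\<Phi> [a, c]) - \<Gamma> c (\<Phi> [a, b])"
    and "is_form 3 \<Phi> \<Longrightarrow> alternation (connection_action \<Gamma> \<Phi>) [a, b, c, d]
      = - \<Gamma> a (\<Phi> [b, c, d]) + \<Gamma> b (\<Phi> [a, c, d]) - \<Gamma> c (\<Phi> [a, b, d]) + \<Gamma> d (\<Phi> [a, b, c])"
  by (simp_all add: alternation_simps connection_action_def lessThan_Suc form_eval_slots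
      sym[of b a] sym[of c a] sym[of d a] sym[of c b] sym[of d b] sym[of d c] eval_nat_numeral)

lemma fn_expression_connection_action_2_3:
  assumes \<Phi>: "is_form 2 \<Phi>" and \<Psi>: "is_form 3 \<Psi>"
  shows "fn_expression 2 \<Phi> (connection_action \<Gamma> \<Phi>) \<Psi> (connection_action \<Gamma> \<Psi>) [a, b, c, d, e] = 0"
proof -
  note 0 = is_formD_length[OF \<Phi>] is_formD_length[OF \<Psi>] connection_action_eq_0[OF \<Phi>]
    connection_action_eq_0[OF \<Psi>] alternation_connection_action_eq_0[OF \<Phi>]
    alternation_connection_action_eq_0[OF \<Psi>]
  have c: "connection_action \<Gamma> \<Phi> z [u, v] = \<Phi> [\<Gamma> z u, v] - \<Phi> [\<Gamma> z v, u] - \<Gamma> z (\<Phi> [u, v])"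
    "connection_action \<Gamma> \<Psi> z [u, v, w]
      = \<Psi> [\<Gamma> z u, v, w] - \<Psi> [\<Gamma> z v, u, w] + \<Psi> [\<Gamma> z w, u, v] - \<Gamma> z (\<Psi> [u, v, w])" for z u v w
    by (simp_all add: connection_action_def form_eval_slots[OF \<Phi>] form_eval_slots[OF \<Psi>] eval_nat_numeral)
  \<comment> \<open>Symmetry is stated for this shape only, which gives it a direction as a rewrite
    rule.\<close>
  have s: "\<Gamma> (\<Psi> [p, q, r]) (\<Phi> [u, v]) = \<Gamma> (\<Phi> [u, v]) (\<Psi> [p, q, r])" for p q r u v
    by (rule sym)
  show ?thesis
    unfolding fn_expression_def
    by (simp add: 0 c s alternation_connection_action(1)[OF \<Phi>] alternation_connection_action(2)[OF \<Psi>]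
        form_eval_slots[OF \<Phi>] form_eval_slots[OF \<Psi>] sym[of _ a] sym[of _ b] sym[of _ c] sym[of _ d] sym[of _ e])
qed

lemma fn_expression_connection_action_3_3:
  assumes \<Phi>: "is_form 3 \<Phi>" and \<Psi>: "is_form 3 \<Psi>"
  shows "fn_expression 3 \<Phi> (connection_action \<Gamma> \<Phi>) \<Psi> (connection_action \<Gamma> \<Psi>) [a, b, c, d, e, f] = 0"
proof -
  note 0 = is_formD_length[OF \<Phi>] is_formD_length[OF \<Psi>] connection_action_eq_0[OF \<Phi>]
    connection_action_eq_0[OF \<Psi>] alternation_connection_action_eq_0[OF \<Phi>]
    alternation_connection_action_eq_0[OF \<Psi>]
  have c: "connection_action \<Gamma> \<Phi> z [u, v, w]
      = \<Phi> [\<Gamma> z u, v, w] - \<Phi> [\<Gamma> z v, u, w] + \<Phi> [\<Gamma> z w, u, v] - \<Gamma> z (\<Phi> [u, v, w])"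
    "connection_action \<Gamma> \<Psi> z [u, v, w]
      = \<Psi> [\<Gamma> z u, v, w] - \<Psi> [\<Gamma> z v, u, w] + \<Psi> [\<Gamma> z w, u, v] - \<Gamma> z (\<Psi> [u, v, w])" for z u v w
    by (simp_all add: connection_action_def form_eval_slots[OF \<Phi>] form_eval_slots[OF \<Psi>] eval_nat_numeral)
  \<comment> \<open>The two forms are separate variables, although both become \<chi> later; this
    keeps the rule directed.\<close>
  have s: "\<Gamma> (\<Psi> [p, q, r]) (\<Phi> [u, v, w]) = \<Gamma> (\<Phi> [u, v, w]) (\<Psi> [p, q, r])" for p q r u v w
    by (rule sym)
  show ?thesis
    unfolding fn_expression_def
    by (simp add: 0 c s alternation_connection_action(2)[OF \<Phi>] alternation_connection_action(2)[OF \<Psi>]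
        form_eval_slots[OF \<Phi>] form_eval_slots[OF \<Psi>] sym[of _ a] sym[of _ b] sym[of _ c] sym[of _ d] sym[of _ e] sym[of _ f])
qed

end

section \<open>Wedge products with the 4-form in standard coordinates\<close>

definition star_form :: "(real^7) list \<Rightarrow> real" where
  "star_form vs = (case vs of [a, b, c, d] \<Rightarrow> chi7 a b c \<bullet> d | _ \<Rightarrow> 0)"

lemma shuffle_sum_map:
  "shuffle_sum H (map f vs) = shuffle_sum (\<lambda>I J. H (map f I) (map f J)) vs"
  by (induction vs arbitrary: H) simp_all

text \<open>The identity \<star>\<phi> \<and> \<iota>_v \<phi> = 3 \<star>v^flat, paired with a
  1-form. It is the origin of the factor 3 in the computation of K.\<close>

lemma star_form_wedge_one_form:
  defines "S x i \<equiv> shuffle_sum (\<lambda>I J. cross_2form (axis i 1) J *\<^sub>R (star_form \<and>\<^sub>f one_form (\<lambda>w. x \<bullet> w)) I)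
      [axis 1 1, axis 2 1, axis 3 1, axis 4 1, axis 5 1, axis 6 1, axis 7 1]"
  shows "S x i = 3 * x $ i"
proof -
  obtain a b c d e f g where x: "x = vec7 a b c d e f g" using vec7_eta by metis
  have "S x 1 = 3 * x $ 1" "S x 2 = 3 * x $ 2" "S x 3 = 3 * x $ 3" "S x 4 = 3 * x $ 4"
    "S x 5 = 3 * x $ 5" "S x 6 = 3 * x $ 6" "S x 7 = 3 * x $ 7"
    unfolding S_def shuffle_sum_cross_2form x
    by (simp only: wedge_eq_shuffle_sum star_form_def one_form_def shuffle_eval ring_eval,
      simp only: vec7_eval ring_eval vec7_nth, simp?)+
  then show ?thesis using exhaust_7[of i] by metis
qed

definition skew_form :: "(real^7 \<Rightarrow> real^7) \<Rightarrow> (real^7) list \<Rightarrow> real" where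
  "skew_form A vs = (case vs of [u, v] \<Rightarrow> A u \<bullet> v - A v \<bullet> u | _ \<Rightarrow> 0)"

text \<open>Invariantly, \<star>\<phi> \<and> \<sigma>_A is the Hodge dual of the skew vector of
  \<open>A\<close>. Membership of \<sigma>_A in \<Lambda>^2_14 thus becomes one vector
  equation.\<close>

lemma star_form_wedge_skew_form_coordinates:
  assumes A: "coordinates A t"
  defines "S \<equiv> star_form \<and>\<^sub>f skew_form A"
  shows
    "S [axis 2 1, axis 3 1, axis 4 1, axis 5 1, axis 6 1, axis 7 1] = skew_vector A $ 1"
    "S [axis 1 1, axis 3 1, axis 4 1, axis 5 1, axis 6 1, axis 7 1] = - (skew_vector A $ 2)"
    "S [axis 1 1, axis 2 1, axis 4 1, axis 5 1, axis 6 1, axis 7 1] = skew_vector A $ 3"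
    "S [axis 1 1, axis 2 1, axis 3 1, axis 5 1, axis 6 1, axis 7 1] = - (skew_vector A $ 4)"
    "S [axis 1 1, axis 2 1, axis 3 1, axis 4 1, axis 6 1, axis 7 1] = skew_vector A $ 5"
    "S [axis 1 1, axis 2 1, axis 3 1, axis 4 1, axis 5 1, axis 7 1] = - (skew_vector A $ 6)"
    "S [axis 1 1, axis 2 1, axis 3 1, axis 4 1, axis 5 1, axis 6 1] = skew_vector A $ 7"
  unfolding S_def
  by (simp only: wedge_eq_shuffle_sum star_form_def skew_form_def shuffle_eval ring_eval,
      simp only: vec7_eval ring_eval vec7_nth A[unfolded coordinates_def, rule_format], simp?)+

section \<open>Decomposition of endomorphisms\<close>

lemma axis_nth: "(axis i 1 :: real^7) $ j = (if j = i then 1 else 0)"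
  by (simp add: axis_def)

text \<open>The V_7 projection; 1/6 inverts the factor in \<open>skew_vector_cross7\<close>.\<close>

definition skew_part :: "(real^7 \<Rightarrow> real^7) \<Rightarrow> real^7 \<Rightarrow> real^7" where
  "skew_part A x = (1/6) *\<^sub>R cross7 (skew_vector A) x"

context
  fixes A :: "real^7 \<Rightarrow> real^7" assumes A: "linear A"
begin

lemma linear_expand: "A x = (\<Sum>i\<in>UNIV. x $ i *\<^sub>R A (axis i 1))"
proof -
  have "A x = A (\<Sum>i\<in>UNIV. x $ i *\<^sub>R axis i 1)"
    by (rule arg_cong[of _ _ A]) (simp add: vec_eq_iff axis_def if_distrib cong: if_cong)
  then show ?thesis by (simp add: linear_sum[OF A] linear_scale[OF A])
qed

lemma inner_transpose7: "transpose7 A x \<bullet> y = x \<bullet> A y"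
proof -
  have "x \<bullet> A y = (\<Sum>i\<in>UNIV. y $ i * (x \<bullet> A (axis i 1)))"
    by (subst linear_expand) (simp add: inner_sum_right)
  then show ?thesis
    unfolding inner_vec_def[of "transpose7 A x"] by (simp add: transpose7_def inner_commute[of _ x] mult.commute)
qed

end

lemma linear_transpose7: "linear (transpose7 A)"
  by (rule linearI) (simp_all add: transpose7_def vec_eq_iff inner_add_right)

text \<open>Adjointness determines the transpose, which allows other descriptions of it to be
  recognised.\<close>

lemma transpose7_unique:
  assumes "linear A" "\<And>x y. B x \<bullet> y = x \<bullet> A y" shows "B = transpose7 A"
proof
  show "B x = transpose7 A x" for x
    using assms(2)[of x] inner_transpose7[OF assms(1), of x] vector_eq_rdot by metis
qed

lemma transpose7_transpose7: "linear A \<Longrightarrow> transpose7 (transpose7 A) = A"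
  by (rule transpose7_unique[symmetric, OF linear_transpose7]) (metis inner_transpose7 inner_commute)

lemma transpose7_add: "transpose7 (\<lambda>x. A x + B x) x = transpose7 A x + transpose7 B x"
  and transpose7_diff: "transpose7 (\<lambda>x. A x - B x) x = transpose7 A x - transpose7 B x"
  and transpose7_scale: "transpose7 (\<lambda>x. r *\<^sub>R A x) x = r *\<^sub>R transpose7 A x"
  and transpose7_id: "transpose7 (\<lambda>x. x) x = x"
  by (simp_all add: transpose7_def vec_eq_iff inner_simps inner_axis')

lemma transpose7_cross7: "transpose7 (cross7 m) x = - cross7 m x"
proof -
  have "(\<lambda>x. - cross7 m x) = transpose7 (cross7 m)"
  proof (rule transpose7_unique)
    show "linear (cross7 m)" using bilinear_cross7 by (simp add: bilinear_def)
    show "- cross7 m x \<bullet> y = x \<bullet> cross7 m y" for x y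
      by (simp add: cross7_def inner_vec_def sum_7 algebra_simps)
  qed
  then show ?thesis by metis
qed

lemma trace7_add: "trace7 (\<lambda>x. A x + B x) = trace7 A + trace7 B"
  and trace7_diff: "trace7 (\<lambda>x. A x - B x) = trace7 A - trace7 B"
  and trace7_scale: "trace7 (\<lambda>x. r *\<^sub>R A x) = r * trace7 A"
  and trace7_id: "trace7 (\<lambda>x. x) = 7"
  and trace7_transpose7: "trace7 (transpose7 A) = trace7 A"
  and trace7_cross7: "trace7 (cross7 m) = 0"
  by (simp_all add: trace7_def sum.distrib sum_subtractf sum_distrib_left transpose7_def inner_axis)
    (simp_all add: cross7_def sum_7 axis_def)

lemma skew_vector_add: "skew_vector (\<lambda>x. A x + B x) = skew_vector A + skew_vector B"
  and skew_vector_diff: "skew_vector (\<lambda>x. A x - B x) = skew_vector A - skew_vector B"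
  and skew_vector_scale: "skew_vector (\<lambda>x. r *\<^sub>R A x) = r *\<^sub>R skew_vector A"
  and skew_vector_id: "skew_vector (\<lambda>x. x) = 0"
  by (simp_all add: skew_vector_def sum.distrib sum_subtractf scaleR_sum_right cross7_simps)

text \<open>Exchanging row and column index reverses the cross product of the two axes, so only the
  skew part contributes.\<close>

lemma skew_vector_transpose7:
  "skew_vector (transpose7 A) = - skew_vector A"
  by (simp add: skew_vector_def sum_7 vec_eq_iff forall_7 cross7_def transpose7_def inner_axis axis_nth)

text \<open>The contraction \<phi>_{iab} \<phi>_{jab} = 6 \<delta>_{ij}.\<close>

lemma skew_vector_cross7: "skew_vector (cross7 m) = 6 *\<^sub>R m"
  by (simp add: skew_vector_def sum_7 vec_eq_iff forall_7 cross7_def axis_def)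

text \<open>The projections onto the four summands. V_14 is what remains of the skew part after V_7
  is removed, and the last branch serves V_27.\<close>

fun part7 :: "nat \<Rightarrow> (real^7 \<Rightarrow> real^7) \<Rightarrow> real^7 \<Rightarrow> real^7" where
  "part7 k A x = (if k = 1 then (trace7 A / 7) *\<^sub>R x
    else if k = 7 then skew_part A x
    else if k = 14 then (1/2) *\<^sub>R (A x - transpose7 A x) - skew_part A x
    else (1/2) *\<^sub>R (A x + transpose7 A x) - (trace7 A / 7) *\<^sub>R x)"

declare part7.simps [simp del]

text \<open>\<open>V_part\<close> in frame coordinates. For V_7, the condition \<sigma>_A =
  \<iota>_m \<phi> reads A - A^T = m \<times>, because \<sigma>_A(x, y) is the inner product of (A -
  A^T) x with y and \<phi>(m, x, y) is that of m \<times> x with y.\<close>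

definition summand7 :: "nat \<Rightarrow> (real^7 \<Rightarrow> real^7) set" where
  "summand7 k = (if k = 1 then {\<lambda>x. r *\<^sub>R x | r. True}
    else if k = 7 then {A. linear A \<and> transpose7 A = (\<lambda>x. - A x) \<and> (\<exists>m. \<forall>x. A x - transpose7 A x = cross7 m x)}
    else if k = 14 then {A. linear A \<and> transpose7 A = (\<lambda>x. - A x) \<and> skew_vector A = 0}
    else if k = 27 then {A. linear A \<and> transpose7 A = A \<and> trace7 A = 0} else {})"

lemma linear_part7: assumes "linear A" shows "linear (part7 k A)"
proof -
  have "linear (skew_part A)"
    by (rule linearI) (simp_all add: skew_part_def cross7_simps scaleR_add_right)
  show ?thesis
    by (rule linearI)
      (simp_all add: part7.simps linear_add[OF assms] linear_scale[OF assms] linear_add[OF linear_transpose7]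
        linear_scale[OF linear_transpose7] linear_add[OF \<open>linear (skew_part A)\<close>]
        linear_scale[OF \<open>linear (skew_part A)\<close>] algebra_simps)
qed

lemma part7_add: "part7 k (\<lambda>x. A x + B x) x = part7 k A x + part7 k B x"
  and part7_scale: "part7 k (\<lambda>x. r *\<^sub>R A x) x = r *\<^sub>R part7 k A x"
  by (simp_all add: part7.simps trace7_add trace7_scale skew_part_def skew_vector_add skew_vector_scale
      transpose7_add transpose7_scale cross7_simps add_divide_distrib algebra_simps)

lemma part7_sum: "A x = part7 1 A x + part7 7 A x + part7 14 A x + part7 27 A x"
  by (simp add: part7.simps vec_eq_iff field_simps)

lemma transpose7_skew_part: "transpose7 (skew_part A) x = - skew_part A x"
  and trace7_skew_part: "trace7 (skew_part A) = 0"
  and skew_vector_skew_part: "skew_vector (skew_part A) = skew_vector A"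
  unfolding skew_part_def[abs_def]
  by (simp_all add: transpose7_scale transpose7_cross7 trace7_scale trace7_cross7 skew_vector_scale skew_vector_cross7)

lemma part7_in_summand7:
  assumes A: "linear A" and k: "k \<in> {1, 7, 14, 27}" shows "part7 k A \<in> summand7 k"
proof -
  note lin = linear_part7[OF A, of k]
  note eta = part7.simps[abs_def]
  have tt: "transpose7 (transpose7 A) x = A x" for x by (simp add: transpose7_transpose7[OF A])
  consider "k = 1" | "k = 7" | "k = 14" | "k = 27" using k by auto
  then show ?thesis
  proof cases
    case 1
    then show ?thesis by (auto simp: summand7_def eta)
  next
    case 2
    \<comment> \<open>A skew map minus its transpose is twice the map, hence 1/3 = 2/6.\<close>
    have "skew_part A x - transpose7 (skew_part A) x = cross7 ((1/3) *\<^sub>R skew_vector A) x" for x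
      by (simp add: transpose7_skew_part) (simp add: skew_part_def cross7_simps vec_eq_iff)
    then show ?thesis
      using 2 lin by (auto simp: summand7_def eta transpose7_skew_part)
  next
    case 3
    have "transpose7 (part7 k A) x = - part7 k A x" for x
      using 3 by (simp add: eta transpose7_diff transpose7_scale tt transpose7_skew_part) (simp add: vec_eq_iff field_simps)
    moreover have "skew_vector (part7 k A) = 0"
      using 3 by (simp add: eta skew_vector_diff skew_vector_scale skew_vector_transpose7 skew_vector_skew_part
          flip: scaleR_add_left)
    ultimately show ?thesis using lin 3 by (auto simp: summand7_def)
  next
    case 4
    have "transpose7 (part7 k A) x = part7 k A x" for x
      using 4 by (simp add: eta transpose7_diff transpose7_add transpose7_scale tt transpose7_id)
    moreover have "trace7 (part7 k A) = 0"
      using 4 by (simp add: eta trace7_diff trace7_add trace7_scale trace7_transpose7 trace7_id)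
    ultimately show ?thesis using lin 4 by (auto simp: summand7_def)
  qed
qed

text \<open>Directness of the sum and idempotence of the projections in one statement.\<close>

lemma part7_summand7:
  assumes A: "A \<in> summand7 j" and k: "k \<in> {1, 7, 14, 27}"
  shows "part7 k A x = (if k = j then A x else 0)"
proof -
  have j: "j = 1 \<or> j = 7 \<or> j = 14 \<or> j = 27"
    using A by (auto simp: summand7_def split: if_splits)
  consider "j = 1" | "j = 7" | "j = 14" | "j = 27" using j by auto
  then show ?thesis
  proof cases
    case 1
    then obtain r where r: "A = (\<lambda>x. r *\<^sub>R x)" using A by (auto simp: summand7_def)
    show ?thesis
      using k 1 by (auto simp: r part7.simps trace7_scale trace7_id skew_part_def skew_vector_scale skew_vector_id
          transpose7_scale transpose7_id cross7_simps simp flip: scaleR_add_left)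
  next
    case 2
    then obtain m where m: "\<And>x. A x - transpose7 A x = cross7 m x" and t: "transpose7 A = (\<lambda>x. - A x)"
      using A by (auto simp: summand7_def)
    \<comment> \<open>\<open>A\<close> is skew, so A - A^T = 2 A. This explains the 1/2, and 3 = 6/2
      below.\<close>
    have Ax: "A x = (1/2) *\<^sub>R cross7 m x" for x
      unfolding m[of x, symmetric] by (simp add: t flip: scaleR_2)
    then have "A = (\<lambda>x. (1/2) *\<^sub>R cross7 m x)" by (simp add: fun_eq_iff)
    then have "skew_vector A = 3 *\<^sub>R m" "trace7 A = 0"
      by (simp_all add: skew_vector_scale skew_vector_cross7 trace7_scale trace7_cross7)
    then show ?thesis
      using k 2 by (auto simp: part7.simps skew_part_def t cross7_simps Ax)
  next
    case 3
    then have t: "transpose7 A = (\<lambda>x. - A x)" and s: "skew_vector A = 0" using A by (auto simp: summand7_def)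
    have "trace7 A = 0" using trace7_transpose7[of A] trace7_scale[of "-1" A] by (simp add: t)
    then show ?thesis using k 3 by (auto simp: part7.simps skew_part_def t s cross7_simps vec_eq_iff)
  next
    case 4
    then have t: "transpose7 A = A" and tr: "trace7 A = 0" using A by (auto simp: summand7_def)
    \<comment> \<open>The skew vector changes sign under transposition, while \<open>A\<close> is
      symmetric.\<close>
    have s: "skew_vector A = 0" using skew_vector_transpose7[of A] by (simp add: t vec_eq_iff)
    show ?thesis using k 4 by (auto simp: part7.simps skew_part_def s t tr cross7_simps simp flip: scaleR_2)
  qed
qed

lemma part7_eq_0_iff:
  assumes "linear A"
  shows "(\<forall>x. part7 1 A x = 0) \<longleftrightarrow> trace7 A = 0"
    "(\<forall>x. part7 7 A x = 0) \<longleftrightarrow> skew_vector A = 0"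
    "(\<forall>x. part7 14 A x = 0) \<longleftrightarrow> (\<exists>m. \<forall>x. A x - transpose7 A x = cross7 m x)"
    "(\<forall>x. part7 27 A x = 0) \<longleftrightarrow> (\<forall>x. A x + transpose7 A x - (2/7 * trace7 A) *\<^sub>R x = 0)"
proof -
  show "(\<forall>x. part7 1 A x = 0) \<longleftrightarrow> trace7 A = 0"
    by (auto simp: part7.simps dest: spec[of _ "axis 1 1"])
  show "(\<forall>x. part7 7 A x = 0) \<longleftrightarrow> skew_vector A = 0"
  proof
    assume "\<forall>x. part7 7 A x = 0"
    then have "skew_part A = (\<lambda>x. 0)" by (simp add: part7.simps fun_eq_iff)
    then show "skew_vector A = 0"
      using skew_vector_skew_part[of A] by (simp add: skew_vector_def cross7_simps)
  qed (simp add: part7.simps skew_part_def cross7_simps)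
  show "(\<forall>x. part7 14 A x = 0) \<longleftrightarrow> (\<exists>m. \<forall>x. A x - transpose7 A x = cross7 m x)"
  proof
    assume "\<forall>x. part7 14 A x = 0"
    then have "A x - transpose7 A x = cross7 ((1/3) *\<^sub>R skew_vector A) x" for x
      by (simp add: part7.simps skew_part_def cross7_simps vec_eq_iff field_simps)
    then show "\<exists>m. \<forall>x. A x - transpose7 A x = cross7 m x" by blast
  next
    assume "\<exists>m. \<forall>x. A x - transpose7 A x = cross7 m x"
    then obtain m where m: "\<And>x. A x - transpose7 A x = cross7 m x" by blast
    then have "(\<lambda>x. A x - transpose7 A x) = cross7 m" by (simp add: fun_eq_iff)
    \<comment> \<open>Apply \<open>skew_vector\<close> to both sides: the transpose doubles the left
      one, and m \<times> gives 6 m.\<close>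
    then have "2 *\<^sub>R skew_vector A = 6 *\<^sub>R m"
      using skew_vector_diff[of A "transpose7 A"] by (simp add: skew_vector_cross7 skew_vector_transpose7 scaleR_2)
    then have "skew_vector A = 3 *\<^sub>R m" by (simp add: vec_eq_iff)
    then show "\<forall>x. part7 14 A x = 0"
      by (simp add: part7.simps m skew_part_def cross7_simps)
  qed
  show "(\<forall>x. part7 27 A x = 0) \<longleftrightarrow> (\<forall>x. A x + transpose7 A x - (2/7 * trace7 A) *\<^sub>R x = 0)"
    by (intro iff_allI) (simp add: part7.simps vec_eq_iff field_simps)
qed

section \<open>Forms in a G2-frame\<close>

lemma wedge_map: "((\<lambda>vs. \<alpha> (map f vs)) \<and>\<^sub>f (\<lambda>vs. \<beta> (map f vs))) vs = (\<alpha> \<and>\<^sub>f \<beta>) (map f vs)"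
  by (simp add: wedge_eq_shuffle_sum shuffle_sum_map)

definition omit7 :: "7 \<Rightarrow> 7 list" where
  "omit7 i = removeAll i [1, 2, 3, 4, 5, 6, 7]"

text \<open>(-1)^(i-1), the value of the volume form on e_i followed by the frame vectors of
  \<open>omit7 i\<close>. The index 7 counts as odd although it equals 0.\<close>

definition sign7 :: "7 \<Rightarrow> real" where
  "sign7 i = (if i \<in> {1, 3, 5, 7} then 1 else -1)"

lemma omit7_simps:
  "omit7 1 = [2, 3, 4, 5, 6, 7]" "omit7 2 = [1, 3, 4, 5, 6, 7]" "omit7 3 = [1, 2, 4, 5, 6, 7]"
  "omit7 4 = [1, 2, 3, 5, 6, 7]" "omit7 5 = [1, 2, 3, 4, 6, 7]" "omit7 6 = [1, 2, 3, 4, 5, 7]"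
  "omit7 7 = [1, 2, 3, 4, 5, 6]"
  by (simp_all add: omit7_def)

lemma sign7_simps: "sign7 1 = 1" "sign7 2 = -1" "sign7 3 = 1" "sign7 4 = -1" "sign7 5 = 1"
  "sign7 6 = -1" "sign7 7 = 1"
  by (simp_all add: sign7_def)

abbreviation axes :: "7 list \<Rightarrow> (real^7) list" where
  "axes is \<equiv> map (\<lambda>i. axis i 1) is"

lemma mset_omit7:
  assumes "distinct is" "length is = 6"
  obtains i where "mset is = mset (omit7 i)"
proof -
  have "card (UNIV - set is) = 1"
    using assms by (simp add: card_Diff_subset distinct_card)
  then obtain i where "UNIV - set is = {i}" by (auto simp: card_1_singleton_iff)
  then have "set is = UNIV - {i}" by auto
  then have "set is = set (omit7 i)" by (simp only: omit7_def set_removeAll list.set UNIV_7)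
  moreover have "distinct (omit7 i)" by (auto simp: omit7_def intro!: distinct_removeAll)
  ultimately show ?thesis using that assms(1) set_eq_iff_mset_eq_distinct by blast
qed

lemma mset_distinct_7:
  assumes "distinct is" "length is = 7" shows "mset is = mset [1, 2, 3, 4, 5, 6, 7 :: 7]"
proof -
  have "card (set is) = CARD(7)" using assms by (simp add: distinct_card)
  then have "set is = UNIV" by (intro card_subset_eq) auto
  then have "set is = set [1, 2, 3, 4, 5, 6, 7]" by (simp add: UNIV_7)
  moreover have "distinct [1, 2, 3, 4, 5, 6, 7 :: 7]" by simp
  ultimately show ?thesis using assms(1) set_eq_iff_mset_eq_distinct by blast
qed

lemma fn_expression_chi_chi:
  assumes T: "linear T"
  shows "fn_expression 3 chi_form (nabla_chi T) chi_form (nabla_chi T) (axes (omit7 i))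
    = sign7 i *\<^sub>R (- 10 *\<^sub>R T (axis i 1) + 2 *\<^sub>R transpose7 T (axis i 1)
        + 6 *\<^sub>R cross7 (skew_vector T) (axis i 1))"
  using exhaust_7[of i]
  by (elim disjE; hypsubst; simp only: omit7_simps sign7_simps list.map scaleR_one scaleR_minus1_left
      fn_expression_chi_chi_coordinates[OF linear_coordinates[OF T]])

lemma star_form_wedge_skew_form:
  assumes A: "linear A"
  shows "(star_form \<and>\<^sub>f skew_form A) (axes (omit7 i)) = sign7 i * skew_vector A $ i"
  using exhaust_7[of i]
  by (elim disjE; hypsubst; simp only: omit7_simps sign7_simps list.map mult_1_left mult_minus1
      star_form_wedge_skew_form_coordinates[OF linear_coordinates[OF A]])

lemma fn_expression_cross_chi:
  assumes T: "linear T"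
  shows "shuffle_sum (\<lambda>I J. cross_2form (axis i 1) J *\<^sub>R
      fn_expression 2 cross_form (nabla_cross T) chi_form (nabla_chi T) I) (axes [1, 2, 3, 4, 5, 6, 7])
    = 3 *\<^sub>R (2 *\<^sub>R T (axis i 1) - 4 *\<^sub>R transpose7 T (axis i 1) - (2 * trace7 T) *\<^sub>R axis i 1)"
  using exhaust_7[of i]
  by (elim disjE; hypsubst; simp only: list.map fn_expression_cross_chi_coordinates[OF linear_coordinates[OF T]])

lemma length_omit7: "length (omit7 i) = 6"
  using exhaust_7[of i] by (auto simp: omit7_def)

text \<open>The interior product of a monomial with e_j, computed on its index list: the sign, 0 if
  \<open>j\<close> is absent, and the surviving indices. It replaces the unfolding of shuffles where
  up to seven vectors are involved.\<close>

fun contraction :: "7 \<Rightarrow> 7 list \<Rightarrow> real \<times> 7 list" where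
  "contraction j [] = (0, [])"
| "contraction j (i # is) = (if i = j then (1, is) else (case contraction j is of (s, l) \<Rightarrow> (- s, i # l)))"

lemma contraction_notin: "j \<notin> set is \<Longrightarrow> fst (contraction j is) = 0"
  by (induction "is") (auto split: prod.splits)

lemma wedge_of_contraction:
  assumes "distinct is" "\<And>i. \<theta> i v = (if i = j then 1 else 0)"
  shows "wedge_of \<theta> is (v # vs) = fst (contraction j is) * wedge_of \<theta> (snd (contraction j is)) vs"
  using assms(1)
proof (induction "is" arbitrary: vs)
  case Nil
  then show ?case by simp
next
  case (Cons i "is")
  have 1: "interior v (one_form (\<theta> i)) = (\<lambda>us. if us = [] then \<theta> i v else 0)"
    by (auto simp: interior_def one_form_def split: list.split)
  have 2: "(\<lambda>us. (- 1) ^ length us * one_form (\<theta> i) us) = (\<lambda>us. - one_form (\<theta> i) us)"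
    by (auto simp: one_form_def fun_eq_iff split: list.split)
  have 3: "interior v (wedge_of \<theta> is)
      = (\<lambda>vs. fst (contraction j is) * wedge_of \<theta> (snd (contraction j is)) vs)"
    using Cons by (simp add: interior_def fun_eq_iff)
  have 4: "(\<alpha> \<and>\<^sub>f (\<lambda>vs. c * \<beta> vs)) vs = c * (\<alpha> \<and>\<^sub>f \<beta>) vs" for \<alpha> \<beta> c
    using shuffle_sum_scaleR[of c "\<lambda>I J. \<alpha> I * \<beta> J" vs] by (simp add: wedge_eq_shuffle_sum mult_ac)
  have "wedge_of \<theta> (i # is) (v # vs) = \<theta> i v * wedge_of \<theta> is vs
      - fst (contraction j is) * wedge_of \<theta> (i # snd (contraction j is)) vs"
    by (simp add: wedge_Cons 1 2 3 4 wedge_const_left wedge_minus_left)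
  moreover obtain s l where "contraction j is = (s, l)" by fastforce
  \<comment> \<open>If \<open>i\<close> is \<open>j\<close>, distinctness leaves nothing to contract
    in the tail, so at most one of the two terms survives.\<close>
  ultimately show ?case
    using Cons.prems contraction_notin[of j "is"] by (auto simp: assms(2))
qed

context oriented_frame
begin

text \<open>\<open>E\<close> and \<open>C\<close> are mutually inverse isometries between standard
  R^7 and the tangent space with \<open>G\<close>; \<open>E\<close> sends the axes to the
  frame.\<close>

definition E :: "real^7 \<Rightarrow> real^7" where "E x = (\<Sum>i\<in>UNIV. x $ i *\<^sub>R e i)"

definition C :: "real^7 \<Rightarrow> real^7" where "C v = (\<chi> i. G (e i) v)"

lemma C_nth: "C v $ i = G (e i) v"
  by (simp add: C_def)

lemma linear_E: "linear E"
  by (rule linearI) (simp_all add: E_def scaleR_add_left sum.distrib scaleR_sum_right)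

lemma linear_C: "linear C"
  by (rule linearI) (simp_all add: C_def G_simps vec_eq_iff)

lemma E_C [simp]: "E (C v) = v"
  by (simp add: E_def C_def orthonormal_expand[OF on])

lemma G_e_E: "G (e i) (E x) = x $ i"
proof -
  have "G (e i) (E x) = (\<Sum>j\<in>UNIV. if i = j then x $ j else 0)"
    unfolding E_def G_simps using on by (intro sum.cong) (auto simp: orthonormal_def)
  then show ?thesis by simp
qed

lemma C_E [simp]: "C (E x) = x"
  by (simp add: C_def G_e_E vec_eq_iff)

lemma E_axis [simp]: "E (axis i 1) = e i"
proof -
  have "E (axis i 1) = (\<Sum>j\<in>UNIV. if j = i then e j else 0)"
    unfolding E_def by (rule sum.cong) (auto simp: axis_nth)
  then show ?thesis by simp
qed

lemma C_e [simp]: "C (e i) = axis i 1"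
  using C_E[of "axis i 1"] by simp

lemma G_E_E: "G (E x) (E y) = x \<bullet> y"
  by (simp add: E_def[of x] G_simps G_e_E inner_vec_def)

lemma G_eq: "G u v = C u \<bullet> C v"
  using G_E_E[of "C u" "C v"] by simp

lemma riesz: "(\<And>w. G u w = G v w) \<Longrightarrow> u = v"
  by (metis C_E E_C G_eq vector_eq_rdot)

text \<open>Raising an index with the chosen basis yields the representing vector, in which nothing
  of the choice survives.\<close>

lemma onb_riesz:
  assumes "linear f" shows "G (\<Sum>i\<in>UNIV. f (onb G i) *\<^sub>R onb G i) w = f w"
proof -
  have "f w = f (\<Sum>i\<in>UNIV. G (onb G i) w *\<^sub>R onb G i)" by (simp add: orthonormal_expand[OF onb(1)])
  then show ?thesis
    by (simp add: linear_sum[OF assms] linear_scale[OF assms] G_simps mult.commute)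
qed

lemma delta_eq:
  assumes \<Psi>: "is_form k \<Psi>" and f: "\<And>w. \<Psi> (w # vs) = C w \<bullet> x"
  shows "delta G \<Psi> vs = E x"
proof (rule riesz)
  have "linear (\<lambda>w. \<Psi> (w # vs))" using is_formD_linear[OF \<Psi>, of "[]"] by simp
  then show "G (delta G \<Psi> vs) w = G (E x) w" for w
    using onb_riesz[of "\<lambda>w. \<Psi> (w # vs)" w] by (simp add: delta_def interior_def f G_eq inner_commute)
qed

lemma vol_axes: "vol G (E x # map e (omit7 i)) = sign7 i * x $ i"
proof -
  have lin: "linear (\<lambda>w. vol G (w # vs))" for vs
    using is_formD_linear[OF is_form_vol, of "[]"] by simp
  have 0: "vol G (e j # map e (omit7 i)) = 0" if "j \<noteq> i" for j
  proof (rule is_formD_eq_0[OF is_form_vol])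
    have "j \<in> set (omit7 i)" using that exhaust_7[of j] by (auto simp: omit7_def)
    then show "\<not> distinct (e j # map e (omit7 i))" by auto
  qed
  have on': "G (e i) (e j) = (if i = j then 1 else 0)" for i j using on by (simp add: orthonormal_def)
  have 1: "vol G (e i # map e (omit7 i)) = sign7 i"
    using exhaust_7[of i]
    by (elim disjE; hypsubst; simp add: omit7_simps sign7_simps vol_eq wedge_of_contraction on' del: wedge_of.simps(2))
  have "vol G (E x # map e (omit7 i)) = (\<Sum>j\<in>UNIV. x $ j * vol G (e j # map e (omit7 i)))"
    unfolding E_def linear_sum[OF lin] linear_scale[OF lin] by simp
  also have "\<dots> = (\<Sum>j\<in>UNIV. if j = i then x $ i * sign7 i else 0)"
    by (rule sum.cong) (auto simp: 0 1)
  finally show ?thesis by simp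
qed

lemma is_form_flat: "is_form 1 (flat G v)"
  unfolding flat_def by (rule is_form_one_form[OF lin2])

lemma is_form_hodge_flat: "is_form 6 (hodge G (flat G v))"
  by (rule is_form_hodge[OF is_form_flat]) simp_all

text \<open>With this index convention \<star>v^flat = \<iota>_v vol: the only contracted index
  stands in the first slot.\<close>

lemma hodge_flat: "hodge G (flat G v) vs = vol G (v # vs)"
proof -
  note f = is_form_flat[of v]
  show ?thesis
  proof (cases "7 - length vs = 1")
    case True
    have *: "{is. length is = 1} = (\<lambda>i. [i]) ` (UNIV :: 7 set)"
      by (auto simp: length_Suc_conv One_nat_def image_iff)
    have lin: "linear (\<lambda>w. vol G (w # vs))"
      using is_formD_linear[OF is_form_vol, of "[]"] by simp
    have "hodge G (flat G v) vs = (\<Sum>i\<in>UNIV. G v (e i) * vol G (e i # vs))"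
      unfolding hodge_eq[OF f] True * by (subst sum.reindex) (auto simp: inj_on_def flat_def one_form_def)
    also have "\<dots> = vol G ((\<Sum>i\<in>UNIV. G (e i) v *\<^sub>R e i) # vs)"
      by (simp add: linear_sum[OF lin] linear_scale[OF lin] sym[of v])
    finally show ?thesis by (simp add: orthonormal_expand[OF on])
  next
    case False
    then have "length vs \<noteq> 6" by auto
    then show ?thesis by (simp add: is_formD_length[OF is_form_vol] is_formD_length[OF is_form_hodge_flat])
  qed
qed

lemma form_eq_0_if_frame:
  assumes "is_form k \<alpha>" "\<And>is. length is = k \<Longrightarrow> distinct is \<Longrightarrow> \<alpha> (map e is) = 0"
  shows "\<alpha> = (\<lambda>vs. 0)"
  using is_form_eq_0_if_basis[OF assms(1), of "\<lambda>i v. G (e i) v" e] assms(2)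
  by (auto simp: orthonormal_expand[OF on])

lemma form7_eq_0:
  assumes "is_form 7 \<alpha>" "\<alpha> (map e [1, 2, 3, 4, 5, 6, 7]) = 0" shows "\<alpha> = (\<lambda>vs. 0)"
proof (rule form_eq_0_if_frame[OF assms(1)])
  fix "is" :: "7 list" assume "length is = 7" "distinct is"
  then have "mset (map e [1, 2, 3, 4, 5, 6, 7]) = mset (map e is)"
    by (simp only: mset_map mset_distinct_7)
  then show "\<alpha> (map e is) = 0" using is_form_mset[OF assms] by blast
qed

lemma form6_eq_0:
  assumes "is_form 6 \<alpha>" "\<And>i. \<alpha> (map e (omit7 i)) = 0" shows "\<alpha> = (\<lambda>vs. 0)"
proof (rule form_eq_0_if_frame[OF assms(1)])
  fix "is" :: "7 list" assume "length is = 6" "distinct is"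
  then obtain i where "mset is = mset (omit7 i)" using mset_omit7 by blast
  then have "mset (map e (omit7 i)) = mset (map e is)" by (simp only: mset_map)
  then show "\<alpha> (map e is) = 0" using is_form_mset[OF assms(1) assms(2)] by blast
qed

text \<open>On the frame vectors of \<open>omit7 i\<close> exactly one of the forms \<star>e_j^flat
  is nonzero, so the coefficients of \<Psi> can be read off there.\<close>

lemma L_iso_eq:
  assumes \<Psi>: "\<And>i. is_form 6 (\<lambda>vs. \<Psi> vs $ i)"
  shows "L_iso G \<Psi> = (\<lambda>u. \<Sum>i\<in>UNIV. G (e i) u *\<^sub>R (sign7 i *\<^sub>R \<Psi> (map e (omit7 i))))"
  unfolding L_iso_def
proof (rule the_equality)
  let ?w = "\<lambda>i. sign7 i *\<^sub>R \<Psi> (map e (omit7 i))"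
  have s: "sign7 i * sign7 i = 1" for i by (simp add: sign7_def)
  have eq: "\<Psi> vs $ k - (\<Sum>i\<in>UNIV. hodge G (flat G (e i)) vs *\<^sub>R ?w i) $ k = 0" for vs k
  proof -
    have "(\<lambda>vs. \<Psi> vs $ k - (\<Sum>i\<in>UNIV. (?w i $ k) *\<^sub>R hodge G (flat G (e i)) vs)) = (\<lambda>vs. 0)"
    proof (rule form6_eq_0)
      show "is_form 6 (\<lambda>vs. \<Psi> vs $ k - (\<Sum>i\<in>UNIV. (?w i $ k) *\<^sub>R hodge G (flat G (e i)) vs))"
        by (intro is_form_diff is_form_sum is_form_scaleR is_form_hodge_flat \<Psi>)
      show "\<Psi> (map e (omit7 j)) $ k - (\<Sum>i\<in>UNIV. (?w i $ k) *\<^sub>R hodge G (flat G (e i)) (map e (omit7 j))) = 0" for j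
      proof -
        have "hodge G (flat G (e i)) (map e (omit7 j)) = (if i = j then sign7 j else 0)" for i
          using vol_axes[of "axis i 1" j] by (auto simp: hodge_flat axis_nth)
        then have "(\<Sum>i\<in>UNIV. (?w i $ k) *\<^sub>R hodge G (flat G (e i)) (map e (omit7 j)))
            = (\<Sum>i\<in>UNIV. if i = j then (sign7 j * sign7 j) * \<Psi> (map e (omit7 j)) $ k else 0)"
          by (intro sum.cong) auto
        then show ?thesis by (simp add: s)
      qed
    qed
    from fun_cong[OF this, of vs] show ?thesis by (simp add: mult_ac)
  qed
  have expand: "\<Psi> = (\<lambda>vs. \<Sum>i\<in>UNIV. hodge G (flat G (e i)) vs *\<^sub>R ?w i)"
  proof (rule ext, rule vec_eq_iff[THEN iffD2], rule allI)
    show "\<Psi> vs $ k = (\<Sum>i\<in>UNIV. hodge G (flat G (e i)) vs *\<^sub>R ?w i) $ k" for vs k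
      using eq[of vs k] by (simp only: right_minus_eq)
  qed
  show "\<exists>v w :: 7 \<Rightarrow> real^7. \<Psi> = (\<lambda>vs. \<Sum>i\<in>UNIV. hodge G (flat G (v i)) vs *\<^sub>R w i) \<and>
      (\<lambda>u. \<Sum>i\<in>UNIV. G (e i) u *\<^sub>R ?w i) = (\<lambda>u. \<Sum>i\<in>UNIV. G (v i) u *\<^sub>R w i)"
    by (rule exI[of _ e], rule exI[of _ ?w], rule conjI[OF expand refl])
  fix B assume "\<exists>v w :: 7 \<Rightarrow> real^7. \<Psi> = (\<lambda>vs. \<Sum>i\<in>UNIV. hodge G (flat G (v i)) vs *\<^sub>R w i) \<and> B = (\<lambda>u. \<Sum>i\<in>UNIV. G (v i) u *\<^sub>R w i)"
  then obtain v w :: "7 \<Rightarrow> real^7" where \<Psi>': "\<Psi> = (\<lambda>vs. \<Sum>i\<in>UNIV. hodge G (flat G (v i)) vs *\<^sub>R w i)"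
    and B: "B = (\<lambda>u. \<Sum>i\<in>UNIV. G (v i) u *\<^sub>R w i)" by blast
  have "hodge G (flat G u) (map e (omit7 i)) = sign7 i * G (e i) u" for u i
    using vol_axes[of "C u" i] by (simp add: hodge_flat C_nth)
  \<comment> \<open>Evaluating the competing representation gives B e_i, so \<open>B\<close> is
    determined.\<close>
  then have w: "?w i = (\<Sum>j\<in>UNIV. G (v j) (e i) *\<^sub>R w j)" for i
    by (simp add: \<Psi>' scaleR_sum_right s sym[of "e i"] flip: mult.assoc)
  show "B = (\<lambda>u. \<Sum>i\<in>UNIV. G (e i) u *\<^sub>R ?w i)"
  proof
    fix u
    have "B u = (\<Sum>j\<in>UNIV. G (v j) (\<Sum>i\<in>UNIV. G (e i) u *\<^sub>R e i) *\<^sub>R w j)"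
      by (simp add: B orthonormal_expand[OF on])
    also have "\<dots> = (\<Sum>j\<in>UNIV. \<Sum>i\<in>UNIV. G (e i) u *\<^sub>R G (v j) (e i) *\<^sub>R w j)"
      by (simp add: G_simps scaleR_sum_left)
    also have "\<dots> = (\<Sum>i\<in>UNIV. G (e i) u *\<^sub>R ?w i)"
      unfolding w scaleR_sum_right by (rule sum.swap)
    finally show "B u = (\<Sum>i\<in>UNIV. G (e i) u *\<^sub>R ?w i)" .
  qed
qed

end

section \<open>The 3-form, its Hodge dual and the cross products in a G2-frame\<close>

definition phi_form :: "(real^7) list \<Rightarrow> real" where
  "phi_form vs = (case vs of [u, v, w] \<Rightarrow> cross7 u v \<bullet> w | _ \<Rightarrow> 0)"

abbreviation "coord \<equiv> wedge_of (\<lambda>(i::7) (x::real^7). x $ i)"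

lemma is_form_coord: "is_form (length is) (coord is)"
  by (rule is_form_wedge_of) (simp add: linear_iff)

lemma coord_phi: "coord [1,2,3] vs + coord [1,4,5] vs + coord [1,6,7] vs + coord [2,4,6] vs
   - coord [2,5,7] vs - coord [3,4,7] vs - coord [3,5,6] vs = phi_form vs"
proof (cases "length vs = 3")
  case True
  then obtain u v w where vs: "vs = [u, v, w]" by (auto simp: length_Suc_conv numeral_3_eq_3)
  show ?thesis
    unfolding vs phi_form_def
    by (simp add: wedge_eq_shuffle_sum one_form_def) (simp add: cross7_def inner_vec_def sum_7 algebra_simps)
next
  case False
  then have "coord [i, j, k] vs = 0" for i j k
    using is_formD_length[OF is_form_coord[of "[i, j, k]"], of vs] by simp
  then show ?thesis
    using False by (auto simp: phi_form_def simp del: wedge_of.simps split: list.split)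
qed

lemma chi7_coord:
  "chi7 a b c $ 1 = coord [3, 4, 6] [a, b, c] + coord [2, 5, 6] [a, b, c] + coord [2, 4, 7] [a, b, c] - coord [3, 5, 7] [a, b, c]"
  "chi7 a b c $ 2 = - coord [3, 6, 7] [a, b, c] - coord [3, 4, 5] [a, b, c] - coord [1, 5, 6] [a, b, c] - coord [1, 4, 7] [a, b, c]"
  "chi7 a b c $ 3 = coord [2, 6, 7] [a, b, c] + coord [2, 4, 5] [a, b, c] + coord [1, 5, 7] [a, b, c] - coord [1, 4, 6] [a, b, c]"
  "chi7 a b c $ 4 = coord [1, 3, 6] [a, b, c] + coord [1, 2, 7] [a, b, c] - coord [5, 6, 7] [a, b, c] - coord [2, 3, 5] [a, b, c]"
  "chi7 a b c $ 5 = coord [4, 6, 7] [a, b, c] + coord [2, 3, 4] [a, b, c] + coord [1, 2, 6] [a, b, c] - coord [1, 3, 7] [a, b, c]"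
  "chi7 a b c $ 6 = - coord [4, 5, 7] [a, b, c] - coord [2, 3, 7] [a, b, c] - coord [1, 3, 4] [a, b, c] - coord [1, 2, 5] [a, b, c]"
  "chi7 a b c $ 7 = coord [4, 5, 6] [a, b, c] + coord [2, 3, 6] [a, b, c] + coord [1, 3, 5] [a, b, c] - coord [1, 2, 4] [a, b, c]"
  by (simp_all add: wedge_eq_shuffle_sum one_form_def)
    (simp_all add: chi7_def cross7_def inner_vec_def sum_7 algebra_simps)

text \<open>Expansion along the last argument, the one that \<open>star_form\<close> pairs with
  \<chi> through the inner product.\<close>

lemma coord_last: "coord [i, j, k, l] [a, b, c, d]
    = coord [i, j, k] [a, b, c] * d $ l - coord [i, j, l] [a, b, c] * d $ k
    + coord [i, k, l] [a, b, c] * d $ j - coord [j, k, l] [a, b, c] * d $ i"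
  by (simp add: wedge_eq_shuffle_sum one_form_def) (simp add: algebra_simps)

lemma star_form_coord: "star_form [a, b, c, d]
  = coord [4,5,6,7] [a, b, c, d] + coord [2,3,6,7] [a, b, c, d] + coord [2,3,4,5] [a, b, c, d]
    + coord [1,3,5,7] [a, b, c, d] - coord [1,3,4,6] [a, b, c, d] - coord [1,2,5,6] [a, b, c, d]
    - coord [1,2,4,7] [a, b, c, d]"
  unfolding star_form_def list.case inner_vec_def sum_7 chi7_coord coord_last
  by (simp add: algebra_simps del: wedge_of.simps(2))

lemma coord_axis:
  "distinct is \<Longrightarrow> coord is (axis j 1 # vs) = fst (contraction j is) * coord (snd (contraction j is)) vs"
  by (rule wedge_of_contraction) (auto simp: axis_nth)

lemma sum_phi_form:
  "(\<Sum>is | length is = 3. phi_form (axes is) * F is)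
    = (\<Sum>i\<in>UNIV. \<Sum>j\<in>UNIV. \<Sum>k\<in>UNIV. (cross7 (axis i 1) (axis j 1) $ k) * F [i, j, k])"
proof -
  have *: "{is. length is = 3} = (\<lambda>(i, j, k). [i, j, k]) ` (UNIV :: (7 \<times> 7 \<times> 7) set)"
    by (auto simp: length_Suc_conv numeral_3_eq_3 image_iff)
  show ?thesis
    unfolding * UNIV_Times_UNIV[symmetric]
    by (subst sum.reindex) (auto simp: inj_on_def phi_form_def inner_axis sum.cartesian_product split_def intro!: sum.cong)
qed

text \<open>Only the six orderings of each of the seven terms of \<phi> contribute, 42 of 343 index
  triples.\<close>

lemma sum_phi_form_expand:
  fixes F :: "7 list \<Rightarrow> real"
  shows "(\<Sum>is | length is = 3. phi_form (axes is) * F is) =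
      (F [1, 2, 3] + F [2, 3, 1] + F [3, 1, 2] - F [1, 3, 2] - F [2, 1, 3] - F [3, 2, 1])
      + (F [1, 4, 5] + F [4, 5, 1] + F [5, 1, 4] - F [1, 5, 4] - F [4, 1, 5] - F [5, 4, 1])
      + (F [1, 6, 7] + F [6, 7, 1] + F [7, 1, 6] - F [1, 7, 6] - F [6, 1, 7] - F [7, 6, 1])
      + (F [2, 4, 6] + F [4, 6, 2] + F [6, 2, 4] - F [2, 6, 4] - F [4, 2, 6] - F [6, 4, 2])
      - (F [2, 5, 7] + F [5, 7, 2] + F [7, 2, 5] - F [2, 7, 5] - F [5, 2, 7] - F [7, 5, 2])
      - (F [3, 4, 7] + F [4, 7, 3] + F [7, 3, 4] - F [3, 7, 4] - F [4, 3, 7] - F [7, 4, 3])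
      - (F [3, 5, 6] + F [5, 6, 3] + F [6, 3, 5] - F [3, 6, 5] - F [5, 3, 6] - F [6, 5, 3])"
  unfolding sum_phi_form sum_7
  by (simp only: axis_eq_vec7 cross7_vec7 vec7_nth ring_eval)

text \<open>The six orderings of a term of \<phi> contribute equally, and this 6 cancels the 3! in
  the Hodge star.\<close>

lemma sum_phi_form_star:
  "(\<Sum>is | length is = 3. phi_form (axes is) * coord [1, 2, 3, 4, 5, 6, 7] (axes is @ [a, b, c, d]))
    = 6 * star_form [a, b, c, d]"
  unfolding sum_phi_form_expand star_form_coord
  by (simp add: coord_axis del: wedge_of.simps(2))

lemma wedge_of_map: "wedge_of \<theta> is (map f vs) = wedge_of (\<lambda>i x. \<theta> i (f x)) is vs"
proof (induction "is" arbitrary: vs)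
  case (Cons i "is")
  have "wedge_of \<theta> (i # is) (map f vs)
      = ((\<lambda>vs. one_form (\<theta> i) (map f vs)) \<and>\<^sub>f (\<lambda>vs. wedge_of \<theta> is (map f vs))) vs"
    by (simp add: wedge_map)
  also have "(\<lambda>vs. one_form (\<theta> i) (map f vs)) = one_form (\<lambda>x. \<theta> i (f x))"
    by (auto simp: one_form_def fun_eq_iff split: list.split)
  finally show ?case by (simp add: Cons.IH)
qed simp

lemma shuffle_sum_linear_image:
  assumes "linear L" shows "L (shuffle_sum H vs) = shuffle_sum (\<lambda>I J. L (H I J)) vs"
  by (induction vs arbitrary: H) (simp_all add: linear_add[OF assms] linear_scale[OF assms])

lemma wedge_sum_scale_right:
  "(\<alpha> \<and>\<^sub>f (\<lambda>vs. \<Sum>i\<in>X. c i * \<beta> i vs)) vs = (\<Sum>i\<in>X. c i * (\<alpha> \<and>\<^sub>f \<beta> i) vs)"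
proof -
  have "(\<lambda>I J. \<alpha> I * (\<Sum>i\<in>X. c i * \<beta> i J)) = (\<lambda>I J. \<Sum>i\<in>X. c i *\<^sub>R (\<alpha> I * \<beta> i J))"
    by (simp add: sum_distrib_left mult_ac)
  then show ?thesis
    by (simp add: wedge_eq_shuffle_sum shuffle_sum_sum shuffle_sum_scaleR del: real_scaleR_def)
      (simp only: real_scaleR_def)
qed

lemma wedge_diff_left: "((\<lambda>vs. \<alpha> vs - \<beta> vs) \<and>\<^sub>f \<gamma>) vs = (\<alpha> \<and>\<^sub>f \<gamma>) vs - (\<beta> \<and>\<^sub>f \<gamma>) vs"
  using shuffle_sum_diff[of "\<lambda>I J. \<alpha> I * \<gamma> J" "\<lambda>I J. \<beta> I * \<gamma> J"]
  by (simp add: wedge_eq_shuffle_sum left_diff_distrib)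

abbreviation basis7 :: "7 list" where "basis7 \<equiv> [1, 2, 3, 4, 5, 6, 7]"

locale g2_frame = oriented_frame +
  fixes \<phi> :: "(real^7) list \<Rightarrow> real"
  assumes frame: "G2_frame \<phi> e"
begin

lemma dual_basis_eq: "dual_basis e i v = G (e i) v"
proof -
  have inj: "inj e"
  proof (rule injI)
    fix i j assume "e i = e j"
    then show "i = j" using on unfolding orthonormal_def by (metis zero_neq_one)
  qed
  have ind: "independent (range e)"
  proof (rule independent_if_scalars_zero)
    fix f x assume "(\<Sum>x\<in>range e. f x *\<^sub>R x) = 0" and "x \<in> range e"
    then obtain i where "x = e i" and "(\<Sum>j\<in>UNIV. f (e j) *\<^sub>R e j) = 0"
      using inj by (auto simp: sum.reindex)
    then have "C (\<Sum>j\<in>UNIV. f (e j) *\<^sub>R e j) $ i = 0" by (simp add: linear_0[OF linear_C])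
    then have "(\<Sum>j\<in>UNIV. f (e j) * (if i = j then 1 else 0)) = 0"
      using on by (simp add: C_nth G_simps orthonormal_def)
    then show "f x = 0" using \<open>x = e i\<close> by (simp add: if_distrib cong: if_cong)
  qed simp
  have sp: "e j \<in> span (range e)" for j by (simp add: span_base)
  have "representation (range e) v (e i)
      = representation (range e) (\<Sum>j\<in>UNIV. G (e j) v *\<^sub>R e j) (e i)"
    by (simp add: orthonormal_expand[OF on])
  also have "\<dots> = (\<Sum>j\<in>UNIV. G (e j) v * representation (range e) (e j) (e i))"
    by (subst representation_sum[OF ind]) (auto simp: representation_scale[OF ind sp] intro: span_scale sp)
  also have "\<dots> = (\<Sum>j\<in>UNIV. if j = i then G (e i) v else 0)"
    by (rule sum.cong) (auto simp: representation_basis[OF ind] inj_eq[OF inj])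
  finally show ?thesis by (simp add: dual_basis_def)
qed

lemma phi_eq: "\<phi> vs = phi_form (map C vs)"
proof -
  have "dual_basis e = (\<lambda>i x. C x $ i)" by (simp add: fun_eq_iff dual_basis_eq C_nth)
  then have w: "wedge_of (dual_basis e) is vs = coord is (map C vs)" for "is"
    by (simp add: wedge_of_map)
  show ?thesis
    using fun_cong[OF conjunct2[OF frame[unfolded G2_frame_def Let_def]], of vs] by (simp only: w coord_phi)
qed

lemma is_form_phi: "is_form 3 \<phi>"
proof -
  have "is_form 3 (wedge_of (dual_basis e) [i, j, k])" for i j k
    using is_form_wedge_of[of "dual_basis e" "[i, j, k]"] by (simp add: dual_basis_eq[abs_def] lin2 eval_nat_numeral)
  then show ?thesis
    using frame unfolding G2_frame_def Let_def by (auto intro!: is_form_add is_form_diff)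
qed

lemma is_form_hodge_phi: "is_form 4 (hodge G \<phi>)"
  by (rule is_form_hodge[OF is_form_phi]) simp_all

lemma hodge_phi: "hodge G \<phi> vs = star_form (map C vs)"
proof (cases "length vs = 4")
  case True
  then have "length (map C vs) = 4" by simp
  then obtain a b c d where abcd: "map C vs = [a, b, c, d]"
    by (auto simp: length_Suc_conv eval_nat_numeral)
  have "map C (map e is @ vs) = axes is @ [a, b, c, d]" for "is" using abcd by simp
  moreover have "vol G ws = coord basis7 (map C ws)" for ws
    unfolding vol_eq wedge_of_map C_nth ..
  ultimately have v: "vol G (map e is @ vs) = coord basis7 (axes is @ [a, b, c, d])" for "is"
    by metis
  have p: "\<phi> (map e is) = phi_form (axes is)" for "is"
    by (simp add: phi_eq o_def)
  show ?thesis
    using True sum_phi_form_star[of a b c d] by (simp add: hodge_eq[OF is_form_phi] v p abcd eval_nat_numeral)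
next
  case False
  then have "star_form (map C vs) = 0" by (auto simp: star_form_def split: list.split)
  then show ?thesis using False is_formD_length[OF is_form_hodge_phi] by simp
qed

lemma delta_phi: "delta G \<phi> vs = E (cross_form (map C vs))"
proof (rule delta_eq[OF is_form_phi])
  show "\<phi> (w # vs) = C w \<bullet> cross_form (map C vs)" for w
    by (auto simp: phi_eq phi_form_def cross_form_def inner_cross7_cyclic[of "C w"] inner_commute[of "C w"]
        split: list.split)
qed

text \<open>Cycling four arguments is an odd permutation, which accounts for the sign in \<chi> = -
  \<delta>_g(\<star>\<phi>). Alternation is inherited from the Hodge star.\<close>

lemma star_form_cyclic: "star_form [d, a, b, c] = - (chi7 a b c \<bullet> d)"
proof -
  have "hodge G \<phi> (map E [d, a, b, c]) = - hodge G \<phi> (map E [a, b, c, d])"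
    using is_form_swap[OF is_form_hodge_phi, of "[]" "E d" "E a" "[E b, E c]"]
      is_form_swap[OF is_form_hodge_phi, of "[E a]" "E d" "E b" "[E c]"]
      is_form_swap[OF is_form_hodge_phi, of "[E a, E b]" "E d" "E c" "[]"] by simp
  then show ?thesis by (simp add: hodge_phi) (simp add: star_form_def)
qed

lemma delta_hodge_phi: "- delta G (hodge G \<phi>) vs = E (chi_form (map C vs))"
proof -
  have "delta G (hodge G \<phi>) vs = E (- chi_form (map C vs))"
  proof (rule delta_eq[OF is_form_hodge_phi])
    show "hodge G \<phi> (w # vs) = C w \<bullet> - chi_form (map C vs)" for w
    proof (cases "length vs = 3")
      case True
      then obtain a b c where vs: "vs = [a, b, c]" by (auto simp: length_Suc_conv eval_nat_numeral)
      then show ?thesis by (simp add: hodge_phi star_form_cyclic chi_form_def inner_commute)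
    next
      case False
      then have "chi_form (map C vs) = 0" by (auto simp: chi_form_def split: list.split)
      then show ?thesis using False is_formD_length[OF is_form_hodge_phi, of "w # vs"] by simp
    qed
  qed
  then show ?thesis by (simp add: linear_neg[OF linear_E])
qed

lemma interior_phi: "interior (E x) \<phi> vs = cross_2form x (map C vs)"
  by (auto simp: interior_def phi_eq phi_form_def cross_2form_def inner_cross7_cyclic[of x] split: list.split)

text \<open>Seven functionals that detect the \<Lambda>^5_7 part: on 5-forms their common kernel is
  \<Lambda>^5_14, and on \<star>\<phi> \<and> v^flat they take the values 3 v_k.\<close>

definition weight :: "((real^7) list \<Rightarrow> real) \<Rightarrow> 7 \<Rightarrow> real" where
  "weight \<alpha> k = (\<alpha> \<and>\<^sub>f interior (e k) \<phi>) (map e basis7)"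

lemma map_e: "map e is = map E (axes is)"
  by simp

lemma weight_eq:
  "weight \<alpha> k = shuffle_sum (\<lambda>I J. cross_2form (axis k 1) J *\<^sub>R \<alpha> (map E I)) (axes basis7)"
proof -
  have "interior (e k) \<phi> (map E J) = cross_2form (axis k 1) J" for J
    using interior_phi[of "axis k 1" "map E J"] by (simp add: o_def)
  then show ?thesis
    unfolding weight_def map_e by (simp only: wedge_eq_shuffle_sum shuffle_sum_map) (simp add: mult.commute)
qed

lemma weight_diff: "weight (\<lambda>vs. \<alpha> vs - \<beta> vs) k = weight \<alpha> k - weight \<beta> k"
  by (simp add: weight_def wedge_diff_left)

lemma weight_hodge_flat: "weight (hodge G \<phi> \<and>\<^sub>f flat G v) k = 3 * C v $ k"
proof -
  have "(hodge G \<phi> \<and>\<^sub>f flat G v) (map E I) = (star_form \<and>\<^sub>f one_form (\<lambda>w. C v \<bullet> w)) I" for I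
  proof -
    have "(\<lambda>vs. flat G v (map E vs)) = one_form (\<lambda>w. C v \<bullet> w)"
      by (auto simp: flat_def one_form_def G_eq fun_eq_iff split: list.split)
    moreover have "(\<lambda>vs. hodge G \<phi> (map E vs)) = star_form"
      by (simp add: hodge_phi o_def fun_eq_iff)
    ultimately show ?thesis
      using wedge_map[of "hodge G \<phi>" E "flat G v" I] by simp
  qed
  then show ?thesis
    unfolding weight_eq list.map by (simp only: star_form_wedge_one_form)
qed

lemma is_form_hodge_wedge_flat: "is_form 5 (hodge G \<phi> \<and>\<^sub>f flat G v)"
  using is_form_wedge[OF is_form_hodge_phi is_form_flat, of v] by simp

text \<open>A 7-form is determined by its value on the frame, and \<iota>_v \<phi> is linear in
  v.\<close>

lemma Lambda5_14_iff:
  assumes \<alpha>: "is_form 5 \<alpha>" shows "\<alpha> \<in> Lambda5_14 \<phi> \<longleftrightarrow> (\<forall>k. weight \<alpha> k = 0)"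
proof
  assume "\<alpha> \<in> Lambda5_14 \<phi>"
  then show "\<forall>k. weight \<alpha> k = 0" by (simp add: Lambda5_14_def weight_def)
next
  assume 0: "\<forall>k. weight \<alpha> k = 0"
  have "\<alpha> \<and>\<^sub>f interior v \<phi> = (\<lambda>vs. 0)" for v
  proof (rule form7_eq_0)
    have "is_form 2 (interior v \<phi>)" using is_form_interior[of 2 \<phi> v] is_form_phi by (simp add: numeral_3_eq_3 numeral_2_eq_2)
    then show "is_form 7 (\<alpha> \<and>\<^sub>f interior v \<phi>)" using is_form_wedge[OF \<alpha>] by fastforce
    have lin: "linear (\<lambda>w. \<phi> (w # vs))" for vs using is_formD_linear[OF is_form_phi, of "[]"] by simp
    have "interior v \<phi> vs = (\<Sum>k\<in>UNIV. G (e k) v * interior (e k) \<phi> vs)" for vs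
    proof -
      have "\<phi> (v # vs) = \<phi> ((\<Sum>k\<in>UNIV. G (e k) v *\<^sub>R e k) # vs)" by (simp add: orthonormal_expand[OF on])
      then show ?thesis by (simp add: interior_def linear_sum[OF lin] linear_scale[OF lin])
    qed
    then have "interior v \<phi> = (\<lambda>vs. \<Sum>k\<in>UNIV. G (e k) v * interior (e k) \<phi> vs)" by blast
    then show "(\<alpha> \<and>\<^sub>f interior v \<phi>) (map e basis7) = 0"
      using 0 by (simp only: wedge_sum_scale_right weight_def[symmetric] mult_zero_right sum.neutral_const)
  qed
  then show "\<alpha> \<in> Lambda5_14 \<phi>" using \<alpha> by (simp add: Lambda5_14_def)
qed

text \<open>\<open>W k\<close> collects the weights of the components of \<Psi>. The candidate
  \<Theta> has the same weights, so \<Psi> - \<Theta> lies in \<Lambda>^5_14. It is unique because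
  the weights of \<star>\<phi> \<and> v^flat recover v.\<close>

lemma K_iso_eq:
  assumes \<Psi>: "\<And>i. is_form 5 (\<lambda>vs. \<Psi> vs $ i)"
  defines "W k \<equiv> shuffle_sum (\<lambda>I J. cross_2form (axis k 1) J *\<^sub>R \<Psi> (map E I)) (axes basis7)"
  shows "K_iso G \<phi> (pi7 G \<phi> \<Psi>) = (\<lambda>u. \<Sum>k\<in>UNIV. G (e k) u *\<^sub>R ((1/3) *\<^sub>R W k))"
proof -
  define w where "w k = (1/3) *\<^sub>R W k" for k
  define \<Theta> where "\<Theta> vs = (\<Sum>k\<in>UNIV. (hodge G \<phi> \<and>\<^sub>f flat G (e k)) vs *\<^sub>R w k)" for vs
  have W: "W k $ i = weight (\<lambda>vs. \<Psi> vs $ i) k" for k i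
  proof -
    have "linear (\<lambda>x :: real^7. x $ i)" by (simp add: linear_iff)
    from shuffle_sum_linear_image[OF this] show ?thesis unfolding W_def weight_eq by simp
  qed
  have flat: "(hodge G \<phi> \<and>\<^sub>f flat G (\<Sum>k\<in>UNIV. c k *\<^sub>R e k)) vs
      = (\<Sum>k\<in>UNIV. c k * (hodge G \<phi> \<and>\<^sub>f flat G (e k)) vs)" for c :: "7 \<Rightarrow> real" and vs
  proof -
    have "flat G (\<Sum>k\<in>UNIV. c k *\<^sub>R e k) = (\<lambda>vs. \<Sum>k\<in>UNIV. c k * flat G (e k) vs)"
      by (auto simp: flat_def one_form_def G_simps fun_eq_iff split: list.split)
    then show ?thesis by (simp add: wedge_sum_scale_right)
  qed
  have \<Theta>i: "(\<lambda>vs. \<Theta> vs $ i) = hodge G \<phi> \<and>\<^sub>f flat G (\<Sum>k\<in>UNIV. (w k $ i) *\<^sub>R e k)" for i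
    by (simp add: fun_eq_iff flat \<Theta>_def mult.commute)
  have CS: "C (\<Sum>k\<in>UNIV. c k *\<^sub>R e k) $ j = c j" for c :: "7 \<Rightarrow> real" and j
    using C_E[of "\<chi> k. c k"] by (simp add: E_def)
  have \<Theta>7: "\<Theta> \<in> tensor_TM (Lambda5_7 G \<phi>)"
    unfolding tensor_TM_def Lambda5_7_def using \<Theta>i by blast
  have \<Theta>14: "(\<lambda>vs. \<Psi> vs - \<Theta> vs) \<in> tensor_TM (Lambda5_14 \<phi>)"
  proof -
    have "(\<lambda>vs. \<Psi> vs $ i - \<Theta> vs $ i) \<in> Lambda5_14 \<phi>" for i
    proof -
      have f: "is_form 5 (\<lambda>vs. \<Psi> vs $ i - \<Theta> vs $ i)"
        by (rule is_form_diff[OF \<Psi>]) (simp only: \<Theta>i is_form_hodge_wedge_flat)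
      have "weight (\<lambda>vs. \<Psi> vs $ i - \<Theta> vs $ i) k = 0" for k
        unfolding weight_diff \<Theta>i weight_hodge_flat CS W[symmetric] by (simp add: w_def)
      then show ?thesis using Lambda5_14_iff[OF f] by blast
    qed
    then show ?thesis by (simp add: tensor_TM_def)
  qed
  have unique: "\<Theta>' = \<Theta>"
    if 7: "\<Theta>' \<in> tensor_TM (Lambda5_7 G \<phi>)" and 14: "(\<lambda>vs. \<Psi> vs - \<Theta>' vs) \<in> tensor_TM (Lambda5_14 \<phi>)" for \<Theta>'
  proof -
    have "(\<lambda>vs. \<Theta>' vs $ i) = (\<lambda>vs. \<Theta> vs $ i)" for i
    proof -
      obtain v where v: "(\<lambda>vs. \<Theta>' vs $ i) = hodge G \<phi> \<and>\<^sub>f flat G v"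
        using 7 by (auto simp: tensor_TM_def Lambda5_7_def)
      have "(\<lambda>vs. \<Psi> vs $ i - \<Theta>' vs $ i) \<in> Lambda5_14 \<phi>" using 14 by (simp add: tensor_TM_def)
      moreover have "is_form 5 (\<lambda>vs. \<Psi> vs $ i - \<Theta>' vs $ i)"
        by (rule is_form_diff[OF \<Psi>]) (simp only: v is_form_hodge_wedge_flat)
      ultimately have "weight (\<lambda>vs. \<Psi> vs $ i - \<Theta>' vs $ i) k = 0" for k
        using Lambda5_14_iff by blast
      then have "C v $ k = w k $ i" for k
        unfolding weight_diff v weight_hodge_flat by (simp add: w_def W)
      then have "C v = C (\<Sum>k\<in>UNIV. (w k $ i) *\<^sub>R e k)" by (simp add: vec_eq_iff CS)
      then have "v = (\<Sum>k\<in>UNIV. (w k $ i) *\<^sub>R e k)" by (metis E_C)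
      then show ?thesis by (simp add: v \<Theta>i)
    qed
    then show ?thesis by (simp add: fun_eq_iff vec_eq_iff)
  qed
  have pi7: "pi7 G \<phi> \<Psi> = \<Theta>"
    unfolding pi7_def by (rule the_equality, rule conjI[OF \<Theta>7 \<Theta>14]) (erule conjE, rule unique)
  show ?thesis
    unfolding pi7 K_iso_def w_def[symmetric]
  proof (rule the_equality)
    show "\<exists>v w' :: 7 \<Rightarrow> real^7. \<Theta> = (\<lambda>vs. \<Sum>i\<in>UNIV. (hodge G \<phi> \<and>\<^sub>f flat G (v i)) vs *\<^sub>R w' i) \<and>
        (\<lambda>u. \<Sum>k\<in>UNIV. G (e k) u *\<^sub>R w k) = (\<lambda>u. \<Sum>i\<in>UNIV. G (v i) u *\<^sub>R w' i)"
      by (rule exI[of _ e], rule exI[of _ w]) (simp add: \<Theta>_def fun_eq_iff)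
  next
    fix B assume "\<exists>v w' :: 7 \<Rightarrow> real^7. \<Theta> = (\<lambda>vs. \<Sum>i\<in>UNIV. (hodge G \<phi> \<and>\<^sub>f flat G (v i)) vs *\<^sub>R w' i) \<and>
        B = (\<lambda>u. \<Sum>i\<in>UNIV. G (v i) u *\<^sub>R w' i)"
    then obtain v w' :: "7 \<Rightarrow> real^7"
      where \<Theta>': "\<Theta> = (\<lambda>vs. \<Sum>i\<in>UNIV. (hodge G \<phi> \<and>\<^sub>f flat G (v i)) vs *\<^sub>R w' i)"
        and B: "B = (\<lambda>u. \<Sum>i\<in>UNIV. G (v i) u *\<^sub>R w' i)" by blast
    \<comment> \<open>Another representation of \<Theta> has the same weights, and these fix its
      value at e_k.\<close>
    have wk: "w k = (\<Sum>j\<in>UNIV. G (v j) (e k) *\<^sub>R w' j)" for k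
    proof (rule vec_eq_iff[THEN iffD2], rule allI)
      fix i
      have fl: "flat G (\<Sum>j\<in>UNIV. (w' j $ i) *\<^sub>R v j) = (\<lambda>vs. \<Sum>j\<in>UNIV. (w' j $ i) * flat G (v j) vs)"
        by (auto simp: flat_def one_form_def G_simps fun_eq_iff split: list.split)
      have "(\<lambda>vs. \<Theta> vs $ i) = hodge G \<phi> \<and>\<^sub>f flat G (\<Sum>j\<in>UNIV. (w' j $ i) *\<^sub>R v j)"
        by (rule ext) (simp add: \<Theta>' fl wedge_sum_scale_right mult.commute)
      then have "weight (hodge G \<phi> \<and>\<^sub>f flat G (\<Sum>j\<in>UNIV. (w' j $ i) *\<^sub>R v j)) k
          = weight (hodge G \<phi> \<and>\<^sub>f flat G (\<Sum>k\<in>UNIV. (w k $ i) *\<^sub>R e k)) k" by (simp add: \<Theta>i)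
      then show "w k $ i = (\<Sum>j\<in>UNIV. G (v j) (e k) *\<^sub>R w' j) $ i"
        unfolding weight_hodge_flat CS by (simp add: C_nth G_simps sym[of "e k"] mult.commute)
    qed
    show "B = (\<lambda>u. \<Sum>k\<in>UNIV. G (e k) u *\<^sub>R w k)"
    proof
      fix u
      have "B u = (\<Sum>j\<in>UNIV. G (v j) (\<Sum>i\<in>UNIV. G (e i) u *\<^sub>R e i) *\<^sub>R w' j)"
        by (simp add: B orthonormal_expand[OF on])
      also have "\<dots> = (\<Sum>j\<in>UNIV. \<Sum>i\<in>UNIV. G (e i) u *\<^sub>R G (v j) (e i) *\<^sub>R w' j)"
        by (simp add: G_simps scaleR_sum_left)
      also have "\<dots> = (\<Sum>i\<in>UNIV. G (e i) u *\<^sub>R w i)"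
        unfolding wk scaleR_sum_right by (rule sum.swap)
      finally show "B u = (\<Sum>k\<in>UNIV. G (e k) u *\<^sub>R w k)" .
    qed
  qed
qed

end

section \<open>Endomorphisms in a G2-frame\<close>

context oriented_frame
begin

text \<open>Conjugation by the frame isometry, which carries endomorphisms of the tangent space to
  standard R^7; \<open>push\<close> is the way back.\<close>

definition pull :: "(real^7 \<Rightarrow> real^7) \<Rightarrow> real^7 \<Rightarrow> real^7" where
  "pull B x = C (B (E x))"

definition push :: "(real^7 \<Rightarrow> real^7) \<Rightarrow> real^7 \<Rightarrow> real^7" where
  "push A v = E (A (C v))"

lemma push_pull [simp]: "push (pull B) = B" and pull_push [simp]: "pull (push A) = A"
  by (simp_all add: push_def pull_def fun_eq_iff)

lemma linear_pull: "linear B \<Longrightarrow> linear (pull B)"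
  using linear_compose[OF linear_compose[OF linear_E] linear_C] by (simp add: o_def pull_def[abs_def])

lemma linear_push: "linear A \<Longrightarrow> linear (push A)"
  using linear_compose[OF linear_compose[OF linear_C] linear_E] by (simp add: o_def push_def[abs_def])

lemma linear_pull_iff: "linear (pull B) \<longleftrightarrow> linear B"
  using linear_pull linear_push[of "pull B"] by auto

lemma G_onb_sum: "(\<Sum>i\<in>UNIV. G u (onb G i) * G (onb G i) v) = G u v"
proof -
  have "G u v = G u (\<Sum>i\<in>UNIV. G (onb G i) v *\<^sub>R onb G i)"
    by (simp add: orthonormal_expand[OF onb(1)])
  then show ?thesis by (simp add: G_simps mult.commute)
qed

text \<open>\<open>endo_transpose\<close> is built from the chosen basis, but it is the adjoint with
  respect to \<open>G\<close>, and adjointness characterises the transpose on R^7.\<close>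

lemma pull_endo_transpose:
  assumes B: "linear B" shows "pull (endo_transpose G B) = transpose7 (pull B)"
proof (rule transpose7_unique[OF linear_pull[OF B]])
  fix x y
  have inner: "(\<Sum>j\<in>UNIV. G (B (onb G j)) z * G (onb G j) w) = G (B w) z" for z w
  proof -
    have "G (B w) z = G (B (\<Sum>j\<in>UNIV. G (onb G j) w *\<^sub>R onb G j)) z"
      by (simp add: orthonormal_expand[OF onb(1)])
    then show ?thesis by (simp add: linear_sum[OF B] linear_scale[OF B] G_simps mult.commute)
  qed
  have "G (endo_transpose G B u) w = G u (B w)" for u w
  proof -
    have "G (endo_transpose G B u) w
        = (\<Sum>i\<in>UNIV. G (onb G i) u * (\<Sum>j\<in>UNIV. G (B (onb G j)) (onb G i) * G (onb G j) w))"
      by (simp add: endo_transpose_def coeff_def G_simps sum_distrib_left mult_ac)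
    also have "\<dots> = (\<Sum>i\<in>UNIV. G (B w) (onb G i) * G (onb G i) u)"
      unfolding inner by (simp add: mult.commute)
    also have "\<dots> = G u (B w)" unfolding G_onb_sum by (rule sym)
    finally show ?thesis .
  qed
  from this[of "E x" "E y"] show "pull (endo_transpose G B) x \<bullet> y = x \<bullet> pull B y"
    by (simp add: G_eq pull_def)
qed

lemma endo_transpose_eq: "linear B \<Longrightarrow> endo_transpose G B = push (transpose7 (pull B))"
  by (metis push_pull pull_endo_transpose)

text \<open>The trace is defined in the coordinate basis. It and the trace in the frame arise from
  one double sum over axes and frame vectors, summed in either order.\<close>

lemma endo_trace_eq:
  assumes B: "linear B" shows "endo_trace B = trace7 (pull B)"
proof -
  have "trace7 (pull B) = (\<Sum>i\<in>UNIV. G (e i) (B (e i)))"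
    by (simp add: trace7_def pull_def C_nth)
  also have "\<dots> = (\<Sum>i\<in>UNIV. \<Sum>k\<in>UNIV. G (e i) (axis k 1) * B (e i) $ k)"
  proof (rule sum.cong[OF refl])
    fix i
    have "G (e i) (B (e i)) = G (e i) (\<Sum>k\<in>UNIV. (B (e i) $ k) *\<^sub>R axis k 1)"
      by (rule arg_cong[OF linear_expand[OF linear_ident]])
    then show "G (e i) (B (e i)) = (\<Sum>k\<in>UNIV. G (e i) (axis k 1) * B (e i) $ k)"
      by (simp add: G_simps mult.commute)
  qed
  also have "\<dots> = (\<Sum>k\<in>UNIV. \<Sum>i\<in>UNIV. G (e i) (axis k 1) * B (e i) $ k)" by (rule sum.swap)
  also have "\<dots> = (\<Sum>k\<in>UNIV. B (\<Sum>i\<in>UNIV. G (e i) (axis k 1) *\<^sub>R e i) $ k)"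
    by (simp add: linear_sum[OF B] linear_scale[OF B])
  also have "\<dots> = endo_trace B"
    by (simp add: orthonormal_expand[OF on] endo_trace_def trace_def matrix_def)
  finally show ?thesis by simp
qed

lemma sigma_form_eq:
  assumes B: "linear B" shows "sigma_form G B vs = skew_form (pull B) (map C vs)"
proof (cases "length vs = 2")
  case True
  then obtain u v where vs: "vs = [u, v]" by (auto simp: length_Suc_conv numeral_2_eq_2)
  have w: "wedge_of (\<lambda>i. G (onb G i)) [i, j] vs = G (onb G i) u * G (onb G j) v - G (onb G i) v * G (onb G j) u" for i j
    by (simp add: vs wedge_eq_shuffle_sum one_form_def)
  have 1: "(\<Sum>i\<in>UNIV. \<Sum>j\<in>UNIV. G (B (onb G i)) (onb G j) * (G (onb G i) u * G (onb G j) v)) = G (B u) v" for u v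
  proof -
    have "G (B u) v = G (B (\<Sum>i\<in>UNIV. G (onb G i) u *\<^sub>R onb G i)) v"
      by (simp add: orthonormal_expand[OF onb(1)])
    also have "\<dots> = (\<Sum>i\<in>UNIV. G (onb G i) u * (\<Sum>j\<in>UNIV. G (B (onb G i)) (onb G j) * G (onb G j) v))"
      by (simp add: linear_sum[OF B] linear_scale[OF B] G_simps G_onb_sum)
    finally show ?thesis by (simp add: sum_distrib_left mult_ac)
  qed
  have "sigma_form G B vs = G (B u) v - G (B v) u"
    unfolding sigma_form_def coeff_def w right_diff_distrib sum_subtractf 1 by simp
  then show ?thesis by (simp add: vs skew_form_def pull_def G_eq)
next
  case False
  then have "wedge_of (\<lambda>i. G (onb G i)) [i, j] vs = 0" for i j
    using is_formD_length[OF is_form_wedge_of[of "\<lambda>i. G (onb G i)" "[i, j]"], of vs] by (simp add: lin2)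
  moreover have "skew_form (pull B) (map C vs) = 0"
    using False by (auto simp: skew_form_def split: list.split)
  ultimately show ?thesis by (simp add: sigma_form_def del: wedge_of.simps)
qed

lemma is_form_sigma_form: "is_form 2 (sigma_form G B)"
proof -
  have "is_form 2 (wedge_of (\<lambda>i. G (onb G i)) [i, j])" for i j
    using is_form_wedge_of[of "\<lambda>i. G (onb G i)" "[i, j]"] by (simp add: lin2 numeral_2_eq_2)
  then have "is_form 2 (\<lambda>vs. \<Sum>i\<in>UNIV. \<Sum>j\<in>UNIV. coeff G B i j *\<^sub>R wedge_of (\<lambda>i. G (onb G i)) [i, j] vs)"
    by (intro is_form_sum is_form_scaleR)
  then show ?thesis by (simp add: sigma_form_def[abs_def])
qed

end

context g2_frame
begin

lemma sigma_form_Lambda2_7: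
  assumes B: "linear B"
  shows "sigma_form G B \<in> Lambda2_7 \<phi> \<longleftrightarrow> (\<exists>m. \<forall>x. pull B x - transpose7 (pull B) x = cross7 m x)"
proof -
  have s: "skew_form (pull B) [x, y] = (pull B x - transpose7 (pull B) x) \<bullet> y" for x y
    using inner_transpose7[OF linear_pull[OF B], of x y]
    by (simp add: skew_form_def inner_diff_left inner_commute[of x "pull B y"])
  have "sigma_form G B = interior (E m) \<phi> \<longleftrightarrow> (\<forall>x. pull B x - transpose7 (pull B) x = cross7 m x)" for m
  proof
    assume eq: "sigma_form G B = interior (E m) \<phi>"
    show "\<forall>x. pull B x - transpose7 (pull B) x = cross7 m x"
    proof
      fix x
      have "(pull B x - transpose7 (pull B) x) \<bullet> y = cross7 m x \<bullet> y" for y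
        using fun_cong[OF eq, of "[E x, E y]"]
        by (simp add: sigma_form_eq[OF B] s interior_phi cross_2form_def inner_cross7_cyclic[of m])
      then show "pull B x - transpose7 (pull B) x = cross7 m x"
        using vector_eq_rdot by blast
    qed
  next
    assume eq: "\<forall>x. pull B x - transpose7 (pull B) x = cross7 m x"
    have "skew_form (pull B) ws = cross_2form m ws" for ws
    proof (cases "length ws = 2")
      case True
      then obtain x y where ws: "ws = [x, y]" by (auto simp: length_Suc_conv numeral_2_eq_2)
      show ?thesis
        unfolding ws s by (simp only: eq) (simp add: cross_2form_def inner_cross7_cyclic[of m])
    next
      case False
      then show ?thesis by (auto simp: skew_form_def cross_2form_def split: list.split)
    qed
    then show "sigma_form G B = interior (E m) \<phi>"
      by (simp add: fun_eq_iff sigma_form_eq[OF B] interior_phi)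
  qed
  then show ?thesis
    unfolding Lambda2_7_def mem_Collect_eq by (metis E_C)
qed

lemma sigma_form_Lambda2_14:
  assumes B: "linear B"
  shows "sigma_form G B \<in> Lambda2_14 G \<phi> \<longleftrightarrow> skew_vector (pull B) = 0"
proof -
  have f: "is_form 6 (hodge G \<phi> \<and>\<^sub>f sigma_form G B)"
    using is_form_wedge[OF is_form_hodge_phi is_form_sigma_form, of B] by simp
  have v: "(hodge G \<phi> \<and>\<^sub>f sigma_form G B) (map e (omit7 i)) = sign7 i * skew_vector (pull B) $ i" for i
  proof -
    have "(\<lambda>vs. hodge G \<phi> (map E vs)) = star_form" "(\<lambda>vs. sigma_form G B (map E vs)) = skew_form (pull B)"
      by (simp_all add: fun_eq_iff hodge_phi sigma_form_eq[OF B] o_def)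
    then show ?thesis
      using wedge_map[of "hodge G \<phi>" E "sigma_form G B" "axes (omit7 i)"]
        star_form_wedge_skew_form[OF linear_pull[OF B], of i] by (simp add: o_def)
  qed
  have "hodge G \<phi> \<and>\<^sub>f sigma_form G B = (\<lambda>vs. 0) \<longleftrightarrow> (\<forall>i. skew_vector (pull B) $ i = 0)"
  proof
    assume "hodge G \<phi> \<and>\<^sub>f sigma_form G B = (\<lambda>vs. 0)"
    then have "sign7 i * skew_vector (pull B) $ i = 0" for i using v[of i] by simp
    moreover have "sign7 i \<noteq> 0" for i by (simp add: sign7_def)
    ultimately show "\<forall>i. skew_vector (pull B) $ i = 0" by simp
  next
    assume "\<forall>i. skew_vector (pull B) $ i = 0"
    then show "hodge G \<phi> \<and>\<^sub>f sigma_form G B = (\<lambda>vs. 0)"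
      by (intro form6_eq_0[OF f]) (simp add: v)
  qed
  then show ?thesis by (simp add: Lambda2_14_def is_form_sigma_form vec_eq_iff)
qed

lemma V_part_iff:
  assumes k: "k \<in> {1, 7, 14, 27}"
  shows "B \<in> V_part G \<phi> k \<longleftrightarrow> pull B \<in> summand7 k"
proof -
  have neg: "pull (\<lambda>v. - B v) = (\<lambda>x. - pull B x)" by (simp add: pull_def fun_eq_iff linear_neg[OF linear_C])
  have inj: "pull B1 = pull B2 \<longleftrightarrow> B1 = B2" for B1 B2 by (metis push_pull)
  have id: "pull (\<lambda>v. r *\<^sub>R v) = (\<lambda>x. r *\<^sub>R x)" for r
    by (simp add: pull_def fun_eq_iff linear_scale[OF linear_C])
  have skew: "(endo_transpose G B = (\<lambda>v. - B v)) = (transpose7 (pull B) = (\<lambda>x. - pull B x))"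
    and self: "(endo_transpose G B = B) = (transpose7 (pull B) = pull B)" if "linear B"
    unfolding pull_endo_transpose[OF that, symmetric] neg[symmetric] inj by (rule refl)+
  consider "k = 1" | "k = 7" | "k = 14" | "k = 27" using k by auto
  then show ?thesis
  proof cases
    case 1
    have "(pull B = (\<lambda>x. r *\<^sub>R x)) = (B = (\<lambda>v. r *\<^sub>R v))" for r
      using inj[of B "\<lambda>v. r *\<^sub>R v"] by (simp only: id)
    then show ?thesis using 1 by (simp add: V_part_def summand7_def V1_def)
  next
    case 2
    \<comment> \<open>The criteria for the transpose and \<sigma> concern linear maps; for other
      maps both sides are false.\<close>
    then show ?thesis
      by (cases "linear B")
        (simp_all add: V_part_def summand7_def V7_def linear_pull_iff skew sigma_form_Lambda2_7)
  next
    case 3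
    then show ?thesis
      by (cases "linear B")
        (simp_all add: V_part_def summand7_def V14_def linear_pull_iff skew sigma_form_Lambda2_14)
  next
    case 4
    then show ?thesis
      by (cases "linear B")
        (simp_all add: V_part_def summand7_def V27_def linear_pull_iff self endo_trace_eq)
  qed
qed

definition project :: "nat \<Rightarrow> (real^7 \<Rightarrow> real^7) \<Rightarrow> real^7 \<Rightarrow> real^7" where
  "project k B = push (part7 k (pull B))"

lemma project_in: "linear B \<Longrightarrow> k \<in> {1, 7, 14, 27} \<Longrightarrow> project k B \<in> V_part G \<phi> k"
  by (simp add: V_part_iff project_def part7_in_summand7 linear_pull)

lemma sum_project:
  assumes "linear B" shows "(\<Sum>j\<in>{1, 7, 14, 27}. project j B v) = B v"
proof -
  have "(\<Sum>j\<in>{1, 7, 14, 27}. project j B v) = E (part7 1 (pull B) (C v) + part7 7 (pull B) (C v)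
      + part7 14 (pull B) (C v) + part7 27 (pull B) (C v))"
    by (simp add: project_def push_def linear_add[OF linear_E] add.assoc)
  also have "\<dots> = E (pull B (C v))" by (simp only: part7_sum[of "pull B" "C v"])
  finally show ?thesis by (simp add: pull_def)
qed

text \<open>This yields both the uniqueness of components and the necessary condition for lying in a
  partial sum.\<close>

lemma project_sum:
  assumes a: "\<And>j. j \<in> I \<Longrightarrow> a j \<in> V_part G \<phi> j" and I: "I \<subseteq> {1, 7, 14, 27}" and k: "k \<in> {1, 7, 14, 27}"
  shows "project k (\<lambda>v. \<Sum>j\<in>I. a j v) v = (if k \<in> I then a k v else 0)"
proof -
  have fin: "finite I" using I finite_subset by auto
  have "part7 k (\<lambda>x. \<Sum>j\<in>I. pull (a j) x) y = (\<Sum>j\<in>I. part7 k (pull (a j)) y)" for y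
    using fin
  proof (induction I)
    case empty
    show ?case using part7_scale[of k 0 "\<lambda>x. x" y] by simp
  next
    case (insert j J)
    then show ?case by (simp add: part7_add)
  qed
  also have "(\<Sum>j\<in>I. part7 k (pull (a j)) y) = (\<Sum>j\<in>I. if j = k then pull (a k) y else 0)" for y
  proof (rule sum.cong[OF refl])
    fix j assume j: "j \<in> I"
    then have "pull (a j) \<in> summand7 j" using a V_part_iff I by blast
    from part7_summand7[OF this k] show "part7 k (pull (a j)) y = (if j = k then pull (a k) y else 0)" by auto
  qed
  finally have "part7 k (\<lambda>x. \<Sum>j\<in>I. pull (a j) x) y = (if k \<in> I then pull (a k) y else 0)" for y
    using fin by simp
  moreover have "pull (\<lambda>v. \<Sum>j\<in>I. a j v) = (\<lambda>x. \<Sum>j\<in>I. pull (a j) x)"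
    by (simp add: pull_def linear_sum[OF linear_C] fun_eq_iff)
  ultimately show ?thesis
    by (simp add: project_def push_def pull_def linear_0[OF linear_E])
qed

lemma V_component_eq:
  assumes B: "linear B" and k: "k \<in> {1, 7, 14, 27}"
  shows "V_component G \<phi> k B = project k B"
  unfolding V_component_def
proof (rule the_equality)
  show "\<exists>a. (\<forall>j\<in>{1, 7, 14, 27}. a j \<in> V_part G \<phi> j) \<and> B = (\<lambda>v. \<Sum>j\<in>{1, 7, 14, 27}. a j v) \<and> project k B = a k"
    using project_in[OF B] sum_project[OF B] by (intro exI[of _ "\<lambda>j. project j B"] conjI ballI ext) (blast, simp, simp)
next
  fix D assume "\<exists>a. (\<forall>j\<in>{1, 7, 14, 27}. a j \<in> V_part G \<phi> j) \<and> B = (\<lambda>v. \<Sum>j\<in>{1, 7, 14, 27}. a j v) \<and> D = a k"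
  then obtain a where a: "\<And>j. j \<in> {1, 7, 14, 27} \<Longrightarrow> a j \<in> V_part G \<phi> j"
    and B': "B = (\<lambda>v. \<Sum>j\<in>{1, 7, 14, 27}. a j v)" and D: "D = a k" by blast
  show "D = project k B"
    unfolding B' D using project_sum[OF a order.refl k] k by (intro ext) simp
qed

lemma project_eq_0_iff: "project k B = (\<lambda>v. 0) \<longleftrightarrow> (\<forall>x. part7 k (pull B) x = 0)"
proof
  assume "project k B = (\<lambda>v. 0)"
  then have "C (project k B (E x)) = 0" for x by (simp add: linear_0[OF linear_C])
  then show "\<forall>x. part7 k (pull B) x = 0" by (simp add: project_def push_def)
qed (simp add: project_def push_def linear_0[OF linear_E] fun_eq_iff)

lemma V_sum_iff:
  assumes B: "linear B" and I: "I \<subseteq> {1, 7, 14, 27}"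
  shows "B \<in> V_sum G \<phi> I \<longleftrightarrow> (\<forall>k\<in>{1, 7, 14, 27} - I. project k B = (\<lambda>v. 0))"
proof
  assume "B \<in> V_sum G \<phi> I"
  then obtain a where B': "B = (\<lambda>v. \<Sum>k\<in>I. a k v)" and a: "\<And>k. k \<in> I \<Longrightarrow> a k \<in> V_part G \<phi> k"
    by (auto simp: V_sum_def)
  show "\<forall>k\<in>{1, 7, 14, 27} - I. project k B = (\<lambda>v. 0)"
  proof (intro ballI ext)
    fix k v assume "k \<in> {1, 7, 14, 27} - I"
    then show "project k B v = 0"
      using project_sum[of I a k v, OF a I] unfolding B' by (simp only: Diff_iff if_False)
  qed
next
  assume 0: "\<forall>k\<in>{1, 7, 14, 27} - I. project k B = (\<lambda>v. 0)"
  have "(\<Sum>j\<in>I. project j B v) = (\<Sum>j\<in>{1, 7, 14, 27}. project j B v)" for v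
    by (rule sum.mono_neutral_left) (use I 0 in auto)
  then have "B = (\<lambda>v. \<Sum>j\<in>I. project j B v)" using sum_project[OF B] by simp
  moreover have "\<forall>j\<in>I. project j B \<in> V_part G \<phi> j" using project_in[OF B] I by blast
  ultimately have "\<exists>a. B = (\<lambda>v. \<Sum>k\<in>I. a k v) \<and> (\<forall>k\<in>I. a k \<in> V_part G \<phi> k)"
    by (intro exI[of _ "\<lambda>j. project j B"] conjI)
  then show "B \<in> V_sum G \<phi> I" unfolding V_sum_def mem_Collect_eq .
qed

end

section \<open>The bracket in a chart\<close>

text \<open>When an argument is repeated in neighbouring slots, only the two terms that remove one
  of the copies survive, and they are opposite.\<close>

lemma is_form_alternation:
  fixes D :: "real^7 \<Rightarrow> (real^7) list \<Rightarrow> real^7"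
  assumes D: "\<And>z. is_form k (D z)" and lin: "\<And>vs. linear (\<lambda>z. D z vs)"
  shows "is_form (Suc k) (alternation D)"
proof (rule is_formI)
  fix vs :: "(real^7) list" assume "length vs \<noteq> Suc k"
  then show "alternation D vs = 0"
    unfolding alternation_def by (intro sum.neutral ballI) (auto simp: is_formD_length[OF D])
next
  fix us vs
  show "linear (\<lambda>w. alternation D (us @ w # vs))"
  proof -
    let ?n = "length us"
    have "linear (\<lambda>w. D ((us @ w # vs) ! i) (take i (us @ w # vs) @ drop (Suc i) (us @ w # vs)))"
      if "i < length us + Suc (length vs)" for i
    proof -
      consider "i < ?n" | "i = ?n" | "i > ?n" by linarith
      then show ?thesis
      proof cases
        case 1
        then show ?thesis
          using is_formD_linear[OF D, of "us ! i" "take i us @ drop (Suc i) us" vs] by (simp add: nth_append)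
      next
        case 2
        then show ?thesis using lin[of "us @ vs"] by (simp add: nth_append)
      next
        case 3
        define j where "j = i - Suc ?n"
        have "i = Suc (?n + j)" "j < length vs" using 3 that by (auto simp: j_def)
        then show ?thesis
          using is_formD_linear[OF D, of "vs ! j" us "take j vs @ drop (Suc j) vs"] by (simp add: nth_append)
      qed
    qed
    then show ?thesis
      unfolding alternation_def length_append length_Cons
      by (intro linear_compose_sum ballI linear_compose_scale_right) auto
  qed
next
  fix us vs :: "(real^7) list" and v :: "real^7"
  let ?l = "us @ v # v # vs" and ?n = "length us"
  let ?t = "\<lambda>i. (-1) ^ i *\<^sub>R D (?l ! i) (take i ?l @ drop (Suc i) ?l)"
  have 0: "?t i = 0" if "i < length ?l" "i \<noteq> ?n" "i \<noteq> Suc ?n" for i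
  proof -
    have "\<not> distinct (take i ?l @ drop (Suc i) ?l)"
    proof (cases "i < ?n")
      case False
      define j where "j = i - Suc (Suc ?n)"
      have "i = Suc (Suc (?n + j))" using False that by (auto simp: j_def)
      then show ?thesis by simp
    qed simp
    then show ?thesis by (simp add: is_formD_eq_0[OF D])
  qed
  have "alternation D ?l = (\<Sum>i\<in>{?n, Suc ?n}. ?t i)"
    unfolding alternation_def by (rule sum.mono_neutral_right) (use 0 in auto)
  also have "\<dots> = 0" by (simp add: nth_append)
  finally show "alternation D ?l = 0" .
qed

text \<open>Alternation and multilinearity of the bracket are what lets its values on a few frame
  lists determine it.\<close>

lemma is_form_fn_expression:
  assumes \<Phi>: "is_form k \<Phi>" and \<Psi>: "is_form l \<Psi>"
    and D\<Phi>: "\<And>z. is_form k (D\<Phi> z)" and D\<Psi>: "\<And>z. is_form l (D\<Psi> z)"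
    and l\<Phi>: "\<And>vs. linear (\<lambda>z. D\<Phi> z vs)" and l\<Psi>: "\<And>vs. linear (\<lambda>z. D\<Psi> z vs)"
  shows "is_form (k + l) (fn_expression k \<Phi> D\<Phi> \<Psi> D\<Psi>)"
proof (rule is_formI)
  note a\<Phi> = is_form_alternation[OF D\<Phi> l\<Phi>] and a\<Psi> = is_form_alternation[OF D\<Psi> l\<Psi>]
  note len = is_formD_length[OF \<Phi>] is_formD_length[OF \<Psi>] is_formD_length[OF D\<Phi>] is_formD_length[OF D\<Psi>]
    is_formD_length[OF a\<Phi>] is_formD_length[OF a\<Psi>]
  note z1 = linear_0[OF l\<Phi>] linear_0[OF l\<Psi>]
  have h: "linear (\<lambda>z. \<Phi> (z # I))" "linear (\<lambda>z. \<Psi> (z # I))" for I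
    using is_formD_linear[OF \<Phi>, of "[]"] is_formD_linear[OF \<Psi>, of "[]"] by auto
  note z2 = linear_0[OF h(1)] linear_0[OF h(2)]
  show "fn_expression k \<Phi> D\<Phi> \<Psi> D\<Psi> vs = 0" if "length vs \<noteq> k + l" for vs
    unfolding fn_expression_def
  proof (rule shuffle_sum_eq_0)
    fix I J :: "(real^7) list" assume L: "length I + length J = length vs"
    \<comment> \<open>Either \<open>I\<close> has the wrong length, so that the direction of
      differentiation is 0, or \<open>J\<close> has.\<close>
    have "D\<Psi> (\<Phi> I) J = 0"
      using that L by (cases "length I = k") (auto simp: len z1)
    moreover have "D\<Phi> (\<Psi> J) I = 0"
      using that L by (cases "length I = k") (auto simp: len z1)
    moreover have "\<Psi> (alternation D\<Phi> I # J) = 0"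
      using that L by (cases "length I = Suc k") (auto simp: len z2)
    moreover have "\<Phi> (alternation D\<Psi> J # I) = 0"
      using that L by (cases "length J = Suc l") (auto simp: len z2)
    ultimately show "D\<Psi> (\<Phi> I) J - D\<Phi> (\<Psi> J) I
      + (- 1) ^ k *\<^sub>R (\<Psi> (alternation D\<Phi> I # J) + \<Phi> (alternation D\<Psi> J # I)) = 0" by simp
  qed
  note cmp = linear_compose[unfolded o_def]
  have t: "linear (\<lambda>w. \<Psi> (x # J @ w # J'))" "linear (\<lambda>w. \<Phi> (x # J @ w # J'))" for x J J'
    using is_formD_linear[OF \<Psi>, of "x # J"] is_formD_linear[OF \<Phi>, of "x # J"] by auto
  show "linear (\<lambda>w. fn_expression k \<Phi> D\<Phi> \<Psi> D\<Psi> (us @ w # vs))" for us vs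
    unfolding fn_expression_def
    by (intro shuffle_sum_linear_slot linear_compose_add linear_compose_sub linear_compose_scale_right
        is_formD_linear[OF D\<Phi>] is_formD_linear[OF D\<Psi>] t
        cmp[OF is_formD_linear[OF \<Phi>] l\<Psi>] cmp[OF is_formD_linear[OF \<Psi>] l\<Phi>]
        cmp[OF is_formD_linear[OF a\<Phi>] h(2)] cmp[OF is_formD_linear[OF a\<Psi>] h(1)])
  show "fn_expression k \<Phi> D\<Phi> \<Psi> D\<Psi> (us @ v # v # vs) = 0" for us v vs
    unfolding fn_expression_def
    by (rule shuffle_sum_adjacent_eq_0)
      (simp_all add: is_formD_eq_0[OF \<Phi>] is_formD_eq_0[OF \<Psi>] is_formD_eq_0[OF D\<Phi>] is_formD_eq_0[OF D\<Psi>]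
        is_formD_eq_0[OF a\<Phi>] is_formD_eq_0[OF a\<Psi>] z1 z2)
qed

text \<open>Naturality under a linear isomorphism applied to values, derivatives and arguments
  alike.\<close>

lemma fn_expression_map:
  assumes E: "linear E" and CE: "\<And>x. C (E x) = x"
  shows "fn_expression k (\<lambda>vs. E (\<Phi> (map C vs))) (\<lambda>z vs. E (D\<Phi> (C z) (map C vs)))
      (\<lambda>vs. E (\<Psi> (map C vs))) (\<lambda>z vs. E (D\<Psi> (C z) (map C vs))) (map E xs)
    = E (fn_expression k \<Phi> D\<Phi> \<Psi> D\<Psi> xs)"
proof -
  have a: "alternation (\<lambda>z vs. E (D (C z) (map C vs))) (map E I) = E (alternation D I)" for D I
    by (simp add: alternation_def linear_sum[OF E] linear_scale[OF E] o_def CE take_map drop_map)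
  have m: "C \<circ> E = (\<lambda>x. x)" by (simp add: fun_eq_iff CE)
  show ?thesis
    unfolding fn_expression_def shuffle_sum_linear_image[OF E] shuffle_sum_map
    by (simp add: a m CE linear_add[OF E] linear_diff[OF E] linear_scale[OF E])
qed

lemma frechet_derivative_nth:
  fixes f :: "real^7 \<Rightarrow> real^7"
  assumes "f differentiable (at x)" shows "deriv_at (\<lambda>y. f y $ i) x z = deriv_at f x z $ i"
proof -
  have "((\<lambda>y. f y $ i) has_derivative (\<lambda>z. deriv_at f x z $ i)) (at x)"
    using assms unfolding frechet_derivative_works
    by (rule bounded_linear.has_derivative[OF bounded_linear_vec_nth])
  from frechet_derivative_at[OF this] show ?thesis by metis
qed

lemma sum_sum_axis:
  fixes L :: "real^7 \<Rightarrow> real^7" assumes L: "linear L"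
  shows "(\<Sum>i\<in>UNIV. \<Sum>j\<in>UNIV. (v $ i * L (axis i 1) $ j) *\<^sub>R axis j 1) = L v"
proof -
  have "(\<Sum>j\<in>UNIV. (x $ j) *\<^sub>R axis j 1) = x" for x :: "real^7"
    by (rule linear_expand[OF linear_ident, symmetric])
  then have "(\<Sum>j\<in>UNIV. (v $ i * L (axis i 1) $ j) *\<^sub>R axis j 1) = v $ i *\<^sub>R L (axis i 1)" for i
    by (simp add: scaleR_sum_right[symmetric] flip: scaleR_scaleR)
  then show ?thesis using linear_expand[OF L, of v] by simp
qed

text \<open>The coordinate fields are constant, so their brackets vanish and Lie derivatives along
  them are partial derivatives. The double sum over components then contracts to vector-valued
  terms.\<close>

lemma fn_bracket_eq:
  assumes \<Phi>: "is_form k (\<Phi> x)" and \<Psi>: "is_form l (\<Psi> x)"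
    and d\<Phi>: "\<And>vs. (\<lambda>y. \<Phi> y vs) differentiable (at x)" and d\<Psi>: "\<And>vs. (\<lambda>y. \<Psi> y vs) differentiable (at x)"
  shows "fn_bracket k \<Phi> \<Psi> x vs = fn_expression k (\<Phi> x) (\<lambda>z vs. deriv_at (\<lambda>y. \<Phi> y vs) x z)
    (\<Psi> x) (\<lambda>z vs. deriv_at (\<lambda>y. \<Psi> y vs) x z) vs"
proof -
  define D\<Phi> where "D\<Phi> z vs = deriv_at (\<lambda>y. \<Phi> y vs) x z" for z vs
  define D\<Psi> where "D\<Psi> z vs = deriv_at (\<lambda>y. \<Psi> y vs) x z" for z vs
  have l\<Phi>: "linear (\<lambda>z. D\<Phi> z vs)" and l\<Psi>: "linear (\<lambda>z. D\<Psi> z vs)" for vs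
    unfolding D\<Phi>_def D\<Psi>_def using linear_frechet_derivative[OF d\<Phi>] linear_frechet_derivative[OF d\<Psi>] by auto
  have h\<Phi>: "linear (\<lambda>z. \<Phi> x (z # I))" and h\<Psi>: "linear (\<lambda>z. \<Psi> x (z # I))" for I
    using is_formD_linear[OF \<Phi>, of "[]"] is_formD_linear[OF \<Psi>, of "[]"] by auto
  \<comment> \<open>The Lie derivative inserts the derivative of a constant field, which is 0, into
    a slot.\<close>
  have z\<Phi>: "\<Phi> x (us[i := 0]) = 0" if "i < length us" for us i
    using linear_0[OF is_formD_linear[OF \<Phi>, of "take i us" "drop (Suc i) us"]] that
    by (simp add: upd_conv_take_nth_drop)
  have z\<Psi>: "\<Psi> x (us[i := 0]) = 0" if "i < length us" for us i
    using linear_0[OF is_formD_linear[OF \<Psi>, of "take i us" "drop (Suc i) us"]] that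
    by (simp add: upd_conv_take_nth_drop)
  have lie: "lie_bracket (\<lambda>y. axis i 1) (\<lambda>y. axis j 1) x = 0" for i j by (simp add: lie_bracket_def)
  have L\<Phi>: "lie_deriv (\<lambda>y. axis i 1) (\<lambda>y ws. \<Phi> y ws $ j) x us = D\<Phi> (axis i 1) us $ j" for i j us
    by (simp add: lie_deriv_def frechet_derivative_nth[OF d\<Phi>] D\<Phi>_def z\<Phi>)
  have L\<Psi>: "lie_deriv (\<lambda>y. axis i 1) (\<lambda>y ws. \<Psi> y ws $ j) x us = D\<Psi> (axis i 1) us $ j" for i j us
    by (simp add: lie_deriv_def frechet_derivative_nth[OF d\<Psi>] D\<Psi>_def z\<Psi>)
  have A\<Phi>: "ext_deriv (\<lambda>y ws. \<Phi> y ws $ j) x us = alternation D\<Phi> us $ j" for j us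
    by (simp add: ext_deriv_def alternation_def frechet_derivative_nth[OF d\<Phi>] D\<Phi>_def)
  have A\<Psi>: "ext_deriv (\<lambda>y ws. \<Psi> y ws $ j) x us = alternation D\<Psi> us $ j" for j us
    by (simp add: ext_deriv_def alternation_def frechet_derivative_nth[OF d\<Psi>] D\<Psi>_def)
  have R: "shuffle_sum H vs *\<^sub>R a = shuffle_sum (\<lambda>I J. H I J *\<^sub>R a) vs" for H and a :: "real^7"
    by (rule shuffle_sum_linear_image) (simp add: linear_iff scaleR_add_left)
  let ?a = "\<lambda>i. axis i 1 :: real^7"
  have "fn_bracket k \<Phi> \<Psi> x vs = shuffle_sum (\<lambda>I J. \<Sum>i\<in>UNIV. \<Sum>j\<in>UNIV.
      (\<Phi> x I $ i * D\<Psi> (?a i) J $ j) *\<^sub>R ?a j - (D\<Phi> (?a j) I $ i * \<Psi> x J $ j) *\<^sub>R ?a i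
      + (-1) ^ k *\<^sub>R ((alternation D\<Phi> I $ i * \<Psi> x (?a i # J) $ j) *\<^sub>R ?a j
         + (\<Phi> x (?a j # I) $ i * alternation D\<Psi> J $ j) *\<^sub>R ?a i)) vs"
    unfolding fn_bracket_def fn_decomposable_def wedge_eq_shuffle_sum lie L\<Phi> L\<Psi> A\<Phi> A\<Psi> interior_def R
      scaleR_zero_right add_0_left
    unfolding shuffle_sum_sum shuffle_sum_add shuffle_sum_diff shuffle_sum_scaleR ..
  also have "\<dots> = fn_expression k (\<Phi> x) D\<Phi> (\<Psi> x) D\<Psi> vs"
    unfolding fn_expression_def
  proof (intro arg_cong[of _ _ "\<lambda>H. shuffle_sum H vs"] ext)
    fix I J
    have 1: "(\<Sum>i\<in>UNIV. \<Sum>j\<in>UNIV. (\<Phi> x I $ i * D\<Psi> (?a i) J $ j) *\<^sub>R ?a j) = D\<Psi> (\<Phi> x I) J"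
      by (rule sum_sum_axis[OF l\<Psi>])
    have 2: "(\<Sum>i\<in>UNIV. \<Sum>j\<in>UNIV. (D\<Phi> (?a j) I $ i * \<Psi> x J $ j) *\<^sub>R ?a i) = D\<Phi> (\<Psi> x J) I"
      by (subst sum.swap, subst mult.commute, rule sum_sum_axis[OF l\<Phi>])
    have 3: "(\<Sum>i\<in>UNIV. \<Sum>j\<in>UNIV. (alternation D\<Phi> I $ i * \<Psi> x (?a i # J) $ j) *\<^sub>R ?a j)
        = \<Psi> x (alternation D\<Phi> I # J)"
      by (rule sum_sum_axis[OF h\<Psi>])
    have 4: "(\<Sum>i\<in>UNIV. \<Sum>j\<in>UNIV. (\<Phi> x (?a j # I) $ i * alternation D\<Psi> J $ j) *\<^sub>R ?a i)
        = \<Phi> x (alternation D\<Psi> J # I)"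
      by (subst sum.swap, subst mult.commute, rule sum_sum_axis[OF h\<Phi>])
    show "(\<Sum>i\<in>UNIV. \<Sum>j\<in>UNIV.
      (\<Phi> x I $ i * D\<Psi> (?a i) J $ j) *\<^sub>R ?a j - (D\<Phi> (?a j) I $ i * \<Psi> x J $ j) *\<^sub>R ?a i
      + (-1) ^ k *\<^sub>R ((alternation D\<Phi> I $ i * \<Psi> x (?a i # J) $ j) *\<^sub>R ?a j
         + (\<Phi> x (?a j # I) $ i * alternation D\<Psi> J $ j) *\<^sub>R ?a i))
      = D\<Psi> (\<Phi> x I) J - D\<Phi> (\<Psi> x J) I
        + (-1) ^ k *\<^sub>R (\<Psi> x (alternation D\<Phi> I # J) + \<Phi> x (alternation D\<Psi> J # I))"
      unfolding sum.distrib sum_subtractf scaleR_sum_right[symmetric] 1 2 3 4 ..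
  qed
  finally show ?thesis unfolding D\<Phi>_def D\<Psi>_def .
qed

section \<open>Differentiability of tensors defined by duality\<close>

lemma differentiable_prod_real:
  fixes f :: "'i \<Rightarrow> 'a::real_normed_vector \<Rightarrow> real"
  assumes "\<And>i. i \<in> I \<Longrightarrow> f i differentiable (at x)"
  shows "(\<lambda>y. \<Prod>i\<in>I. f i y) differentiable (at x)"
  using assms by (induction I rule: infinite_finite_induct) simp_all

lemma differentiable_det:
  fixes A :: "'a::real_normed_vector \<Rightarrow> real^'n^'n"
  assumes "\<And>i j. (\<lambda>y. A y $ i $ j) differentiable (at x)"
  shows "(\<lambda>y. det (A y)) differentiable (at x)"
  unfolding det_def
  by (intro differentiable_sum ballI differentiable_mult differentiable_prod_real differentiable_const assms) simp

lemma differentiable_vec: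
  fixes f :: "'a::real_normed_vector \<Rightarrow> real^7"
  assumes "\<And>i. (\<lambda>y. f y $ i) differentiable (at x)" shows "f differentiable (at x)"
proof -
  have "(\<lambda>y. \<Sum>i\<in>UNIV. (f y $ i) *\<^sub>R (axis i 1 :: real^7)) differentiable (at x)"
    using assms by (intro differentiable_sum ballI differentiable_scaleR) auto
  also have "(\<lambda>y. \<Sum>i\<in>UNIV. (f y $ i) *\<^sub>R (axis i 1 :: real^7)) = f"
    by (rule ext, rule linear_expand[OF linear_ident, symmetric])
  finally show ?thesis .
qed

lemma differentiable_transform_open:
  assumes "f differentiable (at x)" "open U" "x \<in> U" "\<And>y. y \<in> U \<Longrightarrow> f y = h y"
  shows "h differentiable (at x)"
  using assms unfolding differentiable_def by (meson has_derivative_transform_within_open)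

text \<open>Cramer's rule writes each coordinate of the solution as a quotient of determinants. This
  handles vectors known only through their inner products, with no differentiable frame at
  hand.\<close>

lemma differentiable_linear_solve:
  fixes A :: "'a::real_normed_vector \<Rightarrow> real^7^7"
  assumes A: "\<And>i j. (\<lambda>y. A y $ i $ j) differentiable (at x)"
    and b: "\<And>i. (\<lambda>y. b y $ i) differentiable (at x)"
    and U: "open U" "x \<in> U"
    and eq: "\<And>y. y \<in> U \<Longrightarrow> A y *v f y = b y" and det: "\<And>y. y \<in> U \<Longrightarrow> det (A y) \<noteq> 0"
  shows "f differentiable (at x)"
proof (rule differentiable_vec)
  fix k
  let ?h = "\<lambda>y. det (\<chi> i j. if j = k then b y $ i else A y $ i $ j) / det (A y)"
  have "f y $ k = ?h y" if "y \<in> U" for y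
    using cramer[OF det[OF that], of "f y" "b y"] eq[OF that] by (metis (no_types, lifting) vec_lambda_beta)
  moreover have "?h differentiable (at x)"
  proof (rule differentiable_divide)
    show "(\<lambda>y. det (\<chi> i j. if j = k then b y $ i else A y $ i $ j)) differentiable (at x)"
    proof (rule differentiable_det)
      show "(\<lambda>y. (\<chi> i j. if j = k then b y $ i else A y $ i $ j) $ i $ j) differentiable (at x)" for i j
        by (cases "j = k") (simp_all add: A b)
    qed
  qed (use differentiable_det[OF A] det[OF U(2)] in auto)
  ultimately show "(\<lambda>y. f y $ k) differentiable (at x)"
    using differentiable_transform_open[OF _ U, of ?h "\<lambda>y. f y $ k"] by auto
qed

lemma is_form_linear_image:
  assumes L: "linear L" and \<alpha>: "is_form k \<alpha>" shows "is_form k (\<lambda>vs. L (\<alpha> vs))"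
  by (rule is_formI)
    (simp_all add: is_formD_length[OF \<alpha>] is_formD_eq_0[OF \<alpha>] linear_0[OF L]
      linear_compose[OF is_formD_linear[OF \<alpha>] L, unfolded o_def])

lemma is_form_delta:
  assumes "is_form (Suc k) \<Psi>" shows "is_form k (delta G \<Psi>)"
proof -
  have "linear (\<lambda>r. r *\<^sub>R (a :: real^7))" for a by (simp add: linear_iff scaleR_add_left)
  from is_form_linear_image[OF this is_form_interior[OF assms]] show ?thesis
    unfolding delta_def[abs_def] by (intro is_form_sum)
qed

lemma is_form_deriv:
  fixes \<alpha> :: "real^7 \<Rightarrow> (real^7) list \<Rightarrow> 'b::real_normed_vector"
  assumes U: "open U" "x \<in> U" and \<alpha>: "\<And>y. y \<in> U \<Longrightarrow> is_form k (\<alpha> y)"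
    and d: "\<And>vs. (\<lambda>y. \<alpha> y vs) differentiable (at x)"
  shows "is_form k (\<lambda>vs. deriv_at (\<lambda>y. \<alpha> y vs) x z)"
proof (rule is_formI)
  have 0: "deriv_at (\<lambda>y. \<alpha> y vs) x z = 0" if "\<And>y. y \<in> U \<Longrightarrow> \<alpha> y vs = 0" for vs
  proof -
    have "deriv_at (\<lambda>y. 0) x = deriv_at (\<lambda>y. \<alpha> y vs) x"
      by (rule frechet_derivative_transform_within_open[OF differentiable_const U]) (simp add: that)
    from fun_cong[OF this, of z] show ?thesis by simp
  qed
  show "deriv_at (\<lambda>y. \<alpha> y vs) x z = 0" if "length vs \<noteq> k" for vs
    by (rule 0) (use that is_formD_length[OF \<alpha>] in blast)
  show "deriv_at (\<lambda>y. \<alpha> y (us @ v # v # vs)) x z = 0" for us v vs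
    by (rule 0) (simp add: is_formD_eq_0[OF \<alpha>])
  note D = d[unfolded frechet_derivative_works]
  show "linear (\<lambda>w. deriv_at (\<lambda>y. \<alpha> y (us @ w # vs)) x z)" for us vs
  proof (rule linearI)
    fix a b and r :: real
    have "((\<lambda>y. \<alpha> y (us @ (a + b) # vs)) has_derivative
        (\<lambda>z. deriv_at (\<lambda>y. \<alpha> y (us @ a # vs)) x z + deriv_at (\<lambda>y. \<alpha> y (us @ b # vs)) x z)) (at x)"
      by (rule has_derivative_transform_within_open[OF has_derivative_add[OF D D] U])
        (simp add: linear_add[OF is_formD_linear[OF \<alpha>]])
    from fun_cong[OF frechet_derivative_at[OF this], of z]
    show "deriv_at (\<lambda>y. \<alpha> y (us @ (a + b) # vs)) x z
      = deriv_at (\<lambda>y. \<alpha> y (us @ a # vs)) x z + deriv_at (\<lambda>y. \<alpha> y (us @ b # vs)) x z" by simp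
    have "((\<lambda>y. \<alpha> y (us @ (r *\<^sub>R a) # vs)) has_derivative
        (\<lambda>z. r *\<^sub>R deriv_at (\<lambda>y. \<alpha> y (us @ a # vs)) x z)) (at x)"
      by (rule has_derivative_transform_within_open[OF has_derivative_scaleR_right[OF D] U])
        (simp add: linear_scale[OF is_formD_linear[OF \<alpha>]])
    from fun_cong[OF frechet_derivative_at[OF this], of z]
    show "deriv_at (\<lambda>y. \<alpha> y (us @ (r *\<^sub>R a) # vs)) x z = r *\<^sub>R deriv_at (\<lambda>y. \<alpha> y (us @ a # vs)) x z" by simp
  qed
qed

text \<open>The product rule for a linear map and an argument that both depend on the point.
  Expansion in axes leaves sums of products, so differentiability of \<open>h\<close> for each fixed
  argument suffices.\<close>

lemma deriv_contract:
  fixes f :: "real^7 \<Rightarrow> real^7" and h :: "real^7 \<Rightarrow> real^7 \<Rightarrow> 'b::real_normed_vector"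
  assumes U: "open U" "x \<in> U" and f: "f differentiable (at x)" and h: "\<And>a. (\<lambda>y. h y a) differentiable (at x)"
    and lin: "\<And>y. y \<in> U \<Longrightarrow> linear (h y)" and dlin: "linear (\<lambda>a. deriv_at (\<lambda>y. h y a) x z)"
  shows "(\<lambda>y. h y (f y)) differentiable (at x)"
    and "deriv_at (\<lambda>y. h y (f y)) x z = deriv_at (\<lambda>y. h y (f x)) x z + h x (deriv_at f x z)"
proof -
  let ?a = "\<lambda>k. axis k 1 :: real^7"
  have exp: "L a = (\<Sum>k\<in>UNIV. a $ k *\<^sub>R L (?a k))" if "linear L" for L :: "real^7 \<Rightarrow> 'b" and a
  proof -
    have "L a = L (\<Sum>k\<in>UNIV. a $ k *\<^sub>R ?a k)"
      by (rule arg_cong[OF linear_expand[OF linear_ident]])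
    then show ?thesis by (simp add: linear_sum[OF that] linear_scale[OF that])
  qed
  have fk: "((\<lambda>y. f y $ k) has_derivative (\<lambda>z. deriv_at f x z $ k)) (at x)" for k
    using f unfolding frechet_derivative_works
    by (rule bounded_linear.has_derivative[OF bounded_linear_vec_nth])
  have "((\<lambda>y. \<Sum>k\<in>UNIV. f y $ k *\<^sub>R h y (?a k)) has_derivative
      (\<lambda>z. \<Sum>k\<in>UNIV. f x $ k *\<^sub>R deriv_at (\<lambda>y. h y (?a k)) x z + deriv_at f x z $ k *\<^sub>R h x (?a k))) (at x)"
    by (intro has_derivative_sum has_derivative_scaleR fk h[unfolded frechet_derivative_works])
  then have *: "((\<lambda>y. h y (f y)) has_derivative
      (\<lambda>z. \<Sum>k\<in>UNIV. f x $ k *\<^sub>R deriv_at (\<lambda>y. h y (?a k)) x z + deriv_at f x z $ k *\<^sub>R h x (?a k))) (at x)"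
    by (rule has_derivative_transform_within_open[OF _ U]) (rule exp[OF lin, symmetric])
  then show "(\<lambda>y. h y (f y)) differentiable (at x)" unfolding differentiable_def by blast
  show "deriv_at (\<lambda>y. h y (f y)) x z = deriv_at (\<lambda>y. h y (f x)) x z + h x (deriv_at f x z)"
    unfolding fun_cong[OF frechet_derivative_at[OF *], of z, symmetric] sum.distrib
    using exp[OF dlin, of "f x"] exp[OF lin[OF U(2)], of "deriv_at f x z"] by simp
qed

context g2_frame
begin

lemma G_delta_phi: "G (delta G \<phi> [u, v]) w = \<phi> [u, v, w]"
  by (simp add: delta_phi cross_form_def G_eq phi_eq phi_form_def)

lemma delta_hodge_phi_eq: "- delta G (hodge G \<phi>) [u, v, w]
    = G u w *\<^sub>R v - G u v *\<^sub>R w - delta G \<phi> [u, delta G \<phi> [v, w]]"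
  by (simp add: delta_hodge_phi delta_phi chi_form_def cross_form_def chi7_def G_eq
      linear_diff[OF linear_E] linear_scale[OF linear_E])

end

section \<open>Levi-Civita connection and torsion\<close>

text \<open>The data in one chart, at the regularity that a first-order bracket requires. The frame
  is only given point by point, with no dependence on the point prescribed.\<close>

locale g2_chart =
  fixes U :: "(real^7) set" and g :: "real^7 \<Rightarrow> real^7 \<Rightarrow> real^7 \<Rightarrow> real"
    and \<phi> :: "real^7 \<Rightarrow> (real^7) list \<Rightarrow> real"
  assumes U: "open U"
    and inner_g: "y \<in> U \<Longrightarrow> inner_product (g y)"
    and frame_ex: "y \<in> U \<Longrightarrow> \<exists>e. G2_frame (\<phi> y) e \<and> orthonormal (g y) e"
    and dg: "y \<in> U \<Longrightarrow> (\<lambda>y. g y u v) differentiable (at y)"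
    and d\<phi>: "y \<in> U \<Longrightarrow> (\<lambda>y. \<phi> y vs) differentiable (at y)"
begin

definition cr :: "real^7 \<Rightarrow> (real^7) list \<Rightarrow> real^7" where "cr y = delta (g y) (\<phi> y)"

definition ch :: "real^7 \<Rightarrow> (real^7) list \<Rightarrow> real^7" where
  "ch y vs = - delta (g y) (hodge (g y) (\<phi> y)) vs"

lemma g2_frame_at:
  assumes "y \<in> U" obtains e where "g2_frame (g y) e (\<phi> y)"
proof -
  obtain e where e: "G2_frame (\<phi> y) e" "orthonormal (g y) e" using frame_ex[OF assms] by blast
  interpret inner_product "g y" by (rule inner_g[OF assms])
  have "g2_frame (g y) e (\<phi> y)"
    by unfold_locales (use e in \<open>auto simp: G2_frame_def\<close>)
  then show ?thesis by (rule that)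
qed

text \<open>Characterises the cross product by the metric and \<phi>, both differentiable, and so
  removes the chosen basis inside \<open>delta\<close>.\<close>

lemma g_cr: "y \<in> U \<Longrightarrow> g y (cr y [u, v]) w = \<phi> y [u, v, w]"
  unfolding cr_def by (metis g2_frame_at g2_frame.G_delta_phi)

lemma ch_eq: "y \<in> U \<Longrightarrow> ch y [u, v, w] = g y u w *\<^sub>R v - g y u v *\<^sub>R w - cr y [u, cr y [v, w]]"
  unfolding cr_def ch_def by (metis g2_frame_at g2_frame.delta_hodge_phi_eq)

lemma is_form_cr: "y \<in> U \<Longrightarrow> is_form 2 (cr y)"
  unfolding cr_def by (metis g2_frame_at g2_frame.is_form_phi is_form_delta numeral_3_eq_3 numeral_2_eq_2)

lemma is_form_ch:
  assumes "y \<in> U" shows "is_form 3 (ch y)"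
proof -
  obtain e where "g2_frame (g y) e (\<phi> y)" using g2_frame_at[OF assms] .
  then have "is_form (Suc 3) (hodge (g y) (\<phi> y))" using g2_frame.is_form_hodge_phi by fastforce
  from is_form_minus[OF is_form_delta[OF this]] show ?thesis unfolding ch_def[abs_def] .
qed

lemma g_definite: "y \<in> U \<Longrightarrow> g y v v = 0 \<Longrightarrow> v = 0"
proof -
  assume "y \<in> U" and 0: "g y v v = 0"
  then obtain e where "g2_frame (g y) e (\<phi> y)" using g2_frame_at by blast
  then interpret g2_frame "g y" e "\<phi> y" .
  have "C v = 0" using 0 by (simp add: G_eq)
  then show "v = 0" by (metis E_C linear_0 linear_E)
qed

lemma d_cr:
  assumes x: "x \<in> U" shows "(\<lambda>y. cr y vs) differentiable (at x)"
proof (cases "length vs = 2")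
  case True
  then obtain u v where vs: "vs = [u, v]" by (auto simp: length_Suc_conv numeral_2_eq_2)
  let ?a = "\<lambda>k. axis k 1 :: real^7"
  \<comment> \<open>The Gram matrix of the axes: the cross product solves a linear system with this
    matrix, which definiteness makes invertible.\<close>
  let ?A = "\<lambda>y. (\<chi> i j. g y (?a i) (?a j)) :: real^7^7"
  have A: "(?A y *v w) $ i = g y w (?a i)" if "y \<in> U" for y w i
  proof -
    interpret inner_product "g y" by (rule inner_g[OF that])
    have "g y (?a i) w = g y (?a i) (\<Sum>j\<in>UNIV. w $ j *\<^sub>R ?a j)"
      by (rule arg_cong[OF linear_expand[OF linear_ident]])
    then show ?thesis
      by (simp add: matrix_vector_mult_def G_simps sym[of w] mult.commute)
  qed
  show ?thesis
    unfolding vs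
  proof (rule differentiable_linear_solve[OF _ _ U x, of ?A "\<lambda>y. \<chi> i. \<phi> y [u, v, ?a i]"])
    show "(\<lambda>y. ?A y $ i $ j) differentiable (at x)" for i j using dg[OF x] by simp
    show "(\<lambda>y. (\<chi> i. \<phi> y [u, v, ?a i]) $ i) differentiable (at x)" for i using d\<phi>[OF x] by simp
    show "?A y *v cr y [u, v] = (\<chi> i. \<phi> y [u, v, ?a i])" if "y \<in> U" for y
      by (rule vec_eq_iff[THEN iffD2]) (simp only: A[OF that] g_cr[OF that] vec_lambda_beta simp_thms)
    show "det (?A y) \<noteq> 0" if "y \<in> U" for y
    proof -
      interpret inner_product "g y" by (rule inner_g[OF that])
      have "w = 0" if 0: "?A y *v w = 0" for w
      proof (rule g_definite[OF \<open>y \<in> U\<close>])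
        have "g y w w = g y w (\<Sum>j\<in>UNIV. w $ j *\<^sub>R ?a j)"
          by (rule arg_cong[OF linear_expand[OF linear_ident]])
        then show "g y w w = 0"
          using A[OF \<open>y \<in> U\<close>, of w] by (simp add: G_simps 0 del: vec_lambda_beta)
      qed
      then have "inj ((*v) (?A y))"
        using Real_Vector_Spaces.linear_injective_0[OF matrix_vector_mul_linear[of "?A y"]] by blast
      then show ?thesis
        using det_nz_iff_inj[OF matrix_vector_mul_linear[of "?A y"]]
        by (simp only: matrix_of_matrix_vector_mul simp_thms)
    qed
  qed
next
  case False
  then show ?thesis
    using differentiable_transform_open[OF differentiable_const[of 0] U x, of "\<lambda>y. cr y vs"]
    by (simp add: is_formD_length[OF is_form_cr])
qed

end

context g2_chart
begin

definition dm :: "real^7 \<Rightarrow> real^7 \<Rightarrow> real^7 \<Rightarrow> real^7 \<Rightarrow> real" where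
  "dm x u v w = deriv_at (\<lambda>y. g y v w) x u"

context
  fixes x assumes x: "x \<in> U"
begin

interpretation inner_product "g x" by (rule inner_g[OF x])

lemma dm_linear: "linear (\<lambda>u. dm x u v w)" "linear (\<lambda>v. dm x u v w)" "linear (\<lambda>w. dm x u v w)"
proof -
  note D = dg[OF x, unfolded frechet_derivative_works]
  show "linear (\<lambda>u. dm x u v w)"
    unfolding dm_def by (rule linear_frechet_derivative[OF dg[OF x]])
  have sym: "dm x u v w = dm x u w v" for u v w
  proof -
    have "deriv_at (\<lambda>y. g y v w) x = deriv_at (\<lambda>y. g y w v) x"
      by (rule frechet_derivative_transform_within_open[OF dg[OF x] U x])
        (rule inner_product.sym[OF inner_g])
    then show ?thesis by (simp add: dm_def)
  qed
  have lin: "linear (\<lambda>v. dm x u v w)" for u w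
  proof (rule linearI)
    fix a b and r :: real
    have "((\<lambda>y. g y (a + b) w) has_derivative
        (\<lambda>z. deriv_at (\<lambda>y. g y a w) x z + deriv_at (\<lambda>y. g y b w) x z)) (at x)"
      by (rule has_derivative_transform_within_open[OF has_derivative_add[OF D D] U x])
        (simp add: linear_add[OF inner_product.lin1[OF inner_g]])
    from fun_cong[OF frechet_derivative_at[OF this], of u]
    show "dm x u (a + b) w = dm x u a w + dm x u b w" by (simp add: dm_def)
    have "((\<lambda>y. g y (r *\<^sub>R a) w) has_derivative (\<lambda>z. r *\<^sub>R deriv_at (\<lambda>y. g y a w) x z)) (at x)"
      by (rule has_derivative_transform_within_open[OF has_derivative_scaleR_right[OF D] U x])
        (simp add: linear_scale[OF inner_product.lin1[OF inner_g]])
    from fun_cong[OF frechet_derivative_at[OF this], of u]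
    show "dm x u (r *\<^sub>R a) w = r *\<^sub>R dm x u a w" by (simp add: dm_def)
  qed
  then show "linear (\<lambda>v. dm x u v w)" .
  show "linear (\<lambda>w. dm x u v w)" using lin[of u v] by (simp add: sym[of u v])
qed

lemma dm_sym: "dm x u v w = dm x u w v"
proof -
  have "deriv_at (\<lambda>y. g y v w) x = deriv_at (\<lambda>y. g y w v) x"
    by (rule frechet_derivative_transform_within_open[OF dg[OF x] U x])
      (rule inner_product.sym[OF inner_g])
  then show ?thesis by (simp add: dm_def)
qed

lemma levi_civita:
  "bilinear (levi_civita g x)" "levi_civita g x u v = levi_civita g x v u"
  "dm x u v w = g x (levi_civita g x u v) w + g x v (levi_civita g x u w)"
proof -
  obtain e where "g2_frame (g x) e (\<phi> x)" using g2_frame_at[OF x] .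
  then interpret F: g2_frame "g x" e "\<phi> x" .
  note dl = linear_add[OF dm_linear(1)] linear_add[OF dm_linear(2)] linear_add[OF dm_linear(3)]
    linear_scale[OF dm_linear(1)] linear_scale[OF dm_linear(2)] linear_scale[OF dm_linear(3)]
  \<comment> \<open>The Koszul formula for coordinate fields, whose brackets vanish.\<close>
  define k where "k u v w = (dm x u v w + dm x v u w - dm x w u v) / 2" for u v w
  have k_lin: "linear (k u v)" for u v
    by (rule linearI) (simp_all add: k_def dl add_divide_distrib diff_divide_distrib right_diff_distrib distrib_left)
  define \<Gamma> where "\<Gamma> u v = (\<Sum>i\<in>UNIV. k u v (onb (g x) i) *\<^sub>R onb (g x) i)" for u v
  have \<Gamma>: "g x (\<Gamma> u v) w = k u v w" for u v w
    unfolding \<Gamma>_def by (rule F.onb_riesz[OF k_lin])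
  have metric: "dm x u v w = g x (\<Gamma> u v) w + g x v (\<Gamma> u w)" for u v w
    unfolding sym[of v "\<Gamma> u w"] \<Gamma> k_def using dm_sym[of u w v] by (simp add: field_simps)
  have symm: "\<Gamma> u v = \<Gamma> v u" for u v
    by (rule F.riesz) (simp add: \<Gamma> k_def dm_sym[of _ u v])
  have bil: "bilinear \<Gamma>"
  proof -
    have "linear (\<Gamma> u)" for u
      by (rule linearI; rule F.riesz) (simp_all add: \<Gamma> G_simps k_def dl field_simps)
    moreover have "linear (\<lambda>u. \<Gamma> u v)" for v unfolding symm[of _ v] by fact
    ultimately show ?thesis by (simp add: bilinear_def)
  qed
  have unique: "\<Gamma>' = \<Gamma>" if s: "\<And>u v. \<Gamma>' u v = \<Gamma>' v u"
    and m: "\<And>u v w. dm x u v w = g x (\<Gamma>' u v) w + g x v (\<Gamma>' u w)" for \<Gamma>'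
  proof (intro ext F.riesz)
    fix u v w
    \<comment> \<open>Permuting the arguments in the metric condition and using symmetry leads back
      to the Koszul formula.\<close>
    have "g x (\<Gamma>' u v) w = k u v w"
      using s[of v u] s[of w u] s[of w v] sym[of v "\<Gamma>' u w"] by (simp add: k_def m field_simps)
    then show "g x (\<Gamma>' u v) w = g x (\<Gamma> u v) w" by (simp add: \<Gamma>)
  qed
  have "levi_civita g x = \<Gamma>"
    unfolding levi_civita_def dm_def[symmetric]
    by (rule the_equality) (use bil symm metric unique in blast)+
  then show "bilinear (levi_civita g x)" "levi_civita g x u v = levi_civita g x v u"
    "dm x u v w = g x (levi_civita g x u v) w + g x v (levi_civita g x u w)"
    using bil symm metric by auto
qed

lemma d_ch: "(\<lambda>y. ch y vs) differentiable (at x)"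
  and deriv_ch: "deriv_at (\<lambda>y. ch y [u, v, w]) x z = dm x z u w *\<^sub>R v - dm x z u v *\<^sub>R w
    - deriv_at (\<lambda>y. cr y [u, cr x [v, w]]) x z - cr x [u, deriv_at (\<lambda>y. cr y [v, w]) x z]"
proof -
  have lin: "linear (\<lambda>a. cr y [u, a])" if "y \<in> U" for u y
    using is_formD_linear[OF is_form_cr[OF that], of "[u]" "[]"] by simp
  have dlin: "linear (\<lambda>a. deriv_at (\<lambda>y. cr y [u, a]) x z)" for u z
    using is_formD_linear[OF is_form_deriv[OF U x is_form_cr d_cr[OF x]], of "[u]" "[]"] by simp
  \<comment> \<open>The inner cross product is the moving argument of the outer one.\<close>
  note dc = deriv_contract[where h = "\<lambda>y a. cr y [u, a]" for u, OF U x d_cr[OF x] d_cr[OF x] lin dlin]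
  have c1: "(\<lambda>y. cr y [u, cr y [v, w]]) differentiable (at x)" for u v w
    by (rule dc(1))
  have c2: "deriv_at (\<lambda>y. cr y [u, cr y [v, w]]) x z
      = deriv_at (\<lambda>y. cr y [u, cr x [v, w]]) x z + cr x [u, deriv_at (\<lambda>y. cr y [v, w]) x z]" for u v w z
    by (rule dc(2))
  have d: "((\<lambda>y. ch y [u, v, w]) has_derivative (\<lambda>z. dm x z u w *\<^sub>R v - dm x z u v *\<^sub>R w
    - (deriv_at (\<lambda>y. cr y [u, cr x [v, w]]) x z + cr x [u, deriv_at (\<lambda>y. cr y [v, w]) x z]))) (at x)" for u v w
  proof -
    have "((\<lambda>y. cr y [u, cr y [v, w]]) has_derivative
       (\<lambda>z. deriv_at (\<lambda>y. cr y [u, cr x [v, w]]) x z + cr x [u, deriv_at (\<lambda>y. cr y [v, w]) x z])) (at x)"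
      using c1[of u v w] unfolding frechet_derivative_works c2[abs_def] .
    moreover have "((\<lambda>y. g y a b) has_derivative (\<lambda>z. dm x z a b)) (at x)" for a b
      using dg[OF x] unfolding frechet_derivative_works dm_def .
    ultimately have "((\<lambda>y. g y u w *\<^sub>R v - g y u v *\<^sub>R w - cr y [u, cr y [v, w]]) has_derivative
      (\<lambda>z. dm x z u w *\<^sub>R v - dm x z u v *\<^sub>R w
    - (deriv_at (\<lambda>y. cr y [u, cr x [v, w]]) x z + cr x [u, deriv_at (\<lambda>y. cr y [v, w]) x z]))) (at x)"
      by (intro has_derivative_diff has_derivative_scaleR_left)
    then show ?thesis
      by (rule has_derivative_transform_within_open[OF _ U x]) (simp add: ch_eq)
  qed
  show "(\<lambda>y. ch y vs) differentiable (at x)"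
  proof (cases "length vs = 3")
    case True
    then obtain u v w where "vs = [u, v, w]" by (auto simp: length_Suc_conv numeral_3_eq_3)
    then show ?thesis using d unfolding differentiable_def by blast
  next
    case False
    then show ?thesis
      using differentiable_transform_open[OF differentiable_const[of 0] U x, of "\<lambda>y. ch y vs"]
      by (simp add: is_formD_length[OF is_form_ch])
  qed
  show "deriv_at (\<lambda>y. ch y [u, v, w]) x z = dm x z u w *\<^sub>R v - dm x z u v *\<^sub>R w
    - deriv_at (\<lambda>y. cr y [u, cr x [v, w]]) x z - cr x [u, deriv_at (\<lambda>y. cr y [v, w]) x z]"
    using fun_cong[OF frechet_derivative_at[OF d[of u v w]], of z, symmetric] by (simp only: diff_diff_eq add.assoc)
qed

lemma is_form_dcr: "is_form 2 (\<lambda>vs. deriv_at (\<lambda>y. cr y vs) x z)"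
  and is_form_dch: "is_form 3 (\<lambda>vs. deriv_at (\<lambda>y. ch y vs) x z)"
  by (rule is_form_deriv[OF U x is_form_cr d_cr[OF x]], simp,
      rule is_form_deriv[OF U x is_form_ch d_ch], simp)

context
  fixes T :: "real^7 \<Rightarrow> real^7" and e
  assumes torsion: "\<And>z. nabla g \<phi> x z = interior (T z) (hodge (g x) (\<phi> x))"
    and frame_e: "g2_frame (g x) e (\<phi> x)"
begin

interpretation F: g2_frame "g x" e "\<phi> x" by (rule frame_e)

abbreviation (input) "\<Gamma> \<equiv> levi_civita g x"

lemma cr_x: "cr x vs = F.E (cross_form (map F.C vs))"
  and ch_x: "ch x vs = F.E (chi_form (map F.C vs))"
  by (simp_all only: cr_def ch_def F.delta_phi F.delta_hodge_phi)

text \<open>Differentiate g(u \<times> v, w) = \<phi>(u, v, w): the torsion equation supplies the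
  derivative of \<phi>, parallelism that of g, and the terms with \<Gamma> acting on w
  cancel.\<close>

lemma deriv_cr_2: "deriv_at (\<lambda>y. cr y [u, v]) x z = ch x [T z, u, v] + connection_action \<Gamma> (cr x) z [u, v]"
proof (rule F.riesz)
  fix w
  have lin: "linear (\<lambda>a. g y a w)" if "y \<in> U" for y
    using inner_g[OF that] by (rule inner_product.lin1)
  have dlin: "linear (\<lambda>a. deriv_at (\<lambda>y. g y a w) x z)" using dm_linear(2)[of z w] by (simp add: dm_def)
  have "deriv_at (\<lambda>y. g y (cr y [u, v]) w) x z
      = dm x z (cr x [u, v]) w + g x (deriv_at (\<lambda>y. cr y [u, v]) x z) w"
    unfolding dm_def
    by (rule deriv_contract(2)[where h = "\<lambda>y a. g y a w", OF U x d_cr[OF x] dg[OF x] lin dlin])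
  also have "deriv_at (\<lambda>y. g y (cr y [u, v]) w) x = deriv_at (\<lambda>y. \<phi> y [u, v, w]) x"
    by (rule frechet_derivative_transform_within_open[OF d\<phi>[OF x] U x, symmetric]) (simp add: g_cr)
  also have "deriv_at (\<lambda>y. \<phi> y [u, v, w]) x z = hodge (g x) (\<phi> x) [T z, u, v, w]
      + \<phi> x [\<Gamma> z u, v, w] + \<phi> x [u, \<Gamma> z v, w] + \<phi> x [u, v, \<Gamma> z w]"
    using fun_cong[OF torsion[of z], of "[u, v, w]"] by (simp add: nabla_def interior_def eval_nat_numeral)
  also have "hodge (g x) (\<phi> x) [T z, u, v, w] = g x (ch x [T z, u, v]) w"
    by (simp add: F.hodge_phi star_form_def ch_x chi_form_def F.G_eq)
  finally show "g x (deriv_at (\<lambda>y. cr y [u, v]) x z) w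
      = g x (ch x [T z, u, v] + connection_action \<Gamma> (cr x) z [u, v]) w"
    by (simp add: connection_action_def G_simps eval_nat_numeral g_cr[OF x] levi_civita(3))
qed

lemma deriv_cr: "deriv_at (\<lambda>y. cr y vs) x z
    = F.E (nabla_cross (F.pull T) (F.C z) (map F.C vs)) + connection_action \<Gamma> (cr x) z vs"
proof (cases "length vs = 2")
  case True
  then obtain u v where "vs = [u, v]" by (auto simp: length_Suc_conv numeral_2_eq_2)
  then show ?thesis
    by (simp add: deriv_cr_2 ch_x chi_form_def nabla_cross_def F.pull_def)
next
  case False
  then have "nabla_cross (F.pull T) (F.C z) (map F.C vs) = 0"
    by (auto simp: nabla_cross_def split: list.split)
  moreover have "connection_action \<Gamma> (cr x) z vs = 0"
    by (rule connection_action_eq_0[OF levi_civita(1) levi_civita(2) is_form_cr[OF x] False])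
  ultimately show ?thesis
    using is_formD_length[OF is_form_dcr False] by (simp add: linear_0[OF F.linear_E])
qed

lemma deriv_ch_eq: "deriv_at (\<lambda>y. ch y vs) x z
    = F.E (nabla_chi (F.pull T) (F.C z) (map F.C vs)) + connection_action \<Gamma> (ch x) z vs"
proof (cases "length vs = 3")
  case True
  then obtain u v w where vs: "vs = [u, v, w]" by (auto simp: length_Suc_conv numeral_3_eq_3)
  have cl: "cr x [u, a + b] = cr x [u, a] + cr x [u, b]" "cr x [u, a - b] = cr x [u, a] - cr x [u, b]" for u a b
  proof -
    have lin: "linear (\<lambda>a. cr x [u, a])"
      using is_formD_linear[OF is_form_cr[OF x], of "[u]" "[]"] by simp
    show "cr x [u, a + b] = cr x [u, a] + cr x [u, b]" "cr x [u, a - b] = cr x [u, a] - cr x [u, b]"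
      using linear_add[OF lin] linear_diff[OF lin] by blast+
  qed
  \<comment> \<open>The torsion terms of the product rule, brought to the form of
    \<open>nabla_chi\<close> by the algebraic identity for the standard products.\<close>
  have "F.E (nabla_chi (F.pull T) (F.C z) (map F.C vs))
      = - ch x [T z, u, cr x [v, w]] - cr x [u, ch x [T z, v, w]]"
    using cross7_chi7[of "F.C (T z)" "F.C u" "F.C v" "F.C w"]
    by (simp add: vs nabla_chi_def F.pull_def ch_x cr_x chi_form_def cross_form_def
        linear_neg[OF F.linear_E, symmetric] linear_diff[OF F.linear_E, symmetric])
  \<comment> \<open>Parallelism turns the derivatives of the metric into \<Gamma> terms, and all
    \<Gamma> terms assemble into the connection action on \<chi>.\<close>
  moreover have "deriv_at (\<lambda>y. ch y vs) x z = - ch x [T z, u, cr x [v, w]] - cr x [u, ch x [T z, v, w]]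
      + connection_action \<Gamma> (ch x) z vs"
    unfolding vs deriv_ch deriv_cr_2
    by (simp add: connection_action_def eval_nat_numeral ch_eq[OF x] levi_civita(3) cl
        linear_add[OF bilinear_def[THEN iffD1, OF levi_civita(1), THEN conjunct1, rule_format]]
        linear_diff[OF bilinear_def[THEN iffD1, OF levi_civita(1), THEN conjunct1, rule_format]]
        linear_scale[OF bilinear_def[THEN iffD1, OF levi_civita(1), THEN conjunct1, rule_format]]
        scaleR_add_left)
  ultimately show ?thesis by simp
next
  case False
  then have "nabla_chi (F.pull T) (F.C z) (map F.C vs) = 0"
    by (auto simp: nabla_chi_def split: list.split)
  moreover have "connection_action \<Gamma> (ch x) z vs = 0"
    by (rule connection_action_eq_0[OF levi_civita(1) levi_civita(2) is_form_ch[OF x] False])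
  ultimately show ?thesis
    using is_formD_length[OF is_form_dch False] by (simp add: linear_0[OF F.linear_E])
qed

lemma head_linear: "is_form k \<alpha> \<Longrightarrow> linear (\<lambda>w. \<alpha> (w # J))"
  for \<alpha> :: "(real^7) list \<Rightarrow> real^7"
  using is_formD_linear[of k \<alpha> "[]" J] by simp

lemma fn_bracket_cr_ch:
  assumes "length xs = 5"
  shows "fn_bracket 2 cr ch x (map F.E xs) = F.E (fn_expression 2 cross_form (nabla_cross (F.pull T))
    chi_form (nabla_chi (F.pull T)) xs)"
proof -
  note fc = is_form_cr[OF x] and fh = is_form_ch[OF x]
  obtain a b c d f where xs: "map F.E xs = [a, b, c, d, f]"
    using assms by (auto simp: length_Suc_conv eval_nat_numeral)
  have "fn_bracket 2 cr ch x (map F.E xs)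
      = fn_expression 2 (cr x) (\<lambda>z vs. F.E (nabla_cross (F.pull T) (F.C z) (map F.C vs)))
          (ch x) (\<lambda>z vs. F.E (nabla_chi (F.pull T) (F.C z) (map F.C vs))) (map F.E xs)
        + fn_expression 2 (cr x) (connection_action \<Gamma> (cr x)) (ch x) (connection_action \<Gamma> (ch x)) (map F.E xs)"
    unfolding fn_bracket_eq[OF fc fh d_cr[OF x] d_ch] deriv_cr deriv_ch_eq
    by (rule fn_expression_add[OF head_linear[OF fc] head_linear[OF fh]])
  \<comment> \<open>The Christoffel part, which vanishes because the connection is
    symmetric.\<close>
  also have "fn_expression 2 (cr x) (connection_action \<Gamma> (cr x)) (ch x) (connection_action \<Gamma> (ch x)) (map F.E xs) = 0"
    unfolding xs by (rule fn_expression_connection_action_2_3[OF levi_civita(1) levi_civita(2) fc fh])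
  finally show ?thesis
    unfolding cr_x[abs_def] ch_x[abs_def] by (simp add: fn_expression_map[OF F.linear_E F.C_E])
qed

lemma fn_bracket_ch_ch:
  assumes "length xs = 6"
  shows "fn_bracket 3 ch ch x (map F.E xs) = F.E (fn_expression 3 chi_form (nabla_chi (F.pull T))
    chi_form (nabla_chi (F.pull T)) xs)"
proof -
  note fh = is_form_ch[OF x]
  obtain a b c d f h where xs: "map F.E xs = [a, b, c, d, f, h]"
    using assms by (auto simp: length_Suc_conv eval_nat_numeral)
  have "fn_bracket 3 ch ch x (map F.E xs)
      = fn_expression 3 (ch x) (\<lambda>z vs. F.E (nabla_chi (F.pull T) (F.C z) (map F.C vs)))
          (ch x) (\<lambda>z vs. F.E (nabla_chi (F.pull T) (F.C z) (map F.C vs))) (map F.E xs)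
        + fn_expression 3 (ch x) (connection_action \<Gamma> (ch x)) (ch x) (connection_action \<Gamma> (ch x)) (map F.E xs)"
    unfolding fn_bracket_eq[OF fh fh d_ch d_ch] deriv_ch_eq
    by (rule fn_expression_add[OF head_linear[OF fh] head_linear[OF fh]])
  also have "fn_expression 3 (ch x) (connection_action \<Gamma> (ch x)) (ch x) (connection_action \<Gamma> (ch x)) (map F.E xs) = 0"
    unfolding xs by (rule fn_expression_connection_action_3_3[OF levi_civita(1) levi_civita(2) fh fh])
  finally show ?thesis
    unfolding ch_x[abs_def] by (simp add: fn_expression_map[OF F.linear_E F.C_E])
qed

lemma is_form_bracket: "is_form 5 (fn_bracket 2 cr ch x)" "is_form 6 (fn_bracket 3 ch ch x)"
proof -
  note fc = is_form_cr[OF x] and fh = is_form_ch[OF x]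
  note lc = linear_frechet_derivative[OF d_cr[OF x]] and lh = linear_frechet_derivative[OF d_ch]
  have "is_form (2 + 3) (fn_bracket 2 cr ch x)"
    unfolding fn_bracket_eq[OF fc fh d_cr[OF x] d_ch, abs_def]
    by (rule is_form_fn_expression[OF fc fh is_form_dcr is_form_dch lc lh])
  then show "is_form 5 (fn_bracket 2 cr ch x)" by simp
  have "is_form (3 + 3) (fn_bracket 3 ch ch x)"
    unfolding fn_bracket_eq[OF fh fh d_ch d_ch, abs_def]
    by (rule is_form_fn_expression[OF fh fh is_form_dch is_form_dch lh lh])
  then show "is_form 6 (fn_bracket 3 ch ch x)" by simp
qed

lemma is_form_nth: "is_form k \<alpha> \<Longrightarrow> is_form k (\<lambda>vs. \<alpha> vs $ i)" for \<alpha> :: "(real^7) list \<Rightarrow> real^7"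
  by (rule is_form_linear_image) (simp add: linear_iff)

lemma frame_sum: "(\<Sum>i\<in>UNIV. g x (e i) u *\<^sub>R F.E (A (axis i 1))) = F.push A u" if "linear A" for A
proof -
  have "F.push A u = F.E (\<Sum>i\<in>UNIV. F.C u $ i *\<^sub>R A (axis i 1))"
    unfolding F.push_def by (rule arg_cong[OF linear_expand[OF that]])
  then show ?thesis
    by (simp add: linear_sum[OF F.linear_E] linear_scale[OF F.linear_E] F.C_nth)
qed

lemma K_eq:
  assumes T: "linear T"
  shows "K_iso (g x) (\<phi> x) (pi7 (g x) (\<phi> x) (fn_bracket 2 cr ch x))
    = F.push (\<lambda>u. 2 *\<^sub>R F.pull T u - 4 *\<^sub>R transpose7 (F.pull T) u - (2 * trace7 (F.pull T)) *\<^sub>R u)"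
proof -
  note lT = F.linear_pull[OF T]
  let ?K = "\<lambda>u. 2 *\<^sub>R F.pull T u - 4 *\<^sub>R transpose7 (F.pull T) u - (2 * trace7 (F.pull T)) *\<^sub>R u"
  let ?X = "fn_expression 2 cross_form (nabla_cross (F.pull T)) chi_form (nabla_chi (F.pull T))"
  have lK: "linear ?K"
    by (intro linear_compose_sub linear_compose_scale_right lT linear_transpose7 linear_ident)
  have "shuffle_sum (\<lambda>I J. cross_2form (axis k 1) J *\<^sub>R fn_bracket 2 cr ch x (map F.E I)) (axes basis7)
      = 3 *\<^sub>R F.E (?K (axis k 1))" for k
  proof -
    \<comment> \<open>The bracket has been computed on five frame-coordinate arguments; other
      splittings drop out because the 2-form vanishes unless \<open>J\<close> has length 2.\<close>
    have "shuffle_sum (\<lambda>I J. cross_2form (axis k 1) J *\<^sub>R fn_bracket 2 cr ch x (map F.E I)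
        - F.E (cross_2form (axis k 1) J *\<^sub>R ?X I)) (axes basis7) = 0"
    proof (rule shuffle_sum_eq_0)
      fix I J :: "(real^7) list" assume "length I + length J = length (axes basis7)"
      then have "length I = 5 \<or> length J \<noteq> 2" by auto
      then show "cross_2form (axis k 1) J *\<^sub>R fn_bracket 2 cr ch x (map F.E I)
        - F.E (cross_2form (axis k 1) J *\<^sub>R ?X I) = 0"
      proof
        assume "length J \<noteq> 2"
        then have "cross_2form (axis k 1) J = 0" by (auto simp: cross_2form_def split: list.split)
        then show ?thesis by (simp add: linear_0[OF F.linear_E])
      qed (simp add: fn_bracket_cr_ch linear_scale[OF F.linear_E])
    qed
    then show ?thesis
      unfolding shuffle_sum_diff shuffle_sum_linear_image[OF F.linear_E, symmetric] fn_expression_cross_chi[OF lT]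
      by (simp only: right_minus_eq linear_scale[OF F.linear_E])
  qed
  then show ?thesis
    unfolding F.K_iso_eq[OF is_form_nth[OF is_form_bracket(1)]]
    by (intro ext) (simp only: scaleR_scaleR, simp add: frame_sum[OF lK])
qed

lemma L_eq:
  assumes T: "linear T"
  shows "L_iso (g x) (fn_bracket 3 ch ch x) = F.push (\<lambda>u. - 10 *\<^sub>R F.pull T u
    + 2 *\<^sub>R transpose7 (F.pull T) u + 6 *\<^sub>R cross7 (skew_vector (F.pull T)) u)"
proof -
  note lT = F.linear_pull[OF T]
  let ?L = "\<lambda>u. - 10 *\<^sub>R F.pull T u + 2 *\<^sub>R transpose7 (F.pull T) u + 6 *\<^sub>R cross7 (skew_vector (F.pull T)) u"
  have "linear (cross7 (skew_vector (F.pull T)))" using bilinear_cross7 by (simp add: bilinear_def)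
  then have lL: "linear ?L"
    by (intro linear_compose_add linear_compose_scale_right lT linear_transpose7)
  have s: "sign7 i * sign7 i = 1" for i by (simp add: sign7_def)
  have "sign7 i *\<^sub>R fn_bracket 3 ch ch x (map e (omit7 i)) = F.E (?L (axis i 1))" for i
    unfolding F.map_e[of "omit7 i"] fn_bracket_ch_ch[of "axes (omit7 i)", unfolded length_map, OF length_omit7]
      fn_expression_chi_chi[OF lT] linear_scale[OF F.linear_E] scaleR_scaleR s scaleR_one ..
  then show ?thesis
    unfolding F.L_iso_eq[OF is_form_nth[OF is_form_bracket(2)]] by (simp only: frame_sum[OF lL])
qed

end

end

end

section \<open>Characterisation of the torsion classes\<close>

text \<open>The trace of A + A^T is 2 tr(A), so the left side forces tr(A) = 0. Given zero trace it
  is the V_27 condition.\<close>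

lemma part7_eq_0_sym_iff: "(\<forall>x. A x + transpose7 A x = 0)
    \<longleftrightarrow> (\<forall>x. part7 1 A x = 0) \<and> (\<forall>x. part7 27 A x = 0)" if A: "linear A"
proof
  assume 0: "\<forall>x. A x + transpose7 A x = 0"
  then have "trace7 A + trace7 A = trace7 (\<lambda>x. 0)"
    using trace7_add[of A "transpose7 A"] by (simp add: trace7_transpose7)
  then have "trace7 A = 0" by (simp add: trace7_def)
  then show "(\<forall>x. part7 1 A x = 0) \<and> (\<forall>x. part7 27 A x = 0)"
    using 0 by (simp add: part7.simps)
next
  assume "(\<forall>x. part7 1 A x = 0) \<and> (\<forall>x. part7 27 A x = 0)"
  then show "\<forall>x. A x + transpose7 A x = 0"
    using part7_eq_0_iff(1,4)[OF A] by simp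
qed

text \<open>A symmetric map has zero skew vector, so both skew parts vanish. Conversely, the two
  parts add up to (A - A^T)/2.\<close>

lemma part7_eq_0_skew_iff: "(\<forall>x. A x - transpose7 A x = 0)
    \<longleftrightarrow> (\<forall>x. part7 7 A x = 0) \<and> (\<forall>x. part7 14 A x = 0)" if A: "linear A"
proof
  assume 0: "\<forall>x. A x - transpose7 A x = 0"
  then have "transpose7 A = A" by (simp add: fun_eq_iff)
  then have "skew_vector A = - skew_vector A" using skew_vector_transpose7[of A] by simp
  then have "skew_vector A = 0" by (simp add: vec_eq_iff)
  then show "(\<forall>x. part7 7 A x = 0) \<and> (\<forall>x. part7 14 A x = 0)"
    using 0 by (simp add: part7.simps skew_part_def cross7_simps)
next
  assume 0: "(\<forall>x. part7 7 A x = 0) \<and> (\<forall>x. part7 14 A x = 0)"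
  show "\<forall>x. A x - transpose7 A x = 0"
  proof
    fix x
    have "part7 7 A x + part7 14 A x = 0" using 0 by simp
    then show "A x - transpose7 A x = 0" by (simp add: part7.simps)
  qed
qed

lemma part7_scalar:
  assumes "k \<in> {7, 14, 27}" shows "part7 k (\<lambda>x. r *\<^sub>R x) x = 0"
proof -
  have "(\<lambda>x. r *\<^sub>R x) \<in> summand7 1" by (auto simp: summand7_def)
  from part7_summand7[OF this, of k] assms show ?thesis by auto
qed

lemma part7_eq_0_scalar_iff: "(\<forall>x. A x = (1/7 * trace7 A) *\<^sub>R x)
    \<longleftrightarrow> (\<forall>x. part7 7 A x = 0) \<and> (\<forall>x. part7 14 A x = 0) \<and> (\<forall>x. part7 27 A x = 0)"
proof
  assume "\<forall>x. A x = (1/7 * trace7 A) *\<^sub>R x"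
  moreover define r where "r = 1/7 * trace7 A"
  ultimately have A: "A = (\<lambda>x. r *\<^sub>R x)" by (simp add: fun_eq_iff)
  have "part7 k A x = 0" if "k \<in> {7, 14, 27}" for k x
    using part7_scalar[OF that, of r x] unfolding A[symmetric] .
  then show "(\<forall>x. part7 7 A x = 0) \<and> (\<forall>x. part7 14 A x = 0) \<and> (\<forall>x. part7 27 A x = 0)"
    by simp
next
  assume 0: "(\<forall>x. part7 7 A x = 0) \<and> (\<forall>x. part7 14 A x = 0) \<and> (\<forall>x. part7 27 A x = 0)"
  show "\<forall>x. A x = (1/7 * trace7 A) *\<^sub>R x"
  proof
    fix x
    have "A x = part7 1 A x" using part7_sum[of A x] 0 by simp
    then show "A x = (1/7 * trace7 A) *\<^sub>R x" by (simp add: part7.simps)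
  qed
qed

lemma part7_eq_0_all_iff: "(\<forall>x. A x = 0) \<longleftrightarrow> (\<forall>x. part7 1 A x = 0) \<and> (\<forall>x. part7 7 A x = 0)
    \<and> (\<forall>x. part7 14 A x = 0) \<and> (\<forall>x. part7 27 A x = 0)"
proof
  assume "\<forall>x. A x = 0"
  then have "A = (\<lambda>x. 0 *\<^sub>R x)" by (simp add: fun_eq_iff)
  moreover have "part7 1 (\<lambda>x. 0 *\<^sub>R x) x = 0" for x using part7_scale[of 1 0 "\<lambda>x. x" x] by simp
  ultimately show "(\<forall>x. part7 1 A x = 0) \<and> (\<forall>x. part7 7 A x = 0)
    \<and> (\<forall>x. part7 14 A x = 0) \<and> (\<forall>x. part7 27 A x = 0)"
    using part7_scalar[of _ 0] by (metis insertI1 insertI2)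
next
  assume 0: "(\<forall>x. part7 1 A x = 0) \<and> (\<forall>x. part7 7 A x = 0)
    \<and> (\<forall>x. part7 14 A x = 0) \<and> (\<forall>x. part7 27 A x = 0)"
  show "\<forall>x. A x = 0"
  proof
    show "A x = 0" for x using part7_sum[of A x] 0 by simp
  qed
qed

text \<open>The transpose is A on V_1 and V_27 and -A on V_7 and V_14, while the trace term acts on
  V_1 alone, where tr(r id) = 7 r. Hence 2 - 4 - 14 = -16, 2 + 4 = 6 twice, and 2 - 4 = -2.\<close>

lemma part7_K:
  assumes A: "linear A" and k: "k \<in> {1, 7, 14, 27}"
  shows "part7 k (\<lambda>u. 2 *\<^sub>R A u - 4 *\<^sub>R transpose7 A u - (2 * trace7 A) *\<^sub>R u) x
    = (if k = 1 then -16 else if k = 27 then -2 else 6) *\<^sub>R part7 k A x"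
proof -
  define K where "K = (\<lambda>u. 2 *\<^sub>R A u - 4 *\<^sub>R transpose7 A u - (2 * trace7 A) *\<^sub>R u)"
  have tr: "trace7 K = - 16 * trace7 A"
    unfolding K_def by (simp add: trace7_diff trace7_scale trace7_transpose7 trace7_id)
  have sv: "skew_vector K = 6 *\<^sub>R skew_vector A"
    unfolding K_def by (simp add: skew_vector_diff skew_vector_scale skew_vector_transpose7 skew_vector_id
        flip: scaleR_add_left)
  have t: "transpose7 K x = 2 *\<^sub>R transpose7 A x - 4 *\<^sub>R A x - (2 * trace7 A) *\<^sub>R x"
    unfolding K_def by (simp add: transpose7_diff transpose7_scale transpose7_id transpose7_transpose7[OF A])
  have Kx: "K x = 2 *\<^sub>R A x - 4 *\<^sub>R transpose7 A x - (2 * trace7 A) *\<^sub>R x"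
    unfolding K_def ..
  show ?thesis
    unfolding K_def[symmetric]
    using k by (auto simp: part7.simps skew_part_def tr sv t Kx cross7_simps vec_eq_iff field_simps)
qed

text \<open>The first two terms give -10 + 2 = -8 on symmetric and -10 - 2 = -12 on skew maps. The
  cross product term is 6 * 6 = 36 on V_7 and zero elsewhere, so V_7 receives 24.\<close>

lemma part7_L:
  assumes A: "linear A" and k: "k \<in> {1, 7, 14, 27}"
  shows "part7 k (\<lambda>u. - 10 *\<^sub>R A u + 2 *\<^sub>R transpose7 A u + 6 *\<^sub>R cross7 (skew_vector A) u) x
    = (if k = 7 then 24 else if k = 14 then -12 else -8) *\<^sub>R part7 k A x"
proof -
  define L where "L = (\<lambda>u. - 10 *\<^sub>R A u + 2 *\<^sub>R transpose7 A u + 6 *\<^sub>R cross7 (skew_vector A) u)"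
  have tr: "trace7 L = - 8 * trace7 A"
    unfolding L_def trace7_add trace7_scale trace7_transpose7 trace7_cross7 by simp
  have sv: "skew_vector L = 24 *\<^sub>R skew_vector A"
    unfolding L_def skew_vector_add skew_vector_scale skew_vector_transpose7 skew_vector_cross7
    by (simp add: vec_eq_iff)
  have t: "transpose7 L x = - 10 *\<^sub>R transpose7 A x + 2 *\<^sub>R A x - 6 *\<^sub>R cross7 (skew_vector A) x"
    unfolding L_def transpose7_add transpose7_scale transpose7_cross7 transpose7_transpose7[OF A] by simp
  have Lx: "L x = - 10 *\<^sub>R A x + 2 *\<^sub>R transpose7 A x + 6 *\<^sub>R cross7 (skew_vector A) x"
    unfolding L_def ..
  show ?thesis
    unfolding L_def[symmetric]
    using k by (auto simp: part7.simps skew_part_def tr sv t Lx cross7_simps vec_eq_iff field_simps)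
qed

context g2_frame
begin

lemma ball_C: "(\<forall>v. P (C v)) \<longleftrightarrow> (\<forall>x. P x)"
  by (metis C_E)

lemma E_eq_0_iff: "E x = 0 \<longleftrightarrow> x = 0"
  by (metis C_E linear_0 linear_C linear_E)

lemma component_eq_0_iff:
  assumes B: "linear B" and k: "k \<in> {1, 7, 14, 27}"
  shows "V_component G \<phi> k B = (\<lambda>v. 0) \<longleftrightarrow> (\<forall>x. part7 k (pull B) x = 0)"
  by (simp add: V_component_eq[OF assms] project_eq_0_iff)

context
  fixes B :: "real^7 \<Rightarrow> real^7" assumes B: "linear B"
begin

abbreviation (input) "Z k \<equiv> (V_component G \<phi> k B = (\<lambda>v. 0))"

text \<open>The frame isometry carries each relation to R^7, where it becomes a statement about the
  projections; every relation of the table is a combination of these vanishing statements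
  \<open>Z k\<close>.\<close>

lemma conditions:
  "endo_trace B = 0 \<longleftrightarrow> Z 1"
  "sigma_form G B \<in> Lambda2_14 G \<phi> \<longleftrightarrow> Z 7"
  "sigma_form G B \<in> Lambda2_7 \<phi> \<longleftrightarrow> Z 14"
  "(\<forall>v. B v + endo_transpose G B v - (2/7 * endo_trace B) *\<^sub>R v = 0) \<longleftrightarrow> Z 27"
  "(\<forall>v. B v + endo_transpose G B v = 0) \<longleftrightarrow> Z 1 \<and> Z 27"
  "(\<forall>v. B v - endo_transpose G B v = 0) \<longleftrightarrow> Z 7 \<and> Z 14"
  "(\<forall>v. B v = (1/7 * endo_trace B) *\<^sub>R v) \<longleftrightarrow> Z 7 \<and> Z 14 \<and> Z 27"
  "(\<forall>v. B v = 0) \<longleftrightarrow> Z 1 \<and> Z 7 \<and> Z 14 \<and> Z 27"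
proof -
  note lB = linear_pull[OF B]
  note c = component_eq_0_iff[OF B, of 1] component_eq_0_iff[OF B, of 7]
    component_eq_0_iff[OF B, of 14] component_eq_0_iff[OF B, of 27]
  have t: "endo_transpose G B v = E (transpose7 (pull B) (C v))" for v
    by (simp add: endo_transpose_eq[OF B] push_def)
  note lin = linear_add[OF linear_E] linear_diff[OF linear_E] linear_scale[OF linear_E]
  have p27: "B v + endo_transpose G B v - (2/7 * endo_trace B) *\<^sub>R v
      = E (pull B (C v) + transpose7 (pull B) (C v) - (2/7 * trace7 (pull B)) *\<^sub>R C v)" for v
    unfolding t lin endo_trace_eq[OF B] by (simp add: pull_def)
  have sum: "B v + endo_transpose G B v = E (pull B (C v) + transpose7 (pull B) (C v))" for v
    unfolding t lin by (simp add: pull_def)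
  have diff: "B v - endo_transpose G B v = E (pull B (C v) - transpose7 (pull B) (C v))" for v
    unfolding t lin by (simp add: pull_def)
  have p1: "B v - (1/7 * endo_trace B) *\<^sub>R v = E (pull B (C v) - (1/7 * trace7 (pull B)) *\<^sub>R C v)" for v
    unfolding lin endo_trace_eq[OF B] by (simp add: pull_def)
  show "endo_trace B = 0 \<longleftrightarrow> Z 1"
    using c(1) part7_eq_0_iff(1)[OF lB] by (simp add: endo_trace_eq[OF B])
  show "sigma_form G B \<in> Lambda2_14 G \<phi> \<longleftrightarrow> Z 7"
    using c(2) part7_eq_0_iff(2)[OF lB] by (simp add: sigma_form_Lambda2_14[OF B])
  show "sigma_form G B \<in> Lambda2_7 \<phi> \<longleftrightarrow> Z 14"
    using c(3) part7_eq_0_iff(3)[OF lB] by (simp add: sigma_form_Lambda2_7[OF B])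
  have "(\<forall>v. B v + endo_transpose G B v - (2/7 * endo_trace B) *\<^sub>R v = 0)
      \<longleftrightarrow> (\<forall>v. pull B (C v) + transpose7 (pull B) (C v) - (2/7 * trace7 (pull B)) *\<^sub>R C v = 0)"
    unfolding p27 E_eq_0_iff ..
  then show "(\<forall>v. B v + endo_transpose G B v - (2/7 * endo_trace B) *\<^sub>R v = 0) \<longleftrightarrow> Z 27"
    using c(4) part7_eq_0_iff(4)[OF lB]
      ball_C[of "\<lambda>x. pull B x + transpose7 (pull B) x - (2/7 * trace7 (pull B)) *\<^sub>R x = 0"] by simp
  have "(\<forall>v. B v + endo_transpose G B v = 0) \<longleftrightarrow> (\<forall>v. pull B (C v) + transpose7 (pull B) (C v) = 0)"
    unfolding sum E_eq_0_iff ..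
  then show "(\<forall>v. B v + endo_transpose G B v = 0) \<longleftrightarrow> Z 1 \<and> Z 27"
    using c(1,4) part7_eq_0_sym_iff[OF lB] ball_C[of "\<lambda>x. pull B x + transpose7 (pull B) x = 0"] by simp
  have "(\<forall>v. B v - endo_transpose G B v = 0) \<longleftrightarrow> (\<forall>v. pull B (C v) - transpose7 (pull B) (C v) = 0)"
    unfolding diff E_eq_0_iff ..
  then show "(\<forall>v. B v - endo_transpose G B v = 0) \<longleftrightarrow> Z 7 \<and> Z 14"
    using c(2,3) part7_eq_0_skew_iff[OF lB] ball_C[of "\<lambda>x. pull B x - transpose7 (pull B) x = 0"] by simp
  \<comment> \<open>Rewritten as a difference, so that the injective map \<open>E\<close> can be
    stripped off.\<close>
  have "(\<forall>v. B v = (1/7 * endo_trace B) *\<^sub>R v) \<longleftrightarrow> (\<forall>v. B v - (1/7 * endo_trace B) *\<^sub>R v = 0)"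
    by (simp only: right_minus_eq)
  also have "\<dots> \<longleftrightarrow> (\<forall>v. pull B (C v) - (1/7 * trace7 (pull B)) *\<^sub>R C v = 0)"
    unfolding p1 E_eq_0_iff ..
  finally show "(\<forall>v. B v = (1/7 * endo_trace B) *\<^sub>R v) \<longleftrightarrow> Z 7 \<and> Z 14 \<and> Z 27"
    using c(2-4) part7_eq_0_scalar_iff[of "pull B"]
      ball_C[of "\<lambda>x. pull B x - (1/7 * trace7 (pull B)) *\<^sub>R x = 0"] by simp
  have "B v = 0 \<longleftrightarrow> pull B (C v) = 0" for v
    using E_eq_0_iff[of "pull B (C v)"] by (simp add: pull_def)
  then have "(\<forall>v. B v = 0) \<longleftrightarrow> (\<forall>v. pull B (C v) = 0)" by blast
  then show "(\<forall>v. B v = 0) \<longleftrightarrow> Z 1 \<and> Z 7 \<and> Z 14 \<and> Z 27"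
    using c part7_eq_0_all_iff[of "pull B"] ball_C[of "\<lambda>x. pull B x = 0"] by simp
qed

lemma V_sum_iff_component:
  "I \<subseteq> {1, 7, 14, 27} \<Longrightarrow> B \<in> V_sum G \<phi> I \<longleftrightarrow> (\<forall>k\<in>{1, 7, 14, 27} - I. Z k)"
  using V_sum_iff[OF B, of I] V_component_eq[OF B] by (metis Diff_iff)

end

end

context g2_chart
begin

text \<open>The frame in which K and L were computed serves the comparison only and no longer occurs
  in the statement.\<close>

lemma components_K_L:
  assumes x: "x \<in> U" and T: "linear T" and k: "k \<in> {1, 7, 14, 27}"
    and torsion: "\<And>z. nabla g \<phi> x z = interior (T z) (hodge (g x) (\<phi> x))"
  defines "K \<equiv> K_iso (g x) (\<phi> x) (pi7 (g x) (\<phi> x) (fn_bracket 2 cr ch x))"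
    and "L \<equiv> L_iso (g x) (fn_bracket 3 ch ch x)"
  shows "linear K" "linear L"
    "V_component (g x) (\<phi> x) k K = (\<lambda>v. 0) \<longleftrightarrow> V_component (g x) (\<phi> x) k T = (\<lambda>v. 0)"
    "V_component (g x) (\<phi> x) k L = (\<lambda>v. 0) \<longleftrightarrow> V_component (g x) (\<phi> x) k T = (\<lambda>v. 0)"
proof -
  obtain e where e: "g2_frame (g x) e (\<phi> x)" using g2_frame_at[OF x] .
  then interpret F: g2_frame "g x" e "\<phi> x" .
  note lT = F.linear_pull[OF T]
  have "linear (cross7 (skew_vector (F.pull T)))" using bilinear_cross7 by (simp add: bilinear_def)
  then show K: "linear K" and L: "linear L"
    unfolding K_def L_def K_eq[OF x torsion e T] L_eq[OF x torsion e T]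
    by (intro F.linear_push linear_compose_add linear_compose_sub linear_compose_scale_right lT
        linear_transpose7 linear_ident, intro F.linear_push linear_compose_add linear_compose_sub
        linear_compose_scale_right lT linear_transpose7 linear_ident)
  show "V_component (g x) (\<phi> x) k K = (\<lambda>v. 0) \<longleftrightarrow> V_component (g x) (\<phi> x) k T = (\<lambda>v. 0)"
    unfolding F.component_eq_0_iff[OF K k] F.component_eq_0_iff[OF T k]
    unfolding K_def K_eq[OF x torsion e T] F.pull_push part7_K[OF lT k] by simp
  show "V_component (g x) (\<phi> x) k L = (\<lambda>v. 0) \<longleftrightarrow> V_component (g x) (\<phi> x) k T = (\<lambda>v. 0)"
    unfolding F.component_eq_0_iff[OF L k] F.component_eq_0_iff[OF T k]
    unfolding L_def L_eq[OF x torsion e T] F.pull_push part7_L[OF lT k] by simp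
qed

end

section \<open>From a single chart to the manifold\<close>

lemma smooth_on_differentiable:
  assumes "smooth_on S f" "open S" "x \<in> S" shows "f differentiable (at x)"
proof -
  have "Ck_on (Suc 0) f S" using assms(1) unfolding smooth_on_def by blast
  then have "f differentiable_on S" by simp
  then show ?thesis using assms(2,3) by (simp add: differentiable_on_eq_differentiable_at)
qed

lemma on_M_cong: "(\<And>c x. c \<in> A \<Longrightarrow> x \<in> chart_image c \<Longrightarrow> P c x \<longleftrightarrow> Q c x) \<Longrightarrow> on_M A P \<longleftrightarrow> on_M A Q"
  by (simp add: on_M_def)

lemma on_M_conj: "on_M A P \<and> on_M A Q \<longleftrightarrow> on_M A (\<lambda>c x. P c x \<and> Q c x)"
  by (auto simp: on_M_def)

theorem mainTheorem3:
  fixes M :: "'m topology" and A :: "'m chart set"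
    and \<phi> :: "'m chart \<Rightarrow> real^7 \<Rightarrow> (real^7) list \<Rightarrow> real"
    and g :: "'m chart \<Rightarrow> real^7 \<Rightarrow> real^7 \<Rightarrow> real^7 \<Rightarrow> real"
    and T :: "'m chart \<Rightarrow> real^7 \<Rightarrow> real^7 \<Rightarrow> real^7"
  assumes "oriented_manifold M A"
    and "G2_structure A \<phi>"
    and "G2_metric A \<phi> g"
    and "torsion_endomorphism A \<phi> g T"
  shows
    "(\<forall>k\<in>{1, 7, 14, 27}.
        (component_vanishes A \<phi> g k T \<longleftrightarrow> component_vanishes A \<phi> g k (K_endo \<phi> g)) \<and>
        (component_vanishes A \<phi> g k (K_endo \<phi> g) \<longleftrightarrow> component_vanishes A \<phi> g k (L_endo \<phi> g))) \<and>
     (\<forall>B\<in>{T, K_endo \<phi> g, L_endo \<phi> g}.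
        let FG = fernandez_gray_class A \<phi> g T;
            tr_zero = on_M A (\<lambda>c x. endo_trace (B c x) = 0);
            sigma_7 = on_M A (\<lambda>c x. sigma_form (g c x) (B c x) \<in> Lambda2_7 (\<phi> c x));
            sigma_14 = on_M A (\<lambda>c x. sigma_form (g c x) (B c x) \<in> Lambda2_14 (g c x) (\<phi> c x));
            sym_part_pure_trace = on_M A (\<lambda>c x. \<forall>v. B c x v + endo_transpose (g c x) (B c x) v
                - (2/7 * endo_trace (B c x)) *\<^sub>R v = 0);
            skew = on_M A (\<lambda>c x. \<forall>v. B c x v + endo_transpose (g c x) (B c x) v = 0);
            symmetric = on_M A (\<lambda>c x. \<forall>v. B c x v - endo_transpose (g c x) (B c x) v = 0)
        in (FG {1, 7, 14, 27} \<longleftrightarrow> True) \<and>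
           (FG {7, 14, 27} \<longleftrightarrow> tr_zero) \<and>
           (FG {1, 14, 27} \<longleftrightarrow> sigma_14) \<and>
           (FG {1, 7, 27} \<longleftrightarrow> sigma_7) \<and>
           (FG {1, 7, 14} \<longleftrightarrow> sym_part_pure_trace) \<and>
           (FG {14, 27} \<longleftrightarrow> sigma_14 \<and> tr_zero) \<and>
           (FG {7, 27} \<longleftrightarrow> sigma_7 \<and> tr_zero) \<and>
           (FG {7, 14} \<longleftrightarrow> skew) \<and>
           (FG {1, 27} \<longleftrightarrow> symmetric) \<and>
           (FG {1, 14} \<longleftrightarrow> sym_part_pure_trace \<and> sigma_14) \<and>
           (FG {1, 7} \<longleftrightarrow> sym_part_pure_trace \<and> sigma_7) \<and>
           (FG {27} \<longleftrightarrow> symmetric \<and> tr_zero) \<and>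
           (FG {14} \<longleftrightarrow> skew \<and> sigma_14) \<and>
           (FG {7} \<longleftrightarrow> skew \<and> sigma_7) \<and>
           (FG {1} \<longleftrightarrow> on_M A (\<lambda>c x. \<forall>v. B c x v = (1/7 * endo_trace (B c x)) *\<^sub>R v)) \<and>
           (FG {} \<longleftrightarrow> on_M A (\<lambda>c x. \<forall>v. B c x v = 0)))"
proof -
  let ?Z = "\<lambda>B k c x. V_component (g c x) (\<phi> c x) k (B c x) = (\<lambda>v. 0)"
  have chart: "g2_chart (chart_image c) (g c) (\<phi> c)" if c: "c \<in> A" for c
  proof (rule g2_chart.intro)
    show op: "open (chart_image c)" using assms(1) c by (simp add: oriented_manifold_def)
    have m: "riemannian_metric A g" using assms(3) by (simp add: G2_metric_def)
    fix y assume y: "y \<in> chart_image c"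
    show "inner_product (g c y)"
      by (rule inner_product.intro) (use m c y in \<open>auto simp: riemannian_metric_def\<close>)
    show "\<exists>e. G2_frame (\<phi> c y) e \<and> orthonormal (g c y) e"
      using assms(2,3) c y unfolding G2_structure_def G2_metric_def on_M_def by blast
    fix u v
    have "smooth_on (chart_image c) (\<lambda>y. g c y u v)"
      using m c unfolding riemannian_metric_def by blast
    then show "(\<lambda>y. g c y u v) differentiable (at y)"
      using smooth_on_differentiable[OF _ op y] by blast
  next
    fix y vs assume y: "y \<in> chart_image c"
    have op: "open (chart_image c)" using assms(1) c by (simp add: oriented_manifold_def)
    have "smooth_on (chart_image c) (\<lambda>y. \<phi> c y vs)"
      using assms(2) c unfolding G2_structure_def form_field_def by blast
    then show "(\<lambda>y. \<phi> c y vs) differentiable (at y)"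
      using smooth_on_differentiable[OF _ op y] by blast
  qed
  have T: "linear (T c x)" "nabla (g c) (\<phi> c) x z = interior (T c x z) (hodge (g c x) (\<phi> c x))"
    if "c \<in> A" "x \<in> chart_image c" for c x z
    using assms(4) that unfolding torsion_endomorphism_def endo_field_def on_M_def by blast+
  have Cr: "Cr \<phi> g c = g2_chart.cr (g c) (\<phi> c)" and chi: "chi \<phi> g c = g2_chart.ch (g c) (\<phi> c)" if "c \<in> A" for c
    by (simp_all add: fun_eq_iff Cr_def chi_def g2_chart.cr_def[OF chart[OF that]] g2_chart.ch_def[OF chart[OF that]])
  \<comment> \<open>All three fields are linear at each point and have the same vanishing
    components, so the table can be proved for \<open>T\<close>, K and L simultaneously.\<close>
  have lin: "linear (B c x)" and eqZ: "?Z B k c x \<longleftrightarrow> ?Z T k c x"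
    if c: "c \<in> A" and x: "x \<in> chart_image c" and k: "k \<in> {1, 7, 14, 27}" and B: "B \<in> {T, K_endo \<phi> g, L_endo \<phi> g}" for c x k B
    using B T(1)[OF c x] g2_chart.components_K_L[OF chart[OF c] x T(1)[OF c x] k T(2)[OF c x]]
    unfolding K_endo_def[abs_def] L_endo_def[abs_def] Cr[OF c, symmetric] chi[OF c, symmetric] by auto
  have frame: "\<exists>e. g2_frame (g c x) e (\<phi> c x)" if "c \<in> A" "x \<in> chart_image c" for c x
    using g2_chart.g2_frame_at[OF chart[OF that(1)] that(2)] by blast
  \<comment> \<open>The class is defined through \<open>T\<close>, but is tested here on the
    components of \<open>B\<close> complementary to \<open>I\<close>.\<close>
  have FG: "fernandez_gray_class A \<phi> g T I \<longleftrightarrow> on_M A (\<lambda>c x. \<forall>k\<in>{1, 7, 14, 27} - I. ?Z B k c x)"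
    if I: "I \<subseteq> {1, 7, 14, 27}" and B: "B \<in> {T, K_endo \<phi> g, L_endo \<phi> g}" for I B
    unfolding fernandez_gray_class_def
  proof (rule on_M_cong)
    fix c x assume cx: "c \<in> A" "x \<in> chart_image c"
    obtain e where "g2_frame (g c x) e (\<phi> c x)" using frame[OF cx] by blast
    from g2_frame.V_sum_iff_component[OF this T(1)[OF cx] I]
    show "T c x \<in> V_sum (g c x) (\<phi> c x) I \<longleftrightarrow> (\<forall>k\<in>{1, 7, 14, 27} - I. ?Z B k c x)"
      using eqZ[OF cx _ B] by blast
  qed
  have vanish: "component_vanishes A \<phi> g k T \<longleftrightarrow> component_vanishes A \<phi> g k B"
    if "k \<in> {1, 7, 14, 27}" "B \<in> {T, K_endo \<phi> g, L_endo \<phi> g}" for k B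
    unfolding component_vanishes_def by (rule on_M_cong) (use eqZ that in blast)
  show ?thesis
  proof (intro conjI ballI)
    show "component_vanishes A \<phi> g k T \<longleftrightarrow> component_vanishes A \<phi> g k (K_endo \<phi> g)"
      and "component_vanishes A \<phi> g k (K_endo \<phi> g) \<longleftrightarrow> component_vanishes A \<phi> g k (L_endo \<phi> g)"
      if "k \<in> {1, 7, 14, 27}" for k
      using vanish[OF that] by auto
  next
    fix B assume B: "B \<in> {T, K_endo \<phi> g, L_endo \<phi> g}"
    have cond: "on_M A (\<lambda>c x. endo_trace (B c x) = 0) \<longleftrightarrow> on_M A (?Z B 1)"
      "on_M A (\<lambda>c x. sigma_form (g c x) (B c x) \<in> Lambda2_14 (g c x) (\<phi> c x)) \<longleftrightarrow> on_M A (?Z B 7)"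
      "on_M A (\<lambda>c x. sigma_form (g c x) (B c x) \<in> Lambda2_7 (\<phi> c x)) \<longleftrightarrow> on_M A (?Z B 14)"
      "on_M A (\<lambda>c x. \<forall>v. B c x v + endo_transpose (g c x) (B c x) v - (2/7 * endo_trace (B c x)) *\<^sub>R v = 0)
        \<longleftrightarrow> on_M A (?Z B 27)"
      "on_M A (\<lambda>c x. \<forall>v. B c x v + endo_transpose (g c x) (B c x) v = 0)
        \<longleftrightarrow> on_M A (\<lambda>c x. ?Z B 1 c x \<and> ?Z B 27 c x)"
      "on_M A (\<lambda>c x. \<forall>v. B c x v - endo_transpose (g c x) (B c x) v = 0)
        \<longleftrightarrow> on_M A (\<lambda>c x. ?Z B 7 c x \<and> ?Z B 14 c x)"
      "on_M A (\<lambda>c x. \<forall>v. B c x v = (1/7 * endo_trace (B c x)) *\<^sub>R v)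
        \<longleftrightarrow> on_M A (\<lambda>c x. ?Z B 7 c x \<and> ?Z B 14 c x \<and> ?Z B 27 c x)"
      "on_M A (\<lambda>c x. \<forall>v. B c x v = 0)
        \<longleftrightarrow> on_M A (\<lambda>c x. ?Z B 1 c x \<and> ?Z B 7 c x \<and> ?Z B 14 c x \<and> ?Z B 27 c x)"
      \<comment> \<open>The instance 1 is an arbitrary admissible component; linearity of
        \<open>B\<close> does not refer to it.\<close>
      using frame g2_frame.conditions[OF _ lin[OF _ _ _ B, of _ _ 1]]
      by (intro on_M_cong, metis insertI1)+
    \<comment> \<open>The components that have to vanish in each class.\<close>
    have D: "{1, 7, 14, 27} - {7, 14, 27} = {1 :: nat}" "{1, 7, 14, 27} - {1, 14, 27} = {7 :: nat}"
      "{1, 7, 14, 27} - {1, 7, 27} = {14 :: nat}" "{1, 7, 14, 27} - {1, 7, 14} = {27 :: nat}"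
      "{1, 7, 14, 27} - {14, 27} = {1, 7 :: nat}" "{1, 7, 14, 27} - {7, 27} = {1, 14 :: nat}"
      "{1, 7, 14, 27} - {7, 14} = {1, 27 :: nat}" "{1, 7, 14, 27} - {1, 27} = {7, 14 :: nat}"
      "{1, 7, 14, 27} - {1, 14} = {7, 27 :: nat}" "{1, 7, 14, 27} - {1, 7} = {14, 27 :: nat}"
      "{1, 7, 14, 27} - {27} = {1, 7, 14 :: nat}" "{1, 7, 14, 27} - {14} = {1, 7, 27 :: nat}"
      "{1, 7, 14, 27} - {7} = {1, 14, 27 :: nat}" "{1, 7, 14, 27} - {1} = {7, 14, 27 :: nat}"
      by auto
    note F = FG[OF _ B]
    show "let FG = fernandez_gray_class A \<phi> g T;
            tr_zero = on_M A (\<lambda>c x. endo_trace (B c x) = 0);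
            sigma_7 = on_M A (\<lambda>c x. sigma_form (g c x) (B c x) \<in> Lambda2_7 (\<phi> c x));
            sigma_14 = on_M A (\<lambda>c x. sigma_form (g c x) (B c x) \<in> Lambda2_14 (g c x) (\<phi> c x));
            sym_part_pure_trace = on_M A (\<lambda>c x. \<forall>v. B c x v + endo_transpose (g c x) (B c x) v
                - (2/7 * endo_trace (B c x)) *\<^sub>R v = 0);
            skew = on_M A (\<lambda>c x. \<forall>v. B c x v + endo_transpose (g c x) (B c x) v = 0);
            symmetric = on_M A (\<lambda>c x. \<forall>v. B c x v - endo_transpose (g c x) (B c x) v = 0)
        in (FG {1, 7, 14, 27} \<longleftrightarrow> True) \<and>
           (FG {7, 14, 27} \<longleftrightarrow> tr_zero) \<and>
           (FG {1, 14, 27} \<longleftrightarrow> sigma_14) \<and>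
           (FG {1, 7, 27} \<longleftrightarrow> sigma_7) \<and>
           (FG {1, 7, 14} \<longleftrightarrow> sym_part_pure_trace) \<and>
           (FG {14, 27} \<longleftrightarrow> sigma_14 \<and> tr_zero) \<and>
           (FG {7, 27} \<longleftrightarrow> sigma_7 \<and> tr_zero) \<and>
           (FG {7, 14} \<longleftrightarrow> skew) \<and>
           (FG {1, 27} \<longleftrightarrow> symmetric) \<and>
           (FG {1, 14} \<longleftrightarrow> sym_part_pure_trace \<and> sigma_14) \<and>
           (FG {1, 7} \<longleftrightarrow> sym_part_pure_trace \<and> sigma_7) \<and>
           (FG {27} \<longleftrightarrow> symmetric \<and> tr_zero) \<and>
           (FG {14} \<longleftrightarrow> skew \<and> sigma_14) \<and>
           (FG {7} \<longleftrightarrow> skew \<and> sigma_7) \<and>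
           (FG {1} \<longleftrightarrow> on_M A (\<lambda>c x. \<forall>v. B c x v = (1/7 * endo_trace (B c x)) *\<^sub>R v)) \<and>
           (FG {} \<longleftrightarrow> on_M A (\<lambda>c x. \<forall>v. B c x v = 0))"
      unfolding Let_def cond on_M_conj
      by (intro conjI; subst F; auto simp: on_M_def D)
  qed
qed

end
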